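(* Let $N\ge 3$ and let $\Omega\subset\mathbb{R}^N$ be a bounded domain. Then there exists an equilibrium measure for $\mathcal{E}$, i.e. there exists $\rho^\ast\in P(\partial\Omega)$ such that $$\mathcal{E}(\phi_{\rho^\ast})=\inf_{\rho\in P(\partial\Omega)}\mathcal{E}(\phi_\rho).$$
   Context: $P(\partial\Omega)$ is the set of positive Borel measures $\rho$ on $\mathbb{R}^N$ supported on $\partial\Omega$ with $\rho(\partial\Omega)=1$. $D^{1,2}(\mathbb{R}^N)$ is the completion of $C_c^\infty(\mathbb{R}^N)$ with respect to $\|\nabla\cdot\|_{L^2}$. Set $\mathcal{X}=D^{1,2}(\mathbb{R}^N)\cap\{\phi\in C^{0,1}(\mathbb{R}^N):\|\nabla\phi\|_\infty\le 1\}$; functions in $\mathcal X$ are bounded, continuous and tend to $0$ at infinity. For $\rho\in P(\partial\Omega)$ let $$\mathcal{I}_\rho(\phi)=\int_{\mathbb{R}^N}\left(1-\sqrt{1-|\nabla\phi|^2}\right)dx-\langle\rho,\phi\rangle,\quad \phi\in\mathcal{X},\qquad \langle\rho,\phi\rangle=\int_{\partial\Omega}\phi\,d\rho .$$ It is known that $\mathcal{I}_\rho$ has a unique minimizer on $\mathcal{X}$, denoted $\phi_\rho$. The electrostatic energy is $\mathcal{E}(\phi_\rho):=-\mathcal{I}_\rho(\phi_\rho)$. *)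

theory Defs
  imports "HOL-Analysis.Analysis"
begin

definition partial_deriv :: "'a::euclidean_space \<Rightarrow> ('a \<Rightarrow> real) \<Rightarrow> 'a \<Rightarrow> real" where
  "partial_deriv b f x = frechet_derivative f (at x) b"

text \<open>The pointwise gradient; only meaningful where \<open>f\<close> is differentiable.\<close>

definition grad :: "('a::euclidean_space \<Rightarrow> real) \<Rightarrow> 'a \<Rightarrow> 'a" where
  "grad f x = (\<Sum>b\<in>Basis. partial_deriv b f x *\<^sub>R b)"

fun Ck :: "nat \<Rightarrow> ('a::euclidean_space \<Rightarrow> real) \<Rightarrow> bool" where
  "Ck 0 f \<longleftrightarrow> continuous_on UNIV f"
| "Ck (Suc k) f \<longleftrightarrow> (\<forall>x. f differentiable (at x)) \<and> (\<forall>b\<in>Basis. Ck k (partial_deriv b f))"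

definition Cc_infinity :: "('a::euclidean_space \<Rightarrow> real) set" where
  "Cc_infinity = {f. (\<forall>k. Ck k f) \<and> compact (closure {x. f x \<noteq> 0})}"

definition locally_integrable :: "('a::euclidean_space \<Rightarrow> 'b::{banach, second_countable_topology}) \<Rightarrow> bool" where
  "locally_integrable f \<longleftrightarrow> (\<forall>K. compact K \<longrightarrow> set_integrable lborel K f)"

definition has_weak_gradient :: "('a::euclidean_space \<Rightarrow> real) \<Rightarrow> ('a \<Rightarrow> 'a) \<Rightarrow> bool" where
  "has_weak_gradient u g \<longleftrightarrow> locally_integrable u \<and> locally_integrable g \<and>
     (\<forall>\<psi>\<in>Cc_infinity. (LINT x|lborel. u x *\<^sub>R grad \<psi> x) = - (LINT x|lborel. \<psi> x *\<^sub>R g x))"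

text \<open>The weak gradient is determined almost everywhere; a representative is chosen.\<close>

definition weak_grad :: "('a::euclidean_space \<Rightarrow> real) \<Rightarrow> 'a \<Rightarrow> 'a" where
  "weak_grad u = (SOME g. has_weak_gradient u g)"

definition dirichlet_norm :: "('a::euclidean_space \<Rightarrow> real) \<Rightarrow> real" where
  "dirichlet_norm f = sqrt (LINT x|lborel. (norm (grad f x))\<^sup>2)"

definition sobolev_exponent :: "'a::euclidean_space itself \<Rightarrow> real" where
  "sobolev_exponent _ = 2 * real DIM('a) / (real DIM('a) - 2)"

text \<open>
  The completion of \<^const>\<open>Cc_infinity\<close> with respect to \<^const>\<open>dirichlet_norm\<close>, for dimension
  at least 3, realised as a space of functions: by the Sobolev inequality every Cauchy sequence
  for this norm converges in \<open>L\<^sup>p\<close> with \<open>p = 2N/(N - 2)\<close>, and the class of the sequence is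
  identified with this limit. The elements are functions, not classes modulo null sets.
\<close>

definition D12 :: "('a::euclidean_space \<Rightarrow> real) set" where
  "D12 = {u \<in> borel_measurable lborel. \<exists>f :: nat \<Rightarrow> 'a \<Rightarrow> real.
     (\<forall>n. f n \<in> Cc_infinity) \<and>
     (\<forall>e>0. \<exists>M. \<forall>m\<ge>M. \<forall>n\<ge>M. dirichlet_norm (\<lambda>x. f m x - f n x) < e) \<and>
     (\<lambda>n. \<integral>\<^sup>+x. ennreal (\<bar>f n x - u x\<bar> powr sobolev_exponent TYPE('a)) \<partial>lborel) \<longlonglongrightarrow> 0}"

definition BI_space :: "('a::euclidean_space \<Rightarrow> real) set" where
  "BI_space = D12 \<inter> {\<phi>. (\<exists>L. L-lipschitz_on UNIV \<phi>) \<and> (AE x in lborel. norm (weak_grad \<phi> x) \<le> 1)}"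

definition boundary_prob :: "'a::euclidean_space set \<Rightarrow> 'a measure set" where
  "boundary_prob \<Omega> = {\<rho>. sets \<rho> = sets borel \<and> emeasure \<rho> (- frontier \<Omega>) = 0 \<and>
     emeasure \<rho> (frontier \<Omega>) = 1}"

definition BI_functional ::
  "'a::euclidean_space set \<Rightarrow> 'a measure \<Rightarrow> ('a \<Rightarrow> real) \<Rightarrow> real" where
  "BI_functional \<Omega> \<rho> \<phi> =
     (LINT x|lborel. 1 - sqrt (1 - (norm (weak_grad \<phi> x))\<^sup>2)) - (LINT x:frontier \<Omega>|\<rho>. \<phi> x)"

definition potential :: "'a::euclidean_space set \<Rightarrow> 'a measure \<Rightarrow> 'a \<Rightarrow> real" where
  "potential \<Omega> \<rho> = (THE \<phi>. is_arg_min (BI_functional \<Omega> \<rho>) (\<lambda>\<phi>. \<phi> \<in> BI_space) \<phi>)"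

definition electrostatic_energy :: "'a::euclidean_space set \<Rightarrow> 'a measure \<Rightarrow> real" where
  "electrostatic_energy \<Omega> \<rho> = - BI_functional \<Omega> \<rho> (potential \<Omega> \<rho>)"

end

theory Submission
  imports Defs "HOL-Probability.Probability"
begin

text \<open>
  Writing \<open>J\<close> for the gradient part of the functional, the energy of \<open>\<rho>\<close> is the supremum of
  \<open>\<integral> \<phi> d\<rho> - J \<phi>\<close> over all admissible \<open>\<phi>\<close>. The admissible functions are bounded and continuous, so the energy is
  lower semicontinuous for weak convergence, and the probability measures on the compact boundary are
  weakly sequentially compact; a minimizing sequence therefore has a subsequence converging to an
  equilibrium measure.

  What needs work is that the supremum is attained at exactly one function, as the potential is
  selected by a definite description. The density \<open>1 - sqrt (1 - |p|\<^sup>2)\<close> is uniformly convex, so a minimizing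
  sequence of the functional is Cauchy for the Dirichlet norm. For the difference \<open>u\<close> of two admissible functions, which is
  2-Lipschitz, the Sobolev inequality bounds \<open>sup |u|\<^sup>N\<close> by a multiple of the Dirichlet integral of \<open>u\<close>. This gives coercivity,
  uniform convergence of the minimizing sequence, and uniqueness. That the limit is again admissible rests on the fact
  that a continuous function in the Dirichlet space whose gradient is bounded by 1 is 1-Lipschitz.
\<close>

section \<open>Powers of extended nonnegative reals and Hoelder inequalities\<close>

text \<open>Admissible functions are handled as pairs of a function and a limit \<open>G\<close> of
  gradients of test functions: \<open>weak_grad\<close> is an arbitrary choice, tied to
  \<open>G\<close> only by uniqueness almost everywhere. As minimizing sequences converge strongly,
  weak compactness of the Dirichlet space does not enter. The power N in the bound for sup |u| comes
  from geometry: a 2-Lipschitz \<open>u\<close> keeps at least half its value on a ball of radius |u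
  x| / 4, so the Sobolev integral controls |u x| to the power p + N, and p + N is N times the
  exponent N / (N - 2) of the Dirichlet integral. The Sobolev inequality itself is derived from
  Gagliardo's inequality for line integrals. \<open>BI_space\<close> asserts only some Lipschitz
  constant; the constant 1, common to all admissible functions, has to be extracted from the
  gradient bound. Weak compactness of measures is brought down to the real line, where tightness
  yields it: a continuous curve through all points of the boundary has a Borel section, along which
  the measures are pushed to [0, 1]; the limit is pushed back along the curve.\<close>

definition ennreal_powr :: "ennreal \<Rightarrow> real \<Rightarrow> ennreal" where
  "ennreal_powr x r = (if r = 0 then 1 else if x = \<top> then \<top> else ennreal (enn2real x powr r))"

lemma measurable_ennreal_powr [measurable]:
  assumes [measurable]: "f \<in> borel_measurable M"
  shows "(\<lambda>x. ennreal_powr (f x) r) \<in> borel_measurable M"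
  unfolding ennreal_powr_def by measurable

text \<open>Exponent 0 must give 1 at every base, also at 0 (where \<open>powr\<close> gives 0) and
  at \<top>: in the products below an exponent may shrink to 0, and its factor then has to
  disappear.\<close>

lemma ennreal_powr_0 [simp]: "ennreal_powr x 0 = 1"
  by (simp add: ennreal_powr_def)

lemma ennreal_powr_1 [simp]: "ennreal_powr x 1 = x"
  by (cases x) (auto simp: ennreal_powr_def)

lemma ennreal_powr_zero [simp]: "r \<noteq> 0 \<Longrightarrow> ennreal_powr 0 r = 0"
  by (simp add: ennreal_powr_def)

lemma ennreal_powr_top [simp]: "r \<noteq> 0 \<Longrightarrow> ennreal_powr \<top> r = \<top>"
  by (simp add: ennreal_powr_def)

lemma ennreal_powr_ennreal: "a \<ge> 0 \<Longrightarrow> r \<noteq> 0 \<Longrightarrow> ennreal_powr (ennreal a) r = ennreal (a powr r)"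
  by (simp add: ennreal_powr_def)

lemma ennreal_powr_eq_0_iff: "r > 0 \<Longrightarrow> ennreal_powr x r = 0 \<longleftrightarrow> x = 0"
  by (cases x) (auto simp: ennreal_powr_def ennreal_eq_0_iff)

lemma ennreal_powr_add:
  assumes "r \<ge> 0" "s \<ge> 0"
  shows "ennreal_powr x (r + s) = ennreal_powr x r * ennreal_powr x s"
proof (cases "r = 0 \<or> s = 0")
  case False
  with assms have "r > 0" "s > 0" "r + s \<noteq> 0" by auto
  then show ?thesis
    by (cases x) (auto simp: ennreal_powr_def powr_add ennreal_mult)
qed auto

lemma ennreal_powr_mono: "r \<ge> 0 \<Longrightarrow> x \<le> y \<Longrightarrow> ennreal_powr x r \<le> ennreal_powr y r"
  by (cases x; cases y) (auto simp: ennreal_powr_def powr_mono2 top_unique)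

lemma ennreal_powr_mult:
  assumes "r \<ge> 0"
  shows "ennreal_powr (x * y) r = ennreal_powr x r * ennreal_powr y r"
proof (cases "r = 0")
  case False
  then have r: "r > 0" using assms by simp
  have t: "ennreal a * \<top> = (if a \<le> 0 then 0 else \<top>)" "\<top> * ennreal a = (if a \<le> 0 then 0 else \<top>)" for a
    by (auto simp: ennreal_neg ennreal_mult_top ennreal_top_mult ennreal_eq_0_iff)
  show ?thesis
    using r by (cases x; cases y) (auto simp: ennreal_powr_def powr_mult t ennreal_mult[symmetric] enn2real_mult)
qed auto

lemma ennreal_powr_powr:
  assumes "r > 0" "s > 0"
  shows "ennreal_powr (ennreal_powr x r) s = ennreal_powr x (r * s)"
  using assms by (cases x) (auto simp: ennreal_powr_def powr_powr)

lemma ennreal_powr_prod: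
  "r \<ge> 0 \<Longrightarrow> ennreal_powr (\<Prod>i\<in>S. h i) r = (\<Prod>i\<in>S. ennreal_powr (h i) r)"
proof (induction S rule: infinite_finite_induct)
  case (insert i S)
  then show ?case by (simp add: ennreal_powr_mult)
qed (auto simp: ennreal_powr_def)

lemma ennreal_Young:
  assumes "0 < t" "t < 1"
  shows "ennreal_powr x (1 - t) * ennreal_powr y t \<le> ennreal (1 - t) * x + ennreal t * y"
proof (cases x; cases y)
  fix a b :: real
  assume x: "x = ennreal a" "0 \<le> a" and y: "y = ennreal b" "0 \<le> b"
  have "a powr (1 - t) * b powr t \<le> (1 - t) * a + t * b"
  proof (cases "a = 0 \<or> b = 0")
    case True
    then show ?thesis using assms x y by auto
  next
    case False
    then show ?thesis
      using Youngs_inequality_0[of "1 - t" t a b] assms x y by auto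
  qed
  then show ?thesis
    using x y assms by (simp add: ennreal_powr_ennreal ennreal_mult[symmetric] ennreal_plus[symmetric] ennreal_leI
        del: ennreal_plus)
qed (use assms in \<open>auto simp: ennreal_powr_def ennreal_mult_top ennreal_eq_0_iff\<close>)

text \<open>Exponents \<open>1 - t\<close> and \<open>t\<close> sit on the functions themselves,
  which suits iteration better than conjugate norms. After division by the integrals, Young's
  inequality is integrated; the integrals 0 and \<top> are split off because the division is
  meaningless there.\<close>

lemma Hoelder_ennreal:
  assumes [measurable]: "f \<in> borel_measurable M" "g \<in> borel_measurable M"
    and t: "0 \<le> t" "t \<le> 1"
  shows "(\<integral>\<^sup>+x. ennreal_powr (f x) (1 - t) * ennreal_powr (g x) t \<partial>M)
    \<le> ennreal_powr (\<integral>\<^sup>+x. f x \<partial>M) (1 - t) * ennreal_powr (\<integral>\<^sup>+x. g x \<partial>M) t"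
proof (cases "t = 0 \<or> t = 1")
  case False
  then have t: "0 < t" "t < 1" using t by auto
  define A where "A = (\<integral>\<^sup>+x. f x \<partial>M)"
  define B where "B = (\<integral>\<^sup>+x. g x \<partial>M)"
  show ?thesis
  proof (cases "A = 0 \<or> B = 0")
    case True
    then have "(AE x in M. f x = 0) \<or> (AE x in M. g x = 0)"
      unfolding A_def B_def by (auto simp: nn_integral_0_iff_AE)
    then have "AE x in M. ennreal_powr (f x) (1 - t) * ennreal_powr (g x) t = 0"
      using t by auto
    then have "(\<integral>\<^sup>+x. ennreal_powr (f x) (1 - t) * ennreal_powr (g x) t \<partial>M) = 0"
      by (subst nn_integral_0_iff_AE) auto
    then show ?thesis by simp
  next
    case AB0: False
    show ?thesis
    proof (cases "A = \<top> \<or> B = \<top>")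
      case True
      then have "ennreal_powr A (1 - t) * ennreal_powr B t = \<top>"
        using AB0 t by (auto simp: ennreal_mult_eq_top_iff ennreal_powr_eq_0_iff)
      then show ?thesis unfolding A_def B_def by simp
    next
      case False
      then obtain a b where a: "A = ennreal a" "a > 0" and b: "B = ennreal b" "b > 0"
        using AB0 by (cases A; cases B) (auto simp: less_le)
      have fa: "f x = A * (f x / A)" for x
        using a by (cases "f x") (auto simp: divide_ennreal ennreal_mult[symmetric] ennreal_top_divide ennreal_mult_top)
      have gb: "g x = B * (g x / B)" for x
        using b by (cases "g x") (auto simp: divide_ennreal ennreal_mult[symmetric] ennreal_top_divide ennreal_mult_top)
      have A1: "(\<integral>\<^sup>+x. f x / A \<partial>M) = 1"
        using a by (simp add: nn_integral_divide A_def[symmetric] divide_ennreal)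
      have B1: "(\<integral>\<^sup>+x. g x / B \<partial>M) = 1"
        using b by (simp add: nn_integral_divide B_def[symmetric] divide_ennreal)
      have "(\<integral>\<^sup>+x. ennreal_powr (f x) (1 - t) * ennreal_powr (g x) t \<partial>M)
        = (\<integral>\<^sup>+x. (ennreal_powr A (1 - t) * ennreal_powr B t)
            * (ennreal_powr (f x / A) (1 - t) * ennreal_powr (g x / B) t) \<partial>M)"
        by (intro nn_integral_cong, subst (1) fa, subst (1) gb)
           (use t in \<open>simp add: ennreal_powr_mult mult_ac\<close>)
      also have "\<dots> = (ennreal_powr A (1 - t) * ennreal_powr B t)
            * (\<integral>\<^sup>+x. ennreal_powr (f x / A) (1 - t) * ennreal_powr (g x / B) t \<partial>M)"
        by (rule nn_integral_cmult) measurable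
      also have "\<dots> \<le> (ennreal_powr A (1 - t) * ennreal_powr B t)
            * (\<integral>\<^sup>+x. ennreal (1 - t) * (f x / A) + ennreal t * (g x / B) \<partial>M)"
        by (intro mult_left_mono nn_integral_mono ennreal_Young t) simp
      also have "(\<integral>\<^sup>+x. ennreal (1 - t) * (f x / A) + ennreal t * (g x / B) \<partial>M) = 1"
        using t by (simp add: nn_integral_add nn_integral_cmult A1 B1 ennreal_plus[symmetric] del: ennreal_plus)
      finally show ?thesis by (simp add: A_def B_def)
    qed
  qed
qed auto

text \<open>The base function \<open>f\<close> takes whatever exponent the \<open>h j\<close> leave
  over, so the exponents always sum to 1. In \<open>grid_lines\<close> this remainder may still be
  positive.\<close>

lemma Hoelder_ennreal_prod:
  assumes "finite S" "f \<in> borel_measurable M" "\<And>j. j \<in> S \<Longrightarrow> h j \<in> borel_measurable M"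
    and "0 \<le> q" "real (card S) * q \<le> 1"
  shows "(\<integral>\<^sup>+x. ennreal_powr (f x) (1 - real (card S) * q) * (\<Prod>j\<in>S. ennreal_powr (h j x) q) \<partial>M)
    \<le> ennreal_powr (\<integral>\<^sup>+x. f x \<partial>M) (1 - real (card S) * q) * (\<Prod>j\<in>S. ennreal_powr (\<integral>\<^sup>+x. h j x \<partial>M) q)"
  using assms
proof (induction S arbitrary: q rule: finite_induct)
  case empty
  then show ?case by simp
next
  case (insert i S)
  note [measurable] = insert.prems(1) and hi [measurable] = insert.prems(2)[of i, simplified]
  have hS [measurable]: "h j \<in> borel_measurable M" if "j \<in> S" for j
    using insert.prems(2) that by auto
  define n where "n = real (card S)"
  have n: "real (card (insert i S)) = n + 1" "n \<ge> 0"
    using insert.hyps by (auto simp: n_def)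
  have q: "q \<ge> 0" "(n + 1) * q \<le> 1" using insert.prems n by auto
  show ?case
  \<comment> \<open>For \<open>q = 1\<close> the remainder forces \<open>S\<close> to be empty, and
    \<open>b\<close> below would divide by 0.\<close>
  proof (cases "q = 1")
    case True
    then have "S = {}" using q n insert.hyps by (auto simp: n_def)
    then show ?thesis using True by simp
  next
    case False
    have "q \<le> (n + 1) * q" using q n by (simp add: algebra_simps)
    then have q1: "q < 1" using q False by linarith
    \<comment> \<open>Rescaled exponent for the induction hypothesis: raised to the power
      \<open>1 - q\<close>, the exponents \<open>b\<close> and \<open>1 - n * b\<close> become
      \<open>q\<close> and \<open>1 - (n + 1) * q\<close>.\<close>
    define b where "b = q / (1 - q)"
    have b: "b \<ge> 0" "n * b \<le> 1" "(1 - n * b) * (1 - q) = 1 - (n + 1) * q" "b * (1 - q) = q"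
      using q q1 n by (auto simp: b_def field_simps)
    define F where "F x = ennreal_powr (f x) (1 - n * b) * (\<Prod>j\<in>S. ennreal_powr (h j x) b)" for x
    have [measurable]: "F \<in> borel_measurable M"
      unfolding F_def by measurable
    have pp: "ennreal_powr (ennreal_powr x r) (1 - q) = ennreal_powr x (r * (1 - q))" if "r \<ge> 0" for x r
      using that q1 ennreal_powr_powr[of r "1 - q" x] by (cases "r = 0") (auto simp: ennreal_powr_def)
    have dist: "ennreal_powr (ennreal_powr x (1 - n * b) * (\<Prod>j\<in>S. ennreal_powr (k j) b)) (1 - q)
      = ennreal_powr x (1 - (n + 1) * q) * (\<Prod>j\<in>S. ennreal_powr (k j) q)" for x k
      using q1 b by (simp add: ennreal_powr_mult ennreal_powr_prod pp)
    have "(\<integral>\<^sup>+x. ennreal_powr (f x) (1 - (n + 1) * q) * (\<Prod>j\<in>insert i S. ennreal_powr (h j x) q) \<partial>M)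
      = (\<integral>\<^sup>+x. ennreal_powr (F x) (1 - q) * ennreal_powr (h i x) q \<partial>M)"
      unfolding F_def dist using insert.hyps by (simp add: mult_ac)
    also have "\<dots> \<le> ennreal_powr (\<integral>\<^sup>+x. F x \<partial>M) (1 - q) * ennreal_powr (\<integral>\<^sup>+x. h i x \<partial>M) q"
      by (intro Hoelder_ennreal) (use q q1 in auto)
    also have "\<dots> \<le> ennreal_powr (ennreal_powr (\<integral>\<^sup>+x. f x \<partial>M) (1 - n * b)
        * (\<Prod>j\<in>S. ennreal_powr (\<integral>\<^sup>+x. h j x \<partial>M) b)) (1 - q) * ennreal_powr (\<integral>\<^sup>+x. h i x \<partial>M) q"
      unfolding F_def n_def
      by (intro mult_right_mono ennreal_powr_mono insert.IH) (use q1 b hS in \<open>auto simp: n_def\<close>)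
    also have "\<dots> = ennreal_powr (\<integral>\<^sup>+x. f x \<partial>M) (1 - (n + 1) * q)
        * (\<Prod>j\<in>insert i S. ennreal_powr (\<integral>\<^sup>+x. h j x \<partial>M) q)"
      unfolding dist using insert.hyps by (simp add: mult_ac)
    finally show ?thesis unfolding n(1) .
  qed
qed

section \<open>The Gagliardo inequality\<close>

text \<open>The value does not depend on \<open>x i\<close>. In \<open>grid_lines\<close> this makes
  the factor in direction \<open>i\<close> a constant for the integration over the
  \<open>i\<close>-th coordinate.\<close>

definition line_integral :: "'i \<Rightarrow> (('i \<Rightarrow> real) \<Rightarrow> ennreal) \<Rightarrow> ('i \<Rightarrow> real) \<Rightarrow> ennreal" where
  "line_integral i f x = (\<integral>\<^sup>+t. f (x(i := t)) \<partial>lborel)"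

lemma product_sigma_finite_lborel: "product_sigma_finite (\<lambda>_. lborel :: real measure)"
  by unfold_locales

lemma measurable_line_integral:
  assumes f [measurable]: "f \<in> borel_measurable (Pi\<^sub>M (insert i S) (\<lambda>_. lborel))"
  shows "line_integral i f \<in> borel_measurable (Pi\<^sub>M S (\<lambda>_. lborel))"
proof -
  have "(\<lambda>(x, t). f (x(i := t))) \<in> borel_measurable (Pi\<^sub>M S (\<lambda>_. lborel) \<Otimes>\<^sub>M lborel)"
    using measurable_compose[OF measurable_add_dim f] by (simp add: case_prod_unfold)
  then show ?thesis
    unfolding line_integral_def by measurable
qed

text \<open>
  The grid-lines lemma of van Doorn and Macbeth. For \<open>q = 1 / (card S - 1)\<close> the exponent of
  \<open>f\<close> on the left vanishes; it is the intermediate exponents that make the induction work.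
\<close>

lemma grid_lines:
  assumes "finite S" "0 \<le> q" "real (card S) * q \<le> 1 + q"
    and "f \<in> borel_measurable (Pi\<^sub>M S (\<lambda>_. lborel))"
  shows "(\<integral>\<^sup>+x. ennreal_powr (f x) (1 + q - real (card S) * q) *
      (\<Prod>j\<in>S. ennreal_powr (line_integral j f x) q) \<partial>Pi\<^sub>M S (\<lambda>_. lborel))
    \<le> ennreal_powr (\<integral>\<^sup>+x. f x \<partial>Pi\<^sub>M S (\<lambda>_. lborel)) (1 + q)"
  using assms
proof (induction S arbitrary: f rule: finite_induct)
  case empty
  show ?case by (simp add: PiM_empty nn_integral_count_space_finite)
next
  case (insert i S)
  interpret P: product_sigma_finite "\<lambda>_. lborel :: real measure" by (rule product_sigma_finite_lborel)
  let ?M = "Pi\<^sub>M S (\<lambda>_. lborel :: real measure)"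
  note f [measurable] = insert.prems(3)
  note q = insert.prems(1)
  define n where "n = real (card S)"
  have n: "real (card (insert i S)) = n + 1" "n \<ge> 0"
    using insert.hyps by (auto simp: n_def)
  have nq: "n * q \<le> 1" using insert.prems(2) n by (simp add: algebra_simps)
  define F where "F = line_integral i f"
  have F [measurable]: "F \<in> borel_measurable ?M"
    unfolding F_def by (rule measurable_line_integral[OF f])
  have F_upd: "line_integral i f (x(i := y)) = F x" for x y
    by (simp add: line_integral_def F_def)
  have mes2: "(\<lambda>p. f ((x(j := snd p))(i := fst p))) \<in> borel_measurable (lborel \<Otimes>\<^sub>M lborel)"
    if x: "x \<in> space ?M" and j: "j \<in> S" for x j
  proof -
    have "(\<lambda>p. x) \<in> measurable (lborel \<Otimes>\<^sub>M lborel) ?M" using x by simp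
    then have "(\<lambda>p. x(j := snd p)) \<in> measurable (lborel \<Otimes>\<^sub>M lborel) ?M"
      by (rule measurable_fun_upd[where J=S, rotated]) (use j in auto)
    then have "(\<lambda>p. (x(j := snd p))(i := fst p)) \<in> measurable (lborel \<Otimes>\<^sub>M lborel) (Pi\<^sub>M (insert i S) (\<lambda>_. lborel))"
      by (rule measurable_fun_upd[where J=S, rotated]) auto
    then show ?thesis by (rule measurable_compose[OF _ f])
  qed
  have mes1: "(\<lambda>y. f (x(i := y))) \<in> borel_measurable lborel" if x: "x \<in> space ?M" for x
  proof -
    have "(\<lambda>y. x(i := y)) \<in> measurable lborel (Pi\<^sub>M (insert i S) (\<lambda>_. lborel))"
      by (rule measurable_fun_upd[where J=S]) (use x in auto)
    then show ?thesis by (rule measurable_compose[OF _ f])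
  qed
  have mesl: "(\<lambda>y. line_integral j f (x(i := y))) \<in> borel_measurable lborel"
    if x: "x \<in> space ?M" and j: "j \<in> S" for x j
  proof -
    have ne: "j \<noteq> i" using insert.hyps j by auto
    have "(\<lambda>y. \<integral>\<^sup>+t. f ((x(j := snd (y, t)))(i := fst (y, t))) \<partial>lborel) \<in> borel_measurable lborel"
      by (rule sigma_finite_measure.borel_measurable_nn_integral_fst[OF sigma_finite_lborel mes2[OF x j]])
    then show ?thesis
      using ne by (simp add: line_integral_def fun_upd_twist)
  qed
  \<comment> \<open>By Tonelli, integrating the line integral in direction \<open>j\<close> over the
    \<open>i\<close>-th coordinate gives the line integral of the marginal \<open>F\<close>, the
    term that the induction hypothesis for \<open>F\<close> expects.\<close>
  have swap: "(\<integral>\<^sup>+y. line_integral j f (x(i := y)) \<partial>lborel) = line_integral j F x"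
    if x: "x \<in> space ?M" and j: "j \<in> S" for x j
  proof -
    have ne: "j \<noteq> i" using insert.hyps j by auto
    have "(\<integral>\<^sup>+y. \<integral>\<^sup>+t. f ((x(j := t))(i := y)) \<partial>lborel \<partial>lborel)
      = (\<integral>\<^sup>+t. \<integral>\<^sup>+y. f ((x(j := t))(i := y)) \<partial>lborel \<partial>lborel)"
      using lborel_pair.Fubini[OF mes2[OF x j]] by simp
    then show ?thesis
      using ne by (simp add: line_integral_def F_def fun_upd_twist)
  qed
  have mesline: "line_integral j f \<in> borel_measurable (Pi\<^sub>M (insert i S) (\<lambda>_. lborel))" if "j \<in> insert i S" for j
    by (rule measurable_line_integral) (use that f in \<open>simp add: insert_absorb\<close>)
  have "(\<integral>\<^sup>+x. ennreal_powr (f x) (1 - n * q) *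
      (\<Prod>j\<in>insert i S. ennreal_powr (line_integral j f x) q) \<partial>Pi\<^sub>M (insert i S) (\<lambda>_. lborel))
    = (\<integral>\<^sup>+x. \<integral>\<^sup>+y. ennreal_powr (f (x(i := y))) (1 - n * q) *
      (\<Prod>j\<in>insert i S. ennreal_powr (line_integral j f (x(i := y))) q) \<partial>lborel \<partial>?M)"
  proof (rule P.product_nn_integral_insert[OF insert.hyps])
    have [measurable]: "\<And>j. j \<in> insert i S \<Longrightarrow> line_integral j f \<in> borel_measurable (Pi\<^sub>M (insert i S) (\<lambda>_. lborel))"
      by (rule mesline)
    show "(\<lambda>x. ennreal_powr (f x) (1 - n * q) * (\<Prod>j\<in>insert i S. ennreal_powr (line_integral j f x) q))
        \<in> borel_measurable (Pi\<^sub>M (insert i S) (\<lambda>_. lborel))"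
      by measurable
  qed
  also have "\<dots> = (\<integral>\<^sup>+x. ennreal_powr (F x) q * (\<integral>\<^sup>+y. ennreal_powr (f (x(i := y))) (1 - n * q) *
      (\<Prod>j\<in>S. ennreal_powr (line_integral j f (x(i := y))) q) \<partial>lborel) \<partial>?M)"
  proof (intro nn_integral_cong)
    fix x assume x: "x \<in> space ?M"
    note [measurable] = mes1[OF x]
    have [measurable]: "\<And>j. j \<in> S \<Longrightarrow> (\<lambda>y. line_integral j f (x(i := y))) \<in> borel_measurable lborel"
      by (rule mesl[OF x])
    have "(\<integral>\<^sup>+y. ennreal_powr (f (x(i := y))) (1 - n * q) *
      (\<Prod>j\<in>insert i S. ennreal_powr (line_integral j f (x(i := y))) q) \<partial>lborel)
     = (\<integral>\<^sup>+y. ennreal_powr (F x) q * (ennreal_powr (f (x(i := y))) (1 - n * q) *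
      (\<Prod>j\<in>S. ennreal_powr (line_integral j f (x(i := y))) q)) \<partial>lborel)"
      using insert.hyps by (simp add: F_upd mult_ac)
    also have "\<dots> = ennreal_powr (F x) q * (\<integral>\<^sup>+y. ennreal_powr (f (x(i := y))) (1 - n * q) *
      (\<Prod>j\<in>S. ennreal_powr (line_integral j f (x(i := y))) q) \<partial>lborel)"
      by (rule nn_integral_cmult) measurable
    finally show "(\<integral>\<^sup>+y. ennreal_powr (f (x(i := y))) (1 - n * q) *
      (\<Prod>j\<in>insert i S. ennreal_powr (line_integral j f (x(i := y))) q) \<partial>lborel) = \<dots>" .
  qed
  \<comment> \<open>Hoelder in the single variable \<open>y\<close>: exponent
    \<open>1 - n * q\<close> on \<open>f\<close> and \<open>q\<close> on each of the
    \<open>n\<close> remaining line integrals.\<close>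
  also have "\<dots> \<le> (\<integral>\<^sup>+x. ennreal_powr (F x) q * (ennreal_powr (\<integral>\<^sup>+y. f (x(i := y)) \<partial>lborel) (1 - n * q) *
      (\<Prod>j\<in>S. ennreal_powr (\<integral>\<^sup>+y. line_integral j f (x(i := y)) \<partial>lborel) q)) \<partial>?M)"
  proof (intro nn_integral_mono mult_left_mono)
    fix x assume x: "x \<in> space ?M"
    show "(\<integral>\<^sup>+y. ennreal_powr (f (x(i := y))) (1 - n * q) *
        (\<Prod>j\<in>S. ennreal_powr (line_integral j f (x(i := y))) q) \<partial>lborel)
      \<le> ennreal_powr (\<integral>\<^sup>+y. f (x(i := y)) \<partial>lborel) (1 - n * q) *
      (\<Prod>j\<in>S. ennreal_powr (\<integral>\<^sup>+y. line_integral j f (x(i := y)) \<partial>lborel) q)"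
      unfolding n_def
      by (rule Hoelder_ennreal_prod[OF insert.hyps(1) mes1[OF x] mesl[OF x]]) (use q nq in \<open>auto simp: n_def\<close>)
  qed simp
  \<comment> \<open>The factor \<open>F\<close> to the power \<open>q\<close> pulled out above joins
    the power \<open>1 - n * q\<close> left by Hoelder; the sum is the exponent that the statement
    has for \<open>S\<close>.\<close>
  also have "\<dots> = (\<integral>\<^sup>+x. ennreal_powr (F x) (1 + q - n * q) *
      (\<Prod>j\<in>S. ennreal_powr (line_integral j F x) q) \<partial>?M)"
  proof (intro nn_integral_cong)
    fix x assume x: "x \<in> space ?M"
    have e: "q + (1 - n * q) = 1 + q - n * q" by simp
    have a: "ennreal_powr (F x) q * ennreal_powr (F x) (1 - n * q) = ennreal_powr (F x) (1 + q - n * q)"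
      unfolding e[symmetric] by (rule ennreal_powr_add[symmetric]) (use q nq in auto)
    have b: "(\<integral>\<^sup>+y. f (x(i := y)) \<partial>lborel) = F x"
      by (simp add: F_def line_integral_def)
    have c: "(\<Prod>j\<in>S. ennreal_powr (\<integral>\<^sup>+y. line_integral j f (x(i := y)) \<partial>lborel) q)
        = (\<Prod>j\<in>S. ennreal_powr (line_integral j F x) q)"
      by (intro prod.cong refl) (simp add: swap[OF x])
    show "ennreal_powr (F x) q * (ennreal_powr (\<integral>\<^sup>+y. f (x(i := y)) \<partial>lborel) (1 - n * q) *
      (\<Prod>j\<in>S. ennreal_powr (\<integral>\<^sup>+y. line_integral j f (x(i := y)) \<partial>lborel) q))
      = ennreal_powr (F x) (1 + q - n * q) * (\<Prod>j\<in>S. ennreal_powr (line_integral j F x) q)"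
      unfolding b c mult.assoc[symmetric] a ..
  qed
  also have "\<dots> \<le> ennreal_powr (\<integral>\<^sup>+x. F x \<partial>?M) (1 + q)"
    unfolding n_def by (rule insert.IH) (use q nq F n_def in auto)
  also have "(\<integral>\<^sup>+x. F x \<partial>?M) = (\<integral>\<^sup>+x. f x \<partial>Pi\<^sub>M (insert i S) (\<lambda>_. lborel))"
    unfolding F_def line_integral_def
    by (rule P.product_nn_integral_insert[symmetric]) (use insert.hyps in auto)
  finally show ?case
    unfolding n(1) by (simp add: algebra_simps)
qed

text \<open>With \<open>q = 1 / (N - 1)\<close>, the power \<open>1 + q\<close> of \<open>u\<close>
  is a product of N factors with exponent \<open>q\<close>, and the factor for \<open>b\<close> is
  bounded by the line integral of \<open>g\<close> in direction \<open>b\<close>. The result is the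
  integrand of \<open>grid_lines\<close> with exponent 0 on \<open>g\<close>.\<close>

lemma Gagliardo_inequality:
  fixes u g :: "'a::euclidean_space \<Rightarrow> ennreal"
  assumes [measurable]: "u \<in> borel_measurable borel" "g \<in> borel_measurable borel"
    and le: "\<And>b x. b \<in> Basis \<Longrightarrow> u x \<le> (\<integral>\<^sup>+t. g (x + t *\<^sub>R b) \<partial>lborel)"
    and N: "DIM('a) \<ge> 2"
  shows "(\<integral>\<^sup>+x. ennreal_powr (u x) (real DIM('a) / (real DIM('a) - 1)) \<partial>lborel)
    \<le> ennreal_powr (\<integral>\<^sup>+x. g x \<partial>lborel) (real DIM('a) / (real DIM('a) - 1))"
proof -
  define E where "E y = (\<Sum>b\<in>Basis. y b *\<^sub>R b)" for y :: "'a \<Rightarrow> real"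
  define q where "q = 1 / (real DIM('a) - 1)"
  have q: "q > 0" "1 + q - real DIM('a) * q = 0" "1 + q = real DIM('a) / (real DIM('a) - 1)"
    using N by (auto simp: q_def field_simps)
  have E [measurable]: "E \<in> borel_measurable (Pi\<^sub>M Basis (\<lambda>_. lborel))"
    unfolding E_def by measurable
  have lb: "(lborel :: 'a measure) = distr (Pi\<^sub>M Basis (\<lambda>_. lborel)) borel E"
    unfolding E_def by (rule lborel_eq)
  have E_upd: "E (y(b := t)) = E y + (t - y b) *\<^sub>R b" if "b \<in> Basis" for y b t
    using that by (simp add: E_def sum.remove[where x=b] scaleR_diff_left)
  have line: "u (E y) \<le> line_integral b (\<lambda>y. g (E y)) y" if b: "b \<in> Basis" for y b
  proof -
    have "(\<integral>\<^sup>+t. g (E y + t *\<^sub>R b) \<partial>lborel) = (\<integral>\<^sup>+t. g (E y + (- y b + 1 * t) *\<^sub>R b) \<partial>lborel)"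
      using nn_integral_real_affine[of "\<lambda>t. g (E y + t *\<^sub>R b)" 1 "- y b"] by simp
    also have "\<dots> = line_integral b (\<lambda>y. g (E y)) y"
      by (simp add: line_integral_def E_upd[OF b] algebra_simps)
    finally show ?thesis using le[OF b, of "E y"] by simp
  qed
  have "(\<integral>\<^sup>+x. ennreal_powr (u x) (1 + q) \<partial>lborel)
    = (\<integral>\<^sup>+y. ennreal_powr (u (E y)) (1 + q) \<partial>Pi\<^sub>M Basis (\<lambda>_. lborel))"
    by (subst lb) (simp add: nn_integral_distr)
  also have "\<dots> = (\<integral>\<^sup>+y. (\<Prod>b\<in>(Basis :: 'a set). ennreal_powr (u (E y)) q) \<partial>Pi\<^sub>M Basis (\<lambda>_. lborel))"
  proof (intro nn_integral_cong)
    fix y :: "'a \<Rightarrow> real"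
    have "(\<Prod>b\<in>S. ennreal_powr z q) = ennreal_powr z (real (card S) * q)" if "finite S" for S :: "'a set" and z
      using that
    proof (induction S rule: finite_induct)
      case (insert i S)
      have "real (card (insert i S)) * q = q + real (card S) * q"
        using insert.hyps by (simp add: algebra_simps)
      then show ?case using insert q by (simp add: ennreal_powr_add)
    qed simp
    then show "ennreal_powr (u (E y)) (1 + q) = (\<Prod>b\<in>(Basis :: 'a set). ennreal_powr (u (E y)) q)"
      using q by (simp del: prod_constant)
  qed
  also have "\<dots> \<le> (\<integral>\<^sup>+y. (\<Prod>b\<in>Basis. ennreal_powr (line_integral b (\<lambda>y. g (E y)) y) q) \<partial>Pi\<^sub>M Basis (\<lambda>_. lborel))"
  proof (intro nn_integral_mono)
    fix y :: "'a \<Rightarrow> real"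
    have "(\<Prod>b\<in>S. ennreal_powr (u (E y)) q) \<le> (\<Prod>b\<in>S. ennreal_powr (line_integral b (\<lambda>y. g (E y)) y) q)"
      if "finite S" "S \<subseteq> Basis" for S :: "'a set"
      using that
    proof (induction S rule: finite_induct)
      case (insert b S)
      then have "ennreal_powr (u (E y)) q \<le> ennreal_powr (line_integral b (\<lambda>y. g (E y)) y) q"
        using q by (intro ennreal_powr_mono line) auto
      then show ?case
        using insert by (simp del: prod_constant add: mult_mono)
    qed simp
    from this[of Basis] show "(\<Prod>b\<in>(Basis :: 'a set). ennreal_powr (u (E y)) q)
        \<le> (\<Prod>b\<in>Basis. ennreal_powr (line_integral b (\<lambda>y. g (E y)) y) q)"
      by simp
  qed
  also have "\<dots> \<le> ennreal_powr (\<integral>\<^sup>+y. g (E y) \<partial>Pi\<^sub>M Basis (\<lambda>_. lborel)) (1 + q)"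
    using grid_lines[of "Basis :: 'a set" q "\<lambda>y. g (E y)"] q by simp
  also have "(\<integral>\<^sup>+y. g (E y) \<partial>Pi\<^sub>M Basis (\<lambda>_. lborel)) = (\<integral>\<^sup>+x. g x \<partial>lborel)"
    by (subst lb) (simp add: nn_integral_distr)
  finally show ?thesis using q by simp
qed

section \<open>Smooth functions of compact support\<close>

lemma partial_deriv_eqI: "(f has_derivative f') (at x) \<Longrightarrow> partial_deriv b f x = f' b"
  unfolding partial_deriv_def by (simp add: frechet_derivative_at[symmetric])

lemma grad_inner_eqI:
  assumes "(f has_derivative f') (at x)"
  shows "grad f x \<bullet> v = f' v"
proof -
  have lin: "linear f'" using assms by (simp add: has_derivative_bounded_linear bounded_linear.linear)
  have "f' v = f' (\<Sum>b\<in>Basis. (v \<bullet> b) *\<^sub>R b)" by (simp add: euclidean_representation)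
  also have "\<dots> = (\<Sum>b\<in>Basis. (v \<bullet> b) * f' b)"
    using lin by (simp add: linear_sum linear_scale)
  finally show ?thesis
    by (simp add: grad_def partial_deriv_eqI[OF assms] inner_sum_left inner_commute[of v] mult.commute)
qed

lemma has_derivative_grad:
  assumes "f differentiable (at x)"
  shows "(f has_derivative (\<lambda>v. grad f x \<bullet> v)) (at x)"
proof -
  obtain f' where f': "(f has_derivative f') (at x)"
    using assms by (auto simp: differentiable_def)
  have "(\<lambda>v. grad f x \<bullet> v) = f'" using grad_inner_eqI[OF f'] by auto
  with f' show ?thesis by simp
qed

lemma grad_linear_combination:
  assumes "f differentiable (at x)" "g differentiable (at x)"
  shows "grad (\<lambda>x. a * f x + b * g x) x = a *\<^sub>R grad f x + b *\<^sub>R grad g x"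
proof (rule vector_eq_rdot[THEN iffD1], rule allI)
  fix v
  have "((\<lambda>x. a * f x + b * g x) has_derivative (\<lambda>v. a * (grad f x \<bullet> v) + b * (grad g x \<bullet> v))) (at x)"
    by (intro has_derivative_add has_derivative_mult_right has_derivative_grad assms)
  from grad_inner_eqI[OF this]
  show "grad (\<lambda>x. a * f x + b * g x) x \<bullet> v = (a *\<^sub>R grad f x + b *\<^sub>R grad g x) \<bullet> v"
    by (simp add: inner_add_left)
qed

lemma grad_inner_Basis: "b \<in> Basis \<Longrightarrow> grad f x \<bullet> b = partial_deriv b f x"
  by (simp add: grad_def inner_sum_left inner_Basis if_distrib cong: if_cong)

section \<open>Functions of class C^k\<close>

lemma Ck_SucD: "Ck (Suc k) f \<Longrightarrow> Ck k f"
proof (induction k arbitrary: f)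
  case 0
  then show ?case
    by (auto intro!: continuous_at_imp_continuous_on differentiable_imp_continuous_within)
next
  case (Suc k)
  then show ?case using Ck.simps(2)[of "Suc k" f] Ck.simps(2)[of k f] by blast
qed

lemma Ck_const: "Ck k (\<lambda>x. c)"
proof (induction k arbitrary: c)
  case (Suc k)
  have "partial_deriv b (\<lambda>x. c) = (\<lambda>x. 0)" for b :: 'a
    by (rule ext) (simp add: partial_deriv_eqI[OF has_derivative_const])
  then show ?case using Suc by simp
qed simp

lemma Ck_linear_combination: "Ck k f \<Longrightarrow> Ck k g \<Longrightarrow> Ck k (\<lambda>x. a * f x + b * g x)"
proof (induction k arbitrary: f g)
  case 0
  then show ?case by (auto intro!: continuous_intros)
next
  case (Suc k)
  have d: "f differentiable (at x)" "g differentiable (at x)" for x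
    using Suc.prems by auto
  have "partial_deriv c (\<lambda>x. a * f x + b * g x) = (\<lambda>x. a * partial_deriv c f x + b * partial_deriv c g x)"
    if "c \<in> Basis" for c
    by (rule ext) (simp add: grad_inner_Basis[OF that, symmetric] grad_linear_combination[OF d] inner_add_left)
  then show ?case using Suc d by simp
qed

lemma Ck_mult: "Ck k f \<Longrightarrow> Ck k g \<Longrightarrow> Ck k (\<lambda>x. f x * g x)"
proof (induction k arbitrary: f g)
  case 0
  then show ?case by (auto intro!: continuous_intros)
next
  case (Suc k)
  have d: "f differentiable (at x)" "g differentiable (at x)" for x
    using Suc.prems by auto
  have "partial_deriv c (\<lambda>x. f x * g x)
      = (\<lambda>x. 1 * (f x * partial_deriv c g x) + 1 * (partial_deriv c f x * g x))"
    if "c \<in> Basis" for c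
    by (rule ext) (simp add: partial_deriv_eqI[OF has_derivative_mult[OF d[THEN has_derivative_grad]]]
      grad_inner_Basis[OF that])
  moreover have "Ck k (\<lambda>x. 1 * (f x * partial_deriv c g x) + 1 * (partial_deriv c f x * g x))"
    if "c \<in> Basis" for c
    by (intro Ck_linear_combination Suc.IH Suc.prems[THEN Ck_SucD]) (use Suc.prems that in auto)
  ultimately show ?case using d by simp
qed

lemma Ck_prod: "(\<And>i. i \<in> I \<Longrightarrow> Ck k (f i)) \<Longrightarrow> Ck k (\<lambda>x. \<Prod>i\<in>I. f i x)"
  by (induction I rule: infinite_finite_induct) (auto intro: Ck_const Ck_mult)

text \<open>\<open>H\<close> lists a function with all its derivatives. A partial derivative
  replaces \<open>H n\<close> by a multiple of \<open>H (Suc n)\<close>, so the claim for all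
  \<open>n\<close> at once is what the induction on \<open>k\<close> needs.\<close>

lemma Ck_ridge:
  assumes H: "\<And>n t. (H n has_real_derivative H (Suc n) t) (at t)"
  shows "Ck k (\<lambda>x. H n (c * (x \<bullet> v) + d))"
proof (induction k arbitrary: n)
  case 0
  have "continuous_on UNIV (H n)"
    using H by (auto intro!: continuous_at_imp_continuous_on DERIV_isCont)
  then show ?case
    by (auto intro!: continuous_intros continuous_on_compose2[of UNIV "H n"])
next
  case (Suc k)
  have D: "((\<lambda>x. H n (c * (x \<bullet> v) + d)) has_derivative (\<lambda>w. H (Suc n) (c * (x \<bullet> v) + d) * (c * (w \<bullet> v)))) (at x)" for x
    by (auto intro!: derivative_eq_intros
        has_derivative_compose[OF _ H[of n, THEN has_field_derivative_imp_has_derivative]])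
  have "partial_deriv b (\<lambda>x. H n (c * (x \<bullet> v) + d))
      = (\<lambda>x. (c * (b \<bullet> v)) * H (Suc n) (c * (x \<bullet> v) + d) + 0 * H (Suc n) (c * (x \<bullet> v) + d))" for b
    by (rule ext) (simp add: partial_deriv_eqI[OF D])
  moreover have "Ck k (\<lambda>x. (c * (b \<bullet> v)) * H (Suc n) (c * (x \<bullet> v) + d) + 0 * H (Suc n) (c * (x \<bullet> v) + d))" for b
    by (intro Ck_linear_combination Suc.IH)
  ultimately show ?case
    using D unfolding Ck.simps by (auto intro: differentiableI)
qed

section \<open>Test functions\<close>

lemma Cc_infinity_iff: "f \<in> Cc_infinity \<longleftrightarrow> (\<forall>k. Ck k f) \<and> bounded {x. f x \<noteq> 0}"
  by (simp add: Cc_infinity_def)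

lemma Cc_infinity_Ck: "f \<in> Cc_infinity \<Longrightarrow> Ck k f"
  by (simp add: Cc_infinity_iff)

lemma Cc_infinity_linear_combination:
  assumes "f \<in> Cc_infinity" "g \<in> Cc_infinity"
  shows "(\<lambda>x. a * f x + b * g x) \<in> Cc_infinity"
proof -
  have "{x. a * f x + b * g x \<noteq> 0} \<subseteq> {x. f x \<noteq> 0} \<union> {x. g x \<noteq> 0}" by auto
  then have "bounded {x. a * f x + b * g x \<noteq> 0}"
    by (rule bounded_subset[rotated]) (use assms in \<open>simp add: Cc_infinity_iff\<close>)
  then show ?thesis
    using assms by (simp add: Cc_infinity_iff Ck_linear_combination)
qed

lemma Cc_infinity_diff: "f \<in> Cc_infinity \<Longrightarrow> g \<in> Cc_infinity \<Longrightarrow> (\<lambda>x. f x - g x) \<in> Cc_infinity"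
  using Cc_infinity_linear_combination[of f g 1 "-1"] by simp

lemma Cc_infinity_zero: "(\<lambda>x. 0) \<in> Cc_infinity"
  by (simp add: Cc_infinity_iff Ck_const)

lemma Cc_infinity_differentiable: "f \<in> Cc_infinity \<Longrightarrow> f differentiable (at x)"
  using Cc_infinity_Ck[of f 1] by simp

lemma Cc_infinity_continuous: "f \<in> Cc_infinity \<Longrightarrow> continuous_on UNIV f"
  using Cc_infinity_Ck[of f 0] by simp

lemma Cc_infinity_continuous_grad: "f \<in> Cc_infinity \<Longrightarrow> continuous_on UNIV (grad f)"
  using Cc_infinity_Ck[of f 1] unfolding grad_def[abs_def] by (auto intro!: continuous_intros)

lemma grad_diff:
  assumes "f \<in> Cc_infinity" "g \<in> Cc_infinity"
  shows "grad (\<lambda>x. f x - g x) x = grad f x - grad g x"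
  using grad_linear_combination[OF assms[THEN Cc_infinity_differentiable], of 1 "-1"] by simp

lemma Cc_infinity_support:
  assumes "f \<in> Cc_infinity"
  shows "\<exists>R>0. \<forall>x. norm x \<ge> R \<longrightarrow> f x = 0 \<and> grad f x = 0"
proof -
  have "bounded {x. f x \<noteq> 0}" using assms by (simp add: Cc_infinity_iff)
  then obtain B where "\<forall>x\<in>{x. f x \<noteq> 0}. norm x \<le> B" unfolding bounded_iff ..
  then have B: "norm x \<le> B" if "f x \<noteq> 0" for x using that by simp
  define R where "R = \<bar>B\<bar> + 1"
  have 1: "f x = 0" if "norm x > R - 1" for x
    by (rule ccontr) (use B[of x] that in \<open>simp add: R_def\<close>)
  have 2: "grad f x = 0" if "norm x \<ge> R" for x
  proof -
    have "open {x. norm x > R - 1}" by (intro open_Collect_less continuous_intros)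
    then have "(f has_derivative (\<lambda>v. 0)) (at x)"
      by (rule has_derivative_transform_within_open[where f="\<lambda>x. 0", OF has_derivative_const])
         (use that 1 in auto)
    from grad_inner_eqI[OF this] show ?thesis
      using inner_eq_zero_iff[of "grad f x"] by simp
  qed
  show ?thesis by (rule exI[of _ R]) (use 1 2 in \<open>auto simp: R_def\<close>)
qed

section \<open>Smooth bumps from exp (- 1 / t)\<close>

definition flat_exp :: "real poly \<Rightarrow> real \<Rightarrow> real" where
  "flat_exp p t = (if t > 0 then poly p (1 / t) * exp (- (1 / t)) else 0)"

lemma poly_exp_minus_tendsto_0: "((\<lambda>s::real. poly p s * exp (- s)) \<longlongrightarrow> 0) at_top"
proof -
  have "((\<lambda>s::real. \<Sum>i\<le>degree p. coeff p i * (s ^ i / exp s)) \<longlongrightarrow> (\<Sum>i\<le>degree p. coeff p i * 0)) at_top"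
    by (intro tendsto_intros tendsto_power_div_exp_0)
  then show ?thesis
    by (simp add: poly_altdef exp_minus divide_inverse sum_distrib_right mult.assoc)
qed

lemma flat_exp_tendsto_0: "(flat_exp p \<longlongrightarrow> 0) (at_right 0)"
proof -
  have "((\<lambda>t::real. poly p (1 / t) * exp (- (1 / t))) \<longlongrightarrow> 0) (at_right 0)"
    using filterlim_compose[OF poly_exp_minus_tendsto_0 filterlim_inverse_at_top_right]
    by (simp add: inverse_eq_divide)
  then show ?thesis
    by (rule Lim_transform_eventually) (auto simp: flat_exp_def eventually_at_filter)
qed

text \<open>The family is closed under differentiation: with s = 1 / t, the derivative of p(s) exp
  (- s) in t is s^2 (p(s) - p'(s)) exp (- s). Hence all derivatives exist and extend by 0 across t =
  0.\<close>

lemma flat_exp_has_derivative: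
  "(flat_exp p has_real_derivative flat_exp ([:0, 0, 1:] * (p - pderiv p)) t) (at t)"
proof -
  consider "t > 0" | "t < 0" | "t = 0" by linarith
  then show ?thesis
  proof cases
    case 1
    have "((\<lambda>t. poly p (1 / t) * exp (- (1 / t))) has_real_derivative
        flat_exp ([:0, 0, 1:] * (p - pderiv p)) t) (at t)"
      using 1 by (auto intro!: derivative_eq_intros simp: flat_exp_def field_simps power2_eq_square)
    then show ?thesis
      by (rule DERIV_cong_ev[THEN iffD1, rotated -1])
         (use 1 in \<open>auto simp: flat_exp_def intro!: eventually_mono[OF eventually_nhds_in_open[of "{0<..}"]]\<close>)
  next
    case 2
    have "((\<lambda>t::real. 0) has_real_derivative flat_exp ([:0, 0, 1:] * (p - pderiv p)) t) (at t)"
      using 2 by (simp add: flat_exp_def)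
    then show ?thesis
      by (rule DERIV_cong_ev[THEN iffD1, rotated -1])
         (use 2 in \<open>auto simp: flat_exp_def intro!: eventually_mono[OF eventually_nhds_in_open[of "{..<0}"]]\<close>)
  next
    case 3
    \<comment> \<open>From the right, the difference quotient at 0 is again a flat exponential, for
      the polynomial \<open>[:0, 1:] * p\<close>.\<close>
    have r: "((\<lambda>h. flat_exp p h / h) \<longlongrightarrow> 0) (at_right 0)"
      by (rule Lim_transform_eventually[OF flat_exp_tendsto_0[of "[:0, 1:] * p"]])
         (auto simp: flat_exp_def eventually_at_filter)
    have l: "((\<lambda>h. flat_exp p h / h) \<longlongrightarrow> 0) (at_left 0)"
      by (rule Lim_transform_eventually[OF tendsto_const])
         (auto simp: flat_exp_def eventually_at_filter)
    have "((\<lambda>h. flat_exp p h / h) \<longlongrightarrow> 0) (at 0)"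
      using l r by (simp add: filterlim_split_at)
    then show ?thesis using 3 by (simp add: DERIV_def flat_exp_def)
  qed
qed

fun flat_exp_poly :: "nat \<Rightarrow> real poly" where
  "flat_exp_poly 0 = 1"
| "flat_exp_poly (Suc n) = [:0, 0, 1:] * (flat_exp_poly n - pderiv (flat_exp_poly n))"

text \<open>Pointwise approximation of indicators of open boxes is enough to test a locally
  integrable function, since boxes generate the Borel sets; this takes the place of
  mollification.\<close>

lemma box_bump:
  fixes a b :: "'a::euclidean_space"
  shows "\<exists>\<psi> :: nat \<Rightarrow> 'a \<Rightarrow> real. \<forall>n. \<psi> n \<in> Cc_infinity \<and>
    (\<forall>x. 0 \<le> \<psi> n x \<and> \<psi> n x \<le> 1 \<and> (x \<notin> box a b \<longrightarrow> \<psi> n x = 0)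
      \<and> (\<lambda>n. \<psi> n x) \<longlonglongrightarrow> indicator (box a b) x)"
proof -
  define e where "e = flat_exp 1"
  have e: "e t = (if t > 0 then exp (- (1 / t)) else 0)" for t
    by (simp add: e_def flat_exp_def)
  have e01: "0 \<le> e t" "e t \<le> 1" for t by (auto simp: e)
  \<comment> \<open>The signed distance to each face is scaled by \<open>c n\<close>:
    \<open>e (c n * s)\<close> tends to exp 0 = 1 for s > 0 and is 0 for s \<le> 0, which yields the
    indicator of the open box.\<close>
  define c where "c n = real (Suc n)" for n
  have c: "c n > 0" for n by (simp add: c_def)
  have e_lim: "(\<lambda>n. e (c n * s)) \<longlonglongrightarrow> (if s > 0 then 1 else 0)" for s
  proof (cases "s > 0")
    case True
    have "e (c n * s) = exp (- (1 / s * inverse (c n)))" for n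
      using True c[of n] by (simp add: e field_simps)
    moreover have "(\<lambda>n. exp (- (1 / s * inverse (c n)))) \<longlonglongrightarrow> exp (- (1 / s * 0))"
      unfolding c_def by (intro tendsto_intros LIMSEQ_inverse_real_of_nat)
    ultimately show ?thesis using True by simp
  next
    case False
    then have "\<not> c n * s > 0" for n using c[of n] by (simp add: zero_less_mult_iff)
    then show ?thesis using False by (simp add: e)
  qed
  define \<psi> where "\<psi> n x = (\<Prod>i\<in>Basis. e (c n * (x \<bullet> i - a \<bullet> i)) * e (c n * (b \<bullet> i - x \<bullet> i)))"
    for n and x :: 'a
  have smooth: "Ck k (\<lambda>x::'a. e (m * (x \<bullet> v) + d))" for k m v d
  proof -
    have "Ck k (\<lambda>x::'a. flat_exp (flat_exp_poly 0) (m * (x \<bullet> v) + d))"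
      by (rule Ck_ridge[of "\<lambda>n. flat_exp (flat_exp_poly n)"]) (simp only: flat_exp_poly.simps flat_exp_has_derivative)
    then show ?thesis by (simp add: e_def)
  qed
  have "Ck k (\<psi> n)" for k n
  proof -
    have "\<psi> n = (\<lambda>x. \<Prod>i\<in>Basis. e (c n * (x \<bullet> i) + - (c n * (a \<bullet> i)))
        * e ((- c n) * (x \<bullet> i) + c n * (b \<bullet> i)))"
      by (rule ext) (simp add: \<psi>_def algebra_simps)
    then show ?thesis by (simp only:) (intro Ck_prod Ck_mult smooth)
  qed
  moreover have zero: "\<psi> n x = 0" if x: "x \<notin> box a b" for n x
  proof -
    obtain i where i: "i \<in> Basis" "\<not> (a \<bullet> i < x \<bullet> i \<and> x \<bullet> i < b \<bullet> i)"
      using x unfolding mem_box by blast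
    then have "e (c n * (x \<bullet> i - a \<bullet> i)) * e (c n * (b \<bullet> i - x \<bullet> i)) = 0"
      using c[of n] by (auto simp: e zero_less_mult_iff)
    then show ?thesis unfolding \<psi>_def by (intro prod_zero finite_Basis bexI[OF _ i(1)])
  qed
  moreover have "bounded {x. \<psi> n x \<noteq> 0}" for n
  proof (rule bounded_subset[OF bounded_box[of a b]])
    show "{x. \<psi> n x \<noteq> 0} \<subseteq> box a b" using zero[of _ n] by blast
  qed
  ultimately have 1: "\<psi> n \<in> Cc_infinity" for n by (simp add: Cc_infinity_iff)
  have 2: "0 \<le> \<psi> n x" for n x
    unfolding \<psi>_def by (intro prod_nonneg ballI mult_nonneg_nonneg e01)
  have le1: "\<psi> n x \<le> 1" for n x
    unfolding \<psi>_def by (intro prod_le_1 ballI conjI mult_nonneg_nonneg mult_le_one e01)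
  have 3: "(\<lambda>n. \<psi> n x) \<longlonglongrightarrow> indicator (box a b) x" for x
  proof -
    have "(\<lambda>n. \<psi> n x) \<longlonglongrightarrow> (\<Prod>i\<in>Basis. (if x \<bullet> i - a \<bullet> i > 0 then 1 else 0) * (if b \<bullet> i - x \<bullet> i > 0 then 1 else 0))"
      unfolding \<psi>_def by (intro tendsto_prod tendsto_mult e_lim)
    also have "(\<Prod>i\<in>Basis. (if x \<bullet> i - a \<bullet> i > 0 then 1 else 0) * (if b \<bullet> i - x \<bullet> i > 0 then 1 else 0))
        = indicat_real (box a b) x"
    proof (cases "x \<in> box a b")
      case True
      then have "a \<bullet> i < x \<bullet> i" "x \<bullet> i < b \<bullet> i" if "i \<in> Basis" for i
        using that unfolding mem_box by blast+
      then have "(\<Prod>i\<in>Basis. (if x \<bullet> i - a \<bullet> i > 0 then 1 else 0) * (if b \<bullet> i - x \<bullet> i > 0 then 1 else 0)) = (1::real)"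
        by (intro prod.neutral ballI) simp
      then show ?thesis using True by simp
    next
      case False
      then obtain i where i: "i \<in> Basis" "\<not> (a \<bullet> i < x \<bullet> i \<and> x \<bullet> i < b \<bullet> i)"
        unfolding mem_box by blast
      have "(\<Prod>i\<in>Basis. (if x \<bullet> i - a \<bullet> i > 0 then 1 else 0) * (if b \<bullet> i - x \<bullet> i > 0 then 1 else 0)) = (0::real)"
        by (intro prod_zero finite_Basis bexI[OF _ i(1)]) (use i in auto)
      then show ?thesis using False by simp
    qed
    finally show ?thesis .
  qed
  show ?thesis by (intro exI[of _ \<psi>] allI conjI impI) (fact 1 2 le1 zero 3)+
qed

section \<open>The Sobolev inequality\<close>

lemma integrable_compact_support:
  fixes h :: "'a::euclidean_space \<Rightarrow> 'b::{banach, second_countable_topology}"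
  assumes "continuous_on UNIV h" "\<And>x. norm x \<ge> R \<Longrightarrow> h x = 0"
  shows "integrable lborel h"
proof -
  have "integrable lborel (\<lambda>x. indicator (cball 0 R) x *\<^sub>R h x)"
    by (rule borel_integrable_compact) (auto intro: continuous_on_subset[OF assms(1)])
  moreover have "(\<lambda>x. indicator (cball 0 R) x *\<^sub>R h x) = h"
    using assms(2) by (auto simp: indicator_def fun_eq_iff)
  ultimately show ?thesis by simp
qed

lemma nn_integral_compact_support_finite:
  fixes h :: "'a::euclidean_space \<Rightarrow> real"
  assumes "continuous_on UNIV h" "\<And>x. norm x \<ge> R \<Longrightarrow> h x = 0" "\<And>x. 0 \<le> h x"
  shows "(\<integral>\<^sup>+x. ennreal (h x) \<partial>lborel) < \<top>"
  using integrable_compact_support[OF assms(1,2)] assms(3)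
  by (simp add: nn_integral_eq_integral)

lemma has_real_derivative_abs_powr:
  fixes s :: real
  assumes "\<gamma> > 1"
  shows "((\<lambda>s. \<bar>s\<bar> powr \<gamma>) has_real_derivative \<gamma> * \<bar>s\<bar> powr (\<gamma> - 1) * sgn s) (at s)"
proof -
  consider "s > 0" | "s < 0" | "s = 0" by linarith
  then show ?thesis
  proof cases
    case 1
    have "((\<lambda>s. s powr \<gamma>) has_real_derivative \<gamma> * \<bar>s\<bar> powr (\<gamma> - 1) * sgn s) (at s)"
      using 1 by (auto intro!: derivative_eq_intros)
    then show ?thesis
      by (rule DERIV_cong_ev[THEN iffD1, rotated -1])
         (use 1 in \<open>auto intro!: eventually_mono[OF eventually_nhds_in_open[of "{0<..}"]]\<close>)
  next
    case 2
    have "((\<lambda>s. (- s) powr \<gamma>) has_real_derivative \<gamma> * \<bar>s\<bar> powr (\<gamma> - 1) * sgn s) (at s)"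
      using 2 by (auto intro!: derivative_eq_intros)
    then show ?thesis
      by (rule DERIV_cong_ev[THEN iffD1, rotated -1])
         (use 2 in \<open>auto intro!: eventually_mono[OF eventually_nhds_in_open[of "{..<0}"]]\<close>)
  next
    case 3
    have "((\<lambda>h::real. \<bar>h\<bar> powr (\<gamma> - 1)) \<longlongrightarrow> \<bar>0\<bar> powr (\<gamma> - 1)) (at 0)"
      using assms by (intro tendsto_powr' tendsto_intros) auto
    then have "((\<lambda>h::real. \<bar>h\<bar> powr (\<gamma> - 1)) \<longlongrightarrow> 0) (at 0)" by simp
    then have "((\<lambda>h::real. \<bar>h\<bar> powr \<gamma> / h) \<longlongrightarrow> 0) (at 0)"
    proof (rule Lim_null_comparison[rotated])
      have "norm (\<bar>h\<bar> powr \<gamma> / h) \<le> \<bar>h\<bar> powr (\<gamma> - 1)" if "h \<noteq> 0" for h :: real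
        using that by (simp add: powr_diff)
      then show "\<forall>\<^sub>F h in at 0. norm (\<bar>h\<bar> powr \<gamma> / h) \<le> \<bar>h\<bar> powr (\<gamma> - 1)"
        by (auto simp: eventually_at_filter)
    qed
    then show ?thesis using 3 by (simp add: DERIV_def)
  qed
qed

text \<open>The bound is an integral with values in [0, \<infinity>], ready for Gagliardo's
  inequality and for Tonelli.\<close>

lemma FTC_nn_integral_bound:
  fixes \<phi> :: "real \<Rightarrow> real"
  assumes ab: "a \<le> b" and D: "\<And>t. (\<phi> has_vector_derivative d t) (at t)"
    and hc: "continuous_on UNIV h" and dh: "\<And>t. \<bar>d t\<bar> \<le> h t"
  shows "ennreal \<bar>\<phi> b - \<phi> a\<bar> \<le> (\<integral>\<^sup>+t. ennreal (indicator {a..b} t *\<^sub>R h t) \<partial>lborel)"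
proof -
  have h0: "h t \<ge> 0" for t using dh[of t] by linarith
  have hc': "continuous_on {a..b} h" using hc by (rule continuous_on_subset) auto
  have dI: "(d has_integral (\<phi> b - \<phi> a)) {a..b}"
    by (rule fundamental_theorem_of_calculus) (use ab D in \<open>auto intro: has_vector_derivative_at_within\<close>)
  then have "\<bar>\<phi> b - \<phi> a\<bar> = norm (integral {a..b} d)" by (simp add: integral_unique)
  also have "\<dots> \<le> integral {a..b} h"
    by (rule integral_norm_bound_integral[OF has_integral_integrable[OF dI] integrable_continuous_real[OF hc']])
       (use dh in auto)
  also have "\<dots> = (LINT t:{a..b}|lborel. h t)"
    by (rule set_borel_integral_eq_integral(2)[symmetric])
       (unfold set_integrable_def, rule borel_integrable_compact, use hc' in auto)
  finally have "ennreal \<bar>\<phi> b - \<phi> a\<bar> \<le> ennreal (LINT t:{a..b}|lborel. h t)" by (rule ennreal_leI)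
  also have "\<dots> = (\<integral>\<^sup>+t. ennreal (indicator {a..b} t *\<^sub>R h t) \<partial>lborel)"
    unfolding set_lebesgue_integral_def
    by (rule nn_integral_eq_integral[symmetric], rule borel_integrable_compact)
       (use hc' h0 in \<open>auto simp: indicator_def\<close>)
  finally show ?thesis .
qed

lemma has_real_derivative_along_line:
  fixes f :: "'a::euclidean_space \<Rightarrow> real"
  assumes f: "f \<in> Cc_infinity"
  shows "((\<lambda>t. f (x + t *\<^sub>R v)) has_real_derivative (grad f (x + t *\<^sub>R v) \<bullet> v)) (at t)"
proof -
  have "((\<lambda>t. x + t *\<^sub>R v) has_derivative (\<lambda>s. s *\<^sub>R v)) (at t)"
    by (auto intro!: derivative_eq_intros)
  from has_derivative_compose[OF this has_derivative_grad[OF Cc_infinity_differentiable[OF f]]]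
  have "((\<lambda>t. f (x + t *\<^sub>R v)) has_derivative (\<lambda>s. grad f (x + t *\<^sub>R v) \<bullet> (s *\<^sub>R v))) (at t)" .
  moreover have "(\<lambda>s. grad f (x + t *\<^sub>R v) \<bullet> (s *\<^sub>R v)) = (*) (grad f (x + t *\<^sub>R v) \<bullet> v)"
    by (rule ext) (simp add: mult.commute)
  ultimately show ?thesis
    unfolding has_field_derivative_def by (simp only:)
qed

text \<open>Fundamental theorem of calculus for |f| to the power \<gamma> along the line, started
  where \<open>f\<close> vanishes. This is the hypothesis of \<open>Gagliardo_inequality\<close>;
  \<gamma> > 1 makes the power differentiable at the zeros of \<open>f\<close>.\<close>

lemma abs_powr_le_line_integral:
  fixes f :: "'a::euclidean_space \<Rightarrow> real"
  assumes f: "f \<in> Cc_infinity" and b: "b \<in> Basis" and \<gamma>: "\<gamma> > 1"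
  shows "ennreal (\<bar>f x\<bar> powr \<gamma>)
    \<le> (\<integral>\<^sup>+t. ennreal (\<gamma> * \<bar>f (x + t *\<^sub>R b)\<bar> powr (\<gamma> - 1) * norm (grad f (x + t *\<^sub>R b))) \<partial>lborel)"
proof -
  obtain R where R: "R > 0" "\<And>x. norm x \<ge> R \<Longrightarrow> f x = 0" "\<And>x. norm x \<ge> R \<Longrightarrow> grad f x = 0"
    using Cc_infinity_support[OF f] by auto
  \<comment> \<open>As \<open>b\<close> is a unit vector, the point \<open>x - T *\<^sub>R b\<close>
    has norm at least T - norm x = R and lies where \<open>f\<close> vanishes.\<close>
  define T where "T = norm x + R"
  have T: "T \<ge> 0" using R by (simp add: T_def)
  have "norm (T *\<^sub>R b) \<le> norm (x - T *\<^sub>R b) + norm x"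
    using norm_triangle_ineq4[of x "x - T *\<^sub>R b"] by simp
  then have "norm (x - T *\<^sub>R b) \<ge> R"
    using R(1) b by (simp add: T_def)
  then have fT: "f (x + (-T) *\<^sub>R b) = 0"
    using R(2) by simp
  define \<phi> where "\<phi> t = \<bar>f (x + t *\<^sub>R b)\<bar> powr \<gamma>" for t
  define d where "d t = \<gamma> * \<bar>f (x + t *\<^sub>R b)\<bar> powr (\<gamma> - 1) * sgn (f (x + t *\<^sub>R b)) * (grad f (x + t *\<^sub>R b) \<bullet> b)" for t
  define h where "h t = \<gamma> * \<bar>f (x + t *\<^sub>R b)\<bar> powr (\<gamma> - 1) * norm (grad f (x + t *\<^sub>R b))" for t
  have h0: "h t \<ge> 0" for t using \<gamma> by (simp add: h_def)
  have cline: "continuous_on S (\<lambda>t. F (x + t *\<^sub>R b))" if "continuous_on UNIV F" for S and F :: "'a \<Rightarrow> 'c::topological_space"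
    by (rule continuous_on_compose2[OF that]) (auto intro!: continuous_intros)
  have hc: "continuous_on S h" for S
    unfolding h_def using \<gamma>
    by (intro continuous_intros continuous_on_powr' cline Cc_infinity_continuous Cc_infinity_continuous_grad f) auto
  have D: "(\<phi> has_vector_derivative d t) (at t)" for t
    unfolding \<phi>_def d_def
    by (rule has_real_derivative_iff_has_vector_derivative[THEN iffD1],
        rule DERIV_chain2[OF has_real_derivative_abs_powr[OF \<gamma>] has_real_derivative_along_line[OF f]])
  have dh: "\<bar>d t\<bar> \<le> h t" for t
  proof -
    have "\<bar>grad f (x + t *\<^sub>R b) \<bullet> b\<bar> \<le> norm (grad f (x + t *\<^sub>R b))"
      using b by (rule Basis_le_norm)
    moreover have "\<bar>sgn (f (x + t *\<^sub>R b))\<bar> \<le> 1" by (simp add: sgn_if)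
    ultimately have "\<bar>sgn (f (x + t *\<^sub>R b))\<bar> * \<bar>grad f (x + t *\<^sub>R b) \<bullet> b\<bar> \<le> 1 * norm (grad f (x + t *\<^sub>R b))"
      by (intro mult_mono) auto
    then have "(\<gamma> * \<bar>f (x + t *\<^sub>R b)\<bar> powr (\<gamma> - 1)) * (\<bar>sgn (f (x + t *\<^sub>R b))\<bar> * \<bar>grad f (x + t *\<^sub>R b) \<bullet> b\<bar>)
        \<le> (\<gamma> * \<bar>f (x + t *\<^sub>R b)\<bar> powr (\<gamma> - 1)) * norm (grad f (x + t *\<^sub>R b))"
      using \<gamma> by (intro mult_left_mono) auto
    then show ?thesis using \<gamma> by (simp add: d_def h_def abs_mult mult.assoc)
  qed
  have "\<bar>f x\<bar> powr \<gamma> = \<bar>\<phi> 0 - \<phi> (-T)\<bar>"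
    using fT by (simp add: \<phi>_def)
  then have "ennreal (\<bar>f x\<bar> powr \<gamma>) \<le> (\<integral>\<^sup>+t. ennreal (indicator {-T..0} t *\<^sub>R h t) \<partial>lborel)"
    using FTC_nn_integral_bound[of "-T" 0 \<phi> d h] T D hc dh by simp
  also have "\<dots> \<le> (\<integral>\<^sup>+t. ennreal (h t) \<partial>lborel)"
    by (intro nn_integral_mono) (auto simp: indicator_def h0)
  finally show ?thesis by (simp add: h_def)
qed

lemma Cc_infinity_borel_measurable [measurable_dest]:
  assumes "f \<in> Cc_infinity"
  shows "f \<in> borel_measurable borel"
  using Cc_infinity_continuous[OF assms] by (rule borel_measurable_continuous_onI)

lemma Cc_infinity_grad_borel_measurable:
  assumes "f \<in> Cc_infinity"
  shows "grad f \<in> borel_measurable borel"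
  using Cc_infinity_continuous_grad[OF assms] by (rule borel_measurable_continuous_onI)

text \<open>Absorption: \<open>a\<close> occurs on both sides, on the right to the power s / 2 < 1,
  so logarithms solve the inequality for \<open>a\<close>. That \<open>a\<close> is a real number,
  hence finite, is essential.\<close>

lemma powr_absorb:
  fixes a X s :: real
  assumes "0 \<le> a" "0 \<le> X" "0 < s" "s < 2" "a \<le> (X * a) powr (s / 2)"
  shows "a \<le> X powr (s / (2 - s))"
proof (cases "a = 0 \<or> X = 0")
  case False
  then have pos: "a > 0" "X > 0" using assms by auto
  have "ln a \<le> ln ((X * a) powr (s / 2))"
    by (subst ln_le_cancel_iff) (use assms(5) pos in auto)
  moreover have "ln ((X * a) powr (s / 2)) = s / 2 * (ln X + ln a)"
    unfolding ln_mult_pos[OF pos(2,1), symmetric] using pos by (intro ln_powr)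
  ultimately have "ln a \<le> s / 2 * (ln X + ln a)" by (simp only:)
  then have "(2 - s) * ln a \<le> s * ln X" by (simp add: algebra_simps)
  then have "ln a \<le> s / (2 - s) * ln X" using assms by (simp add: field_simps)
  then have "ln a \<le> ln (X powr (s / (2 - s)))" using pos by (simp add: ln_powr)
  then show ?thesis using pos by (subst (asm) ln_le_cancel_iff) auto
qed (use assms in auto)

text \<open>Gagliardo for |f| to the power \<gamma>, then Cauchy-Schwarz on the right. The value of
  \<gamma> makes both \<gamma> N / (N - 1) and 2 (\<gamma> - 1) equal to the Sobolev exponent p, so
  that the integral of |f| to the power p appears on both sides and can be absorbed.\<close>

lemma Sobolev_inequality_Cc_infinity:
  fixes f :: "'a::euclidean_space \<Rightarrow> real"
  assumes f: "f \<in> Cc_infinity" and N: "DIM('a) \<ge> 3"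
  shows "(\<integral>\<^sup>+x. ennreal (\<bar>f x\<bar> powr sobolev_exponent TYPE('a)) \<partial>lborel)
    \<le> ennreal_powr (ennreal ((2 * (real DIM('a) - 1) / (real DIM('a) - 2))\<^sup>2)
        * (\<integral>\<^sup>+x. ennreal ((norm (grad f x))\<^sup>2) \<partial>lborel)) (real DIM('a) / (real DIM('a) - 2))"
proof -
  define n where "n = real DIM('a)"
  have n: "n \<ge> 3" using N by (simp add: n_def)
  define p where "p = sobolev_exponent TYPE('a)"
  define \<gamma> where "\<gamma> = 2 * (n - 1) / (n - 2)"
  define s where "s = n / (n - 1)"
  have p: "p = 2 * n / (n - 2)" by (simp add: p_def sobolev_exponent_def n_def)
  have ex: "\<gamma> > 1" "p > 0" "\<gamma> * s = p" "p / 2 = \<gamma> - 1" "s / (2 - s) = n / (n - 2)" "0 < s" "s < 2"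
  proof -
    have nz: "n - 1 > 0" "n - 2 > 0" using n by auto
    have "2 - s = (n - 2) / (n - 1)" using nz by (simp add: s_def field_simps)
    then show "s / (2 - s) = n / (n - 2)" using nz by (simp add: s_def)
    show "\<gamma> * s = p" using nz by (simp add: \<gamma>_def s_def p divide_simps)
    show "p / 2 = \<gamma> - 1" using nz by (simp add: \<gamma>_def p field_simps)
  qed (use n in \<open>auto simp: \<gamma>_def s_def p field_simps\<close>)
  obtain R where R: "R > 0" "\<And>x. norm x \<ge> R \<Longrightarrow> f x = 0" "\<And>x. norm x \<ge> R \<Longrightarrow> grad f x = 0"
    using Cc_infinity_support[OF f] by auto
  note [measurable] = Cc_infinity_borel_measurable[OF f] Cc_infinity_grad_borel_measurable[OF f]
  define A where "A = (\<integral>\<^sup>+x. ennreal (\<bar>f x\<bar> powr p) \<partial>lborel)"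
  define D where "D = (\<integral>\<^sup>+x. ennreal ((norm (grad f x))\<^sup>2) \<partial>lborel)"
  \<comment> \<open>Compact support makes \<open>A\<close> finite, without which it could not be
    absorbed.\<close>
  have "continuous_on UNIV (\<lambda>x. \<bar>f x\<bar> powr p)"
    using ex by (intro continuous_on_powr' continuous_intros Cc_infinity_continuous f) auto
  then have "A < \<top>" unfolding A_def
    by (rule nn_integral_compact_support_finite[where R=R]) (use R in auto)
  then obtain a where a: "A = ennreal a" "a \<ge> 0" by (cases A) auto
  have "continuous_on UNIV (\<lambda>x. (norm (grad f x))\<^sup>2)"
    by (intro continuous_intros Cc_infinity_continuous_grad f)
  then have "D < \<top>" unfolding D_def
    by (rule nn_integral_compact_support_finite[where R=R]) (use R in auto)
  then obtain d where d: "D = ennreal d" "d \<ge> 0" by (cases D) auto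
  have "A = (\<integral>\<^sup>+x. ennreal_powr (ennreal (\<bar>f x\<bar> powr \<gamma>)) s \<partial>lborel)"
    unfolding A_def using ex by (intro nn_integral_cong) (simp add: ennreal_powr_ennreal powr_powr)
  also have "\<dots> \<le> ennreal_powr (\<integral>\<^sup>+x. ennreal (\<gamma> * \<bar>f x\<bar> powr (\<gamma> - 1) * norm (grad f x)) \<partial>lborel) s"
    unfolding s_def n_def
    by (rule Gagliardo_inequality) (use N ex f in \<open>auto intro!: abs_powr_le_line_integral\<close>)
  also have "\<dots> \<le> ennreal_powr (ennreal \<gamma> * (ennreal_powr A (1 - 1 / 2) * ennreal_powr D (1 / 2))) s"
  proof (rule ennreal_powr_mono)
    have "(\<integral>\<^sup>+x. ennreal (\<gamma> * \<bar>f x\<bar> powr (\<gamma> - 1) * norm (grad f x)) \<partial>lborel)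
      = (\<integral>\<^sup>+x. ennreal \<gamma> * (ennreal_powr (ennreal (\<bar>f x\<bar> powr p)) (1 - 1 / 2)
          * ennreal_powr (ennreal ((norm (grad f x))\<^sup>2)) (1 / 2)) \<partial>lborel)"
    proof (intro nn_integral_cong)
      fix x :: 'a
      have "((norm (grad f x))\<^sup>2) powr (1 / 2) = norm (grad f x)"
        by (simp add: powr_half_sqrt)
      moreover have pp: "(\<bar>f x\<bar> powr p) powr (1 / 2) = \<bar>f x\<bar> powr (\<gamma> - 1)"
        unfolding ex(4)[symmetric] by (simp add: powr_powr)
      ultimately show "ennreal (\<gamma> * \<bar>f x\<bar> powr (\<gamma> - 1) * norm (grad f x))
        = ennreal \<gamma> * (ennreal_powr (ennreal (\<bar>f x\<bar> powr p)) (1 - 1 / 2)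
          * ennreal_powr (ennreal ((norm (grad f x))\<^sup>2)) (1 / 2))"
        using ex(1) pp by (simp add: ennreal_powr_ennreal ennreal_mult mult.assoc)
    qed
    also have "\<dots> = ennreal \<gamma> * (\<integral>\<^sup>+x. ennreal_powr (ennreal (\<bar>f x\<bar> powr p)) (1 - 1 / 2)
          * ennreal_powr (ennreal ((norm (grad f x))\<^sup>2)) (1 / 2) \<partial>lborel)"
      by (rule nn_integral_cmult) measurable
    also have "\<dots> \<le> ennreal \<gamma> * (ennreal_powr A (1 - 1 / 2) * ennreal_powr D (1 / 2))"
      unfolding A_def D_def by (intro mult_left_mono Hoelder_ennreal) auto
    finally show "(\<integral>\<^sup>+x. ennreal (\<gamma> * \<bar>f x\<bar> powr (\<gamma> - 1) * norm (grad f x)) \<partial>lborel) \<le> \<dots>" .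
  qed (use ex in auto)
  also have "\<dots> = ennreal ((\<gamma>\<^sup>2 * d * a) powr (s / 2))"
  proof -
    have "((\<gamma> * (a powr (1 / 2) * d powr (1 / 2))) powr s) = (\<gamma>\<^sup>2 * d * a) powr (s / 2)"
    proof -
      have "\<gamma> = (\<gamma>\<^sup>2) powr (1 / 2)" using ex by (simp add: powr_half_sqrt)
      then have "\<gamma> * (a powr (1 / 2) * d powr (1 / 2)) = (\<gamma>\<^sup>2 * d * a) powr (1 / 2)"
        using a d ex by (simp add: powr_mult)
      then show ?thesis by (simp add: powr_powr)
    qed
    then show ?thesis
      using a d ex by (simp add: ennreal_powr_ennreal ennreal_mult[symmetric])
  qed
  finally have "a \<le> (\<gamma>\<^sup>2 * d * a) powr (s / 2)" using a by simp
  then have "a \<le> (\<gamma>\<^sup>2 * d) powr (n / (n - 2))"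
    using powr_absorb[of a "\<gamma>\<^sup>2 * d" s] ex a d by simp
  then have "A \<le> ennreal_powr (ennreal (\<gamma>\<^sup>2) * D) (n / (n - 2))"
    using a d n by (simp add: ennreal_powr_ennreal ennreal_mult[symmetric] ennreal_leI)
  then show ?thesis by (simp add: A_def D_def p_def n_def \<gamma>_def)
qed

section \<open>Uniqueness of the weak gradient\<close>

lemma Cc_infinity_mult: "f \<in> Cc_infinity \<Longrightarrow> g \<in> Cc_infinity \<Longrightarrow> (\<lambda>x. f x * g x) \<in> Cc_infinity"
  unfolding Cc_infinity_iff
  by (auto intro!: Ck_mult elim!: bounded_subset)

lemma Cc_infinity_integrable: "f \<in> Cc_infinity \<Longrightarrow> integrable lborel f"
  using Cc_infinity_support[of f] integrable_compact_support[OF Cc_infinity_continuous[of f]] by blast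

lemma Cc_infinity_grad_integrable: "f \<in> Cc_infinity \<Longrightarrow> integrable lborel (grad f)"
  using Cc_infinity_support[of f] integrable_compact_support[OF Cc_infinity_continuous_grad[of f]] by blast

lemma Cc_infinity_grad_bounded:
  fixes f :: "'a::euclidean_space \<Rightarrow> real"
  assumes f: "f \<in> Cc_infinity"
  shows "\<exists>M\<ge>0. \<forall>x. norm (grad f x) \<le> M"
proof -
  obtain R where R: "R > 0" "\<And>x. norm x \<ge> R \<Longrightarrow> f x = 0" "\<And>x. norm x \<ge> R \<Longrightarrow> grad f x = 0"
    using Cc_infinity_support[OF f] by auto
  have "compact (grad f ` cball 0 R)"
    by (intro compact_continuous_image continuous_on_subset[OF Cc_infinity_continuous_grad[OF f]]) auto
  then have "bounded (grad f ` cball 0 R)" by (rule compact_imp_bounded)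
  then obtain B where B: "\<forall>y\<in>grad f ` cball 0 R. norm y \<le> B" unfolding bounded_iff ..
  have bd: "norm (grad f x) \<le> \<bar>B\<bar>" for x
  proof (cases "norm x \<le> R")
    case True
    then have "norm (grad f x) \<le> B" using B by simp
    then show ?thesis by simp
  qed (use R in simp)
  show ?thesis by (rule exI[of _ "\<bar>B\<bar>"]) (use bd in auto)
qed

lemma Cc_infinity_Lipschitz:
  fixes f :: "'a::euclidean_space \<Rightarrow> real"
  assumes f: "f \<in> Cc_infinity" and M: "\<And>x. norm (grad f x) \<le> M"
  shows "\<bar>f x - f y\<bar> \<le> M * norm (x - y)"
proof -
  have "norm (f x - f y) \<le> M * norm (x - y)"
  proof (rule differentiable_bound[of UNIV])
    fix z :: 'a
    show "(f has_derivative (\<lambda>v. grad f z \<bullet> v)) (at z within UNIV)"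
      using has_derivative_grad[OF Cc_infinity_differentiable[OF f]] by simp
    show "onorm (\<lambda>v. grad f z \<bullet> v) \<le> M"
    proof (rule onorm_le)
      fix v
      have "norm (grad f z \<bullet> v) \<le> norm (grad f z) * norm v" by (simp add: Cauchy_Schwarz_ineq2)
      also have "\<dots> \<le> M * norm v" using M by (intro mult_right_mono) auto
      finally show "norm (grad f z \<bullet> v) \<le> M * norm v" .
    qed
  qed auto
  then show ?thesis by simp
qed

lemma integral_lborel_translation:
  fixes h :: "'a::euclidean_space \<Rightarrow> real"
  assumes "integrable lborel h"
  shows "integrable lborel (\<lambda>x. h (x + c))" "(LINT x|lborel. h (x + c)) = (LINT x|lborel. h x)"
proof -
  have l: "lborel = distr lborel borel (\<lambda>x::'a. c + x)" using lborel_distr_plus[of c] by simp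
  have [measurable]: "h \<in> borel_measurable borel" using assms by auto
  have "integrable (distr lborel borel (\<lambda>x::'a. c + x)) h" using assms l by simp
  then show "integrable lborel (\<lambda>x. h (x + c))"
    by (simp add: integrable_distr_eq add.commute)
  have "(LINT x|lborel. h x) = (LINT x|distr lborel borel (\<lambda>x::'a. c + x). h x)" using l by simp
  also have "\<dots> = (LINT x|lborel. h (c + x))" by (rule integral_distr) auto
  finally show "(LINT x|lborel. h (x + c)) = (LINT x|lborel. h x)" by (simp add: add.commute)
qed

text \<open>Translation invariance makes the integrals of all difference quotients vanish.\<close>

lemma integral_grad_eq_0:
  fixes f :: "'a::euclidean_space \<Rightarrow> real"
  assumes f: "f \<in> Cc_infinity"
  shows "(LINT x|lborel. grad f x) = 0"
proof (rule euclidean_eqI)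
  fix b :: 'a assume b: "b \<in> Basis"
  obtain R where R: "R > 0" "\<And>x. norm x \<ge> R \<Longrightarrow> f x = 0" "\<And>x. norm x \<ge> R \<Longrightarrow> grad f x = 0"
    using Cc_infinity_support[OF f] by auto
  obtain M where M: "M \<ge> 0" "\<And>x. norm (grad f x) \<le> M"
    using Cc_infinity_grad_bounded[OF f] by auto
  note [measurable] = Cc_infinity_borel_measurable[OF f] Cc_infinity_grad_borel_measurable[OF f]
  define h where "h n = inverse (real (Suc n))" for n
  have h: "h n > 0" "h n \<le> 1" for n by (auto simp: h_def inverse_le_1_iff)
  define q where "q n x = (f (x + h n *\<^sub>R b) - f x) / h n" for n and x :: 'a
  have q0: "(LINT x|lborel. q n x) = 0" for n
    unfolding q_def
    using integral_lborel_translation[OF Cc_infinity_integrable[OF f]] Cc_infinity_integrable[OF f] by simp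
  have lim: "(\<lambda>n. q n x) \<longlonglongrightarrow> grad f x \<bullet> b" for x
  proof -
    have "((\<lambda>t. f (x + t *\<^sub>R b)) has_real_derivative (grad f x \<bullet> b)) (at 0)"
      using has_real_derivative_along_line[OF f, of x b 0] by simp
    then have l: "((\<lambda>t. (f (x + t *\<^sub>R b) - f x) / t) \<longlongrightarrow> grad f x \<bullet> b) (at 0)"
      by (simp add: DERIV_def)
    have "filterlim h (at 0) sequentially"
      unfolding filterlim_at using h(1) LIMSEQ_inverse_real_of_nat
      by (auto simp: h_def[abs_def] less_imp_neq[symmetric])
    then show ?thesis unfolding q_def by (rule filterlim_compose[OF l])
  qed
  have bound: "norm (q n x) \<le> M * indicat_real (cball 0 (R + 1)) x" for n x
  proof (cases "norm x \<le> R + 1")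
    case True
    have "\<bar>f (x + h n *\<^sub>R b) - f x\<bar> \<le> M * h n"
      using Cc_infinity_Lipschitz[OF f M(2), of "x + h n *\<^sub>R b" x] b h(1)[of n] by simp
    then show ?thesis using True h(1)[of n] by (simp add: q_def field_simps)
  next
    case False
    have "norm x \<le> norm (x + h n *\<^sub>R b) + norm (h n *\<^sub>R b)"
      using norm_triangle_sub[of x "x + h n *\<^sub>R b"] by simp
    then have "norm (x + h n *\<^sub>R b) \<ge> R" using False h[of n] b by simp
    then have "q n x = 0" using False R by (simp add: q_def)
    then show ?thesis using M by simp
  qed
  have "(\<lambda>n. LINT x|lborel. q n x) \<longlonglongrightarrow> (LINT x|lborel. grad f x \<bullet> b)"
  proof (rule integral_dominated_convergence[where w="\<lambda>x. M * indicat_real (cball 0 (R + 1)) x"])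
    show "integrable lborel (\<lambda>x. M * indicat_real (cball 0 (R + 1)) (x::'a))"
      by (intro integrable_mult_right integrable_real_indicator) 
         (use emeasure_bounded_finite[OF bounded_cball[of "0::'a" "R + 1"]] in auto)
    show "(\<lambda>x. grad f x \<bullet> b) \<in> borel_measurable lborel" "\<And>n. q n \<in> borel_measurable lborel"
      unfolding q_def by measurable
  qed (use lim bound in auto)
  then have "(LINT x|lborel. grad f x \<bullet> b) = 0" using q0 by (simp add: LIMSEQ_const_iff)
  then show "(LINT x|lborel. grad f x) \<bullet> b = 0 \<bullet> b"
    using Cc_infinity_grad_integrable[OF f] by simp
qed

text \<open>The product of \<open>f\<close> and \<psi> is a test function, so the integral of its
  gradient vanishes; the product rule splits it into the two sides.\<close>

lemma integral_by_parts_Cc_infinity: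
  fixes f \<psi> :: "'a::euclidean_space \<Rightarrow> real"
  assumes f: "f \<in> Cc_infinity" and \<psi>: "\<psi> \<in> Cc_infinity"
  shows "(LINT x|lborel. f x *\<^sub>R grad \<psi> x) = - (LINT x|lborel. \<psi> x *\<^sub>R grad f x)"
proof -
  have g: "grad (\<lambda>x. f x * \<psi> x) = (\<lambda>x. f x *\<^sub>R grad \<psi> x + \<psi> x *\<^sub>R grad f x)"
  proof (rule ext, rule vector_eq_rdot[THEN iffD1], rule allI)
    fix x v
    show "grad (\<lambda>x. f x * \<psi> x) x \<bullet> v = (f x *\<^sub>R grad \<psi> x + \<psi> x *\<^sub>R grad f x) \<bullet> v"
      using grad_inner_eqI[OF has_derivative_mult[OF assms[THEN Cc_infinity_differentiable, THEN has_derivative_grad]]]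
      by (simp add: inner_add_left)
  qed
  obtain R where R: "R > 0" "\<And>x. norm x \<ge> R \<Longrightarrow> f x = 0" "\<And>x. norm x \<ge> R \<Longrightarrow> grad f x = 0"
    using Cc_infinity_support[OF f] by auto
  have 1: "integrable lborel (\<lambda>x. f x *\<^sub>R grad \<psi> x)"
    by (rule integrable_compact_support[where R=R])
       (use R in \<open>auto intro!: continuous_intros Cc_infinity_continuous Cc_infinity_continuous_grad assms\<close>)
  have 2: "integrable lborel (\<lambda>x. \<psi> x *\<^sub>R grad f x)"
    by (rule integrable_compact_support[where R=R])
       (use R in \<open>auto intro!: continuous_intros Cc_infinity_continuous Cc_infinity_continuous_grad assms\<close>)
  have "(LINT x|lborel. f x *\<^sub>R grad \<psi> x) + (LINT x|lborel. \<psi> x *\<^sub>R grad f x) = 0"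
    using integral_grad_eq_0[OF Cc_infinity_mult[OF assms]] 1 2 unfolding g by simp
  then show ?thesis by (simp add: eq_neg_iff_add_eq_0)
qed

text \<open>The positive and the negative part of \<open>u\<close> are densities of two measures
  that agree on boxes, hence everywhere. Densities are unique almost everywhere, and max 0 t = max 0
  (- t) holds only for t = 0.\<close>

lemma AE_eq_0_of_box_integrals:
  fixes u :: "'a::euclidean_space \<Rightarrow> real"
  assumes u: "integrable lborel u"
    and box: "\<And>a b. (LINT x|lborel. indicator (box a b) x *\<^sub>R u x) = 0"
  shows "AE x in lborel. u x = 0"
proof -
  have [measurable]: "u \<in> borel_measurable borel" using u by auto
  define P where "P = density (lborel :: 'a measure) (\<lambda>x. ennreal (max 0 (u x)))"
  define Q where "Q = density (lborel :: 'a measure) (\<lambda>x. ennreal (max 0 (- u x)))"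
  let ?E = "range (\<lambda>(a, b). box a b::'a set)"
  let ?A = "\<lambda>n::nat. box (- (real n *\<^sub>R One)) (real n *\<^sub>R One) :: 'a set"
  have iP: "integrable lborel (\<lambda>x. indicator S x *\<^sub>R max 0 (v x))"
    if "S \<in> sets borel" "integrable lborel v" for v :: "'a \<Rightarrow> real" and S :: "'a set"
    by (intro integrable_mult_indicator Bochner_Integration.integrable_max integrable_zero) (use that in auto)
  have em: "emeasure (density lborel (\<lambda>x. ennreal (max 0 (v x)))) S
      = ennreal (LINT x|lborel. indicator S x *\<^sub>R max 0 (v x))"
    if S: "S \<in> sets borel" and v: "integrable lborel v" for v :: "'a \<Rightarrow> real" and S :: "'a set"
  proof -
    have [measurable]: "v \<in> borel_measurable borel" using v by auto
    have "emeasure (density lborel (\<lambda>x. ennreal (max 0 (v x)))) S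
        = (\<integral>\<^sup>+x. ennreal (indicator S x *\<^sub>R max 0 (v x)) \<partial>lborel)"
      using S by (subst emeasure_density) (auto intro!: nn_integral_cong simp: indicator_def)
    also have "\<dots> = ennreal (LINT x|lborel. indicator S x *\<^sub>R max 0 (v x))"
      by (rule nn_integral_eq_integral[OF iP[OF S v]]) (auto simp: indicator_def)
    finally show ?thesis .
  qed
  have u': "integrable lborel (\<lambda>x. - u x)" using u by simp
  have "P = Q"
  proof (rule measure_eqI_generator_eq)
    show "Int_stable ?E"
      by (auto simp: Int_stable_def box_Int_box)
    show "?E \<subseteq> Pow UNIV" "sets P = sigma_sets UNIV ?E" "sets Q = sigma_sets UNIV ?E"
      by (simp_all add: borel_eq_box P_def Q_def)
    show "range ?A \<subseteq> ?E" "(\<Union>i. ?A i) = UNIV"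
      unfolding UN_box_eq_UNIV by auto
    show "emeasure P (?A i) \<noteq> \<infinity>" for i
      unfolding P_def by (subst em[OF _ u]) auto
    fix X assume "X \<in> ?E"
    then obtain a b where X: "X = box a b" by auto
    have "(LINT x|lborel. indicator X x *\<^sub>R max 0 (u x)) - (LINT x|lborel. indicator X x *\<^sub>R max 0 (- u x))
        = (LINT x|lborel. indicator X x *\<^sub>R max 0 (u x) - indicator X x *\<^sub>R max 0 (- u x))"
      by (rule Bochner_Integration.integral_diff[symmetric]) (use iP[OF _ u, of X] iP[OF _ u', of X] X in auto)
    also have "\<dots> = (LINT x|lborel. indicator (box a b) x *\<^sub>R u x)"
      unfolding X by (intro Bochner_Integration.integral_cong) (auto simp: indicator_def max_def)
    finally have "(LINT x|lborel. indicator X x *\<^sub>R max 0 (u x)) = (LINT x|lborel. indicator X x *\<^sub>R max 0 (- u x))"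
      using box by simp
    then show "emeasure P X = emeasure Q X"
      unfolding P_def Q_def using em[OF _ u, of X] em[OF _ u', of X] X by simp
  qed
  then have "AE x in lborel. ennreal (max 0 (u x)) = ennreal (max 0 (- u x))"
    unfolding P_def Q_def by (subst (asm) sigma_finite_measure.density_unique_iff[OF sigma_finite_lborel]) auto
  then show ?thesis by eventually_elim (auto simp: max_def split: if_splits)
qed

text \<open>The fundamental lemma of the calculus of variations. Dominated convergence along
  \<open>box_bump\<close> passes from test functions to boxes; cutting \<open>g\<close> off to
  growing boxes makes it integrable, and its coordinates are treated one at a time.\<close>

lemma AE_eq_0_of_test_functions:
  fixes g :: "'a::euclidean_space \<Rightarrow> 'a"
  assumes g: "locally_integrable g"
    and test: "\<And>\<psi>. \<psi> \<in> Cc_infinity \<Longrightarrow> (LINT x|lborel. \<psi> x *\<^sub>R g x) = 0"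
  shows "AE x in lborel. g x = 0"
proof -
  have gK: "integrable lborel (\<lambda>x. indicator (cbox a b) x *\<^sub>R g x)" for a b
    using g by (auto simp: locally_integrable_def set_integrable_def)
  have gB: "integrable lborel (\<lambda>x. indicator (box a b) x *\<^sub>R g x)" for a b :: 'a
  proof -
    have "integrable lborel (\<lambda>x. indicator (box a b) x *\<^sub>R indicator (cbox a b) x *\<^sub>R g x)"
      by (rule integrable_mult_indicator[OF _ gK]) auto
    moreover have "(\<lambda>x. indicator (box a b) x *\<^sub>R indicator (cbox a b) x *\<^sub>R g x)
        = (\<lambda>x. indicat_real (box a b) x *\<^sub>R g x)"
      using box_subset_cbox[of a b] by (auto simp: indicator_def fun_eq_iff)
    ultimately show ?thesis by simp
  qed
  have box: "(LINT x|lborel. indicat_real (box a b) x *\<^sub>R g x) = 0" for a b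
  proof -
    obtain \<psi> :: "nat \<Rightarrow> 'a \<Rightarrow> real" where \<psi>: "\<And>n. \<psi> n \<in> Cc_infinity"
      "\<And>n x. 0 \<le> \<psi> n x" "\<And>n x. \<psi> n x \<le> 1" "\<And>n x. x \<notin> box a b \<Longrightarrow> \<psi> n x = 0"
      "\<And>x. (\<lambda>n. \<psi> n x) \<longlonglongrightarrow> indicator (box a b) x"
      using box_bump[of a b] by auto
    have eq: "\<psi> n x *\<^sub>R g x = \<psi> n x *\<^sub>R (indicat_real (box a b) x *\<^sub>R g x)" for n x
      using \<psi>(4)[of x n] by (auto simp: indicator_def)
    have [measurable]: "\<psi> n \<in> borel_measurable borel" for n by (rule Cc_infinity_borel_measurable[OF \<psi>(1)])
    have [measurable]: "(\<lambda>x. indicat_real (box a b) x *\<^sub>R g x) \<in> borel_measurable lborel"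
      using gB by (rule borel_measurable_integrable)
    have "(\<lambda>n. LINT x|lborel. \<psi> n x *\<^sub>R g x) \<longlonglongrightarrow> (LINT x|lborel. indicat_real (box a b) x *\<^sub>R (indicat_real (box a b) x *\<^sub>R g x))"
      unfolding eq
    proof (rule integral_dominated_convergence[where w="\<lambda>x. norm (indicat_real (box a b) x *\<^sub>R g x)"])
      show "integrable lborel (\<lambda>x. norm (indicat_real (box a b) x *\<^sub>R g x))"
        by (rule integrable_norm[OF gB])
      show "AE x in lborel. norm (\<psi> n x *\<^sub>R (indicat_real (box a b) x *\<^sub>R g x)) \<le> norm (indicat_real (box a b) x *\<^sub>R g x)" for n
      proof (rule AE_I2)
        fix x
        show "norm (\<psi> n x *\<^sub>R (indicat_real (box a b) x *\<^sub>R g x)) \<le> norm (indicat_real (box a b) x *\<^sub>R g x)"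
          using \<psi>(2,3)[of n x] unfolding norm_scaleR[of "\<psi> n x"] by (intro mult_left_le_one_le) auto
      qed
      show "AE x in lborel. (\<lambda>n. \<psi> n x *\<^sub>R (indicat_real (box a b) x *\<^sub>R g x)) \<longlonglongrightarrow> indicat_real (box a b) x *\<^sub>R (indicat_real (box a b) x *\<^sub>R g x)"
        by (intro AE_I2 tendsto_scaleR \<psi>(5) tendsto_const)
    qed measurable
    moreover have "(LINT x|lborel. \<psi> n x *\<^sub>R g x) = 0" for n by (rule test[OF \<psi>(1)])
    ultimately have "(LINT x|lborel. indicat_real (box a b) x *\<^sub>R (indicat_real (box a b) x *\<^sub>R g x)) = 0"
      by (simp add: LIMSEQ_const_iff)
    moreover have "(\<lambda>x. indicat_real (box a b) x *\<^sub>R (indicat_real (box a b) x *\<^sub>R g x)) = (\<lambda>x. indicat_real (box a b) x *\<^sub>R g x)"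
      by (auto simp: indicator_def fun_eq_iff)
    ultimately show ?thesis by simp
  qed
  let ?A = "\<lambda>n::nat. box (- (real n *\<^sub>R One)) (real n *\<^sub>R One) :: 'a set"
  have "AE x in lborel. (indicat_real (?A n) x *\<^sub>R g x) \<bullet> i = 0" for n i
  proof (rule AE_eq_0_of_box_integrals)
    show "integrable lborel (\<lambda>x. (indicat_real (?A n) x *\<^sub>R g x) \<bullet> i)"
      by (rule integrable_inner_left) (rule gB)
    fix a b :: 'a
    obtain c d where cd: "box a b \<inter> ?A n = box c d"
      unfolding box_Int_box by blast
    have "(LINT x|lborel. indicat_real (box a b) x *\<^sub>R ((indicat_real (?A n) x *\<^sub>R g x) \<bullet> i))
        = (LINT x|lborel. (indicat_real (box c d) x *\<^sub>R g x) \<bullet> i)"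
      unfolding cd[symmetric] by (intro Bochner_Integration.integral_cong) (auto simp: indicator_def)
    also have "\<dots> = (LINT x|lborel. indicat_real (box c d) x *\<^sub>R g x) \<bullet> i"
      by (rule integral_inner_left) (rule gB)
    finally show "(LINT x|lborel. indicat_real (box a b) x *\<^sub>R ((indicat_real (?A n) x *\<^sub>R g x) \<bullet> i)) = 0"
      by (simp add: box)
  qed
  then have "AE x in lborel. \<forall>n. \<forall>i\<in>Basis. (indicat_real (?A n) x *\<^sub>R g x) \<bullet> i = 0"
    unfolding AE_all_countable by (intro allI AE_finite_allI finite_Basis)
  then show ?thesis
  proof eventually_elim
    case (elim x)
    have "x \<in> (\<Union>n. ?A n)" using UN_box_eq_UNIV by blast
    then obtain n where "x \<in> ?A n" by blast
    then have "g x \<bullet> i = 0" if "i \<in> Basis" for i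
      using elim[rule_format, OF that, of n] by simp
    then show ?case by (simp add: euclidean_eq_iff[of "g x" 0])
  qed
qed

lemma integrable_test_function_mult:
  fixes k :: "'a::euclidean_space \<Rightarrow> 'a"
  assumes k: "locally_integrable k" and \<psi>: "\<psi> \<in> Cc_infinity"
  shows "integrable lborel (\<lambda>x. \<psi> x *\<^sub>R k x)"
proof -
  obtain R where R: "R > 0" "\<And>x. norm x \<ge> R \<Longrightarrow> \<psi> x = 0" "\<And>x. norm x \<ge> R \<Longrightarrow> grad \<psi> x = 0"
    using Cc_infinity_support[OF \<psi>] by auto
  have ki: "integrable lborel (\<lambda>x. indicat_real (cball 0 R) x *\<^sub>R k x)"
    using k by (auto simp: locally_integrable_def set_integrable_def)
  have "compact (\<psi> ` cball 0 R)"
    by (intro compact_continuous_image continuous_on_subset[OF Cc_infinity_continuous[OF \<psi>]]) auto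
  then have "bounded (\<psi> ` cball 0 R)" by (rule compact_imp_bounded)
  then obtain B where B: "\<forall>y\<in>\<psi> ` cball 0 R. norm y \<le> B" unfolding bounded_iff ..
  have [measurable]: "\<psi> \<in> borel_measurable borel" by (rule Cc_infinity_borel_measurable[OF \<psi>])
  have [measurable]: "(\<lambda>x. indicat_real (cball 0 R) x *\<^sub>R k x) \<in> borel_measurable lborel"
    using ki by (rule borel_measurable_integrable)
  have eq: "(\<lambda>x. \<psi> x *\<^sub>R k x) = (\<lambda>x. \<psi> x *\<^sub>R (indicat_real (cball 0 R) x *\<^sub>R k x))"
  proof
    show "\<psi> x *\<^sub>R k x = \<psi> x *\<^sub>R (indicat_real (cball 0 R) x *\<^sub>R k x)" for x
      using R(2)[of x] by (cases "norm x \<le> R") auto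
  qed
  have Bki: "integrable lborel (\<lambda>x. \<bar>B\<bar> *\<^sub>R norm (indicat_real (cball 0 R) x *\<^sub>R k x))"
    by (rule integrable_scaleR_right, rule integrable_norm) (rule ki)
  have "integrable lborel (\<lambda>x. \<psi> x *\<^sub>R (indicat_real (cball 0 R) x *\<^sub>R k x))"
  proof (rule Bochner_Integration.integrable_bound[OF Bki])
    show "AE x in lborel. norm (\<psi> x *\<^sub>R (indicat_real (cball 0 R) x *\<^sub>R k x))
        \<le> norm (\<bar>B\<bar> *\<^sub>R norm (indicat_real (cball 0 R) x *\<^sub>R k x))"
    proof (rule AE_I2)
      fix x
      show "norm (\<psi> x *\<^sub>R (indicat_real (cball 0 R) x *\<^sub>R k x))
        \<le> norm (\<bar>B\<bar> *\<^sub>R norm (indicat_real (cball 0 R) x *\<^sub>R k x))"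
      proof (cases "x \<in> cball 0 R")
        case True
        then have "\<bar>\<psi> x\<bar> \<le> \<bar>B\<bar>" using B by force
        with True show ?thesis by (simp add: mult_right_mono)
      qed (simp add: indicator_def)
    qed
  qed measurable
  then show ?thesis using eq by (simp only:)
qed

lemma has_weak_gradient_unique:
  fixes u :: "'a::euclidean_space \<Rightarrow> real"
  assumes g: "has_weak_gradient u g" and h: "has_weak_gradient u h"
  shows "AE x in lborel. g x = h x"
proof -
  have li: "locally_integrable g" "locally_integrable h"
    using g h by (auto simp: has_weak_gradient_def)
  have "AE x in lborel. g x - h x = 0"
  proof (rule AE_eq_0_of_test_functions)
    show "locally_integrable (\<lambda>x. g x - h x)"
      using li unfolding locally_integrable_def by (auto intro!: set_integral_diff)
    fix \<psi> :: "'a \<Rightarrow> real" assume \<psi>: "\<psi> \<in> Cc_infinity"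
    have "(LINT x|lborel. \<psi> x *\<^sub>R g x) = (LINT x|lborel. \<psi> x *\<^sub>R h x)"
      using g h \<psi> unfolding has_weak_gradient_def by (metis neg_equal_iff_equal)
    then show "(LINT x|lborel. \<psi> x *\<^sub>R (g x - h x)) = 0"
      using integrable_test_function_mult[OF li(1) \<psi>] integrable_test_function_mult[OF li(2) \<psi>] by (simp add: scaleR_diff_right)
  qed
  then show ?thesis by simp
qed

text \<open>Whatever \<open>SOME\<close> picks in \<open>weak_grad\<close> can from here on be
  traded, up to a null set, for a gradient that is known explicitly.\<close>

lemma weak_grad_eq:
  assumes "has_weak_gradient u g"
  shows "AE x in lborel. weak_grad u x = g x"
  using has_weak_gradient_unique[OF _ assms] someI[of "has_weak_gradient u", OF assms]
  by (auto simp: weak_grad_def)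

section \<open>Compactness of probability measures on compact sets\<close>

text \<open>Schoenberg's digit reader: continuous, of period 2, equal to 0 on [0, 1/3] and to 1 on
  [2/3, 1], so it detects whether a leading ternary digit is 0 or 2.\<close>

definition bump_cos :: "real \<Rightarrow> real" where
  "bump_cos t = max 0 (min 1 (1 / 2 - cos (pi * t)))"

lemma bump_cos_bounds: "0 \<le> bump_cos t" "bump_cos t \<le> 1"
  by (auto simp: bump_cos_def)

lemma continuous_bump_cos [continuous_intros]:
  fixes f :: "real \<Rightarrow> real"
  shows "continuous_on S f \<Longrightarrow> continuous_on S (\<lambda>x. bump_cos (f x))"
  unfolding bump_cos_def by (intro continuous_intros)

lemma bump_cos_periodic: "bump_cos (2 * of_int z + t) = bump_cos t"
proof -
  have "pi * (2 * of_int z + t) = (2 * pi) * of_int z + pi * t" by (simp add: algebra_simps)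
  then have "cos (pi * (2 * of_int z + t)) = cos (pi * t)"
    by (simp only: cos_add cos_int_2pin sin_int_2pin)
  then show ?thesis by (simp add: bump_cos_def)
qed

lemma bump_cos_eq_0: "0 \<le> t \<Longrightarrow> t \<le> 1 / 3 \<Longrightarrow> bump_cos t = 0"
  using cos_monotone_0_pi_le[of "pi * t" "pi / 3"] by (auto simp: bump_cos_def cos_60 divide_simps)

lemma bump_cos_eq_1:
  assumes "2 / 3 \<le> t" "t \<le> 1"
  shows "bump_cos t = 1"
proof -
  have "cos (pi * t) = - cos (pi - pi * t)" by (simp add: cos_diff)
  moreover have "cos (pi / 3) \<le> cos (pi - pi * t)"
    using assms by (intro cos_monotone_0_pi_le) (auto simp: field_simps)
  ultimately show ?thesis by (simp add: bump_cos_def cos_60)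
qed

text \<open>For digits 0 and 1 this is the point of the Cantor set with ternary digits
  \<open>2 * d m\<close>. Avoiding the ternary digit 1 leaves a gap in which a continuous function
  can pass from 0 to 1.\<close>

definition ternary :: "(nat \<Rightarrow> int) \<Rightarrow> real" where
  "ternary d = (\<Sum>m. 2 * of_int (d m) / 3 ^ Suc m)"

lemma sums_two_thirds: "(\<lambda>m. 2 / 3 ^ Suc m :: real) sums 1"
  using sums_mult[OF geometric_sums[of "1 / 3 :: real"], of "2 / 3"] by (simp add: power_one_over divide_simps)

lemma summable_ternary:
  assumes "\<And>m. d m \<in> {0, 1}"
  shows "summable (\<lambda>m. 2 * of_int (d m) / 3 ^ Suc m :: real)"
proof (rule summable_comparison_test')
  show "summable (\<lambda>m. 2 / 3 ^ Suc m :: real)" using sums_two_thirds by (rule sums_summable)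
  show "norm (2 * of_int (d m) / 3 ^ Suc m :: real) \<le> 2 / 3 ^ Suc m" if "m \<ge> 0" for m
    using assms[of m] by auto
qed

lemma ternary_bounds:
  assumes "\<And>m. d m \<in> {0, 1}"
  shows "0 \<le> ternary d" "ternary d \<le> 1"
proof -
  have d: "0 \<le> real_of_int (d m)" "real_of_int (d m) \<le> 1" for m
    using assms[of m] by auto
  show "0 \<le> ternary d"
    unfolding ternary_def by (intro suminf_nonneg summable_ternary assms) (use d in auto)
  have "ternary d \<le> (\<Sum>m. 2 / 3 ^ Suc m)"
    unfolding ternary_def
    by (intro suminf_le summable_ternary assms sums_summable[OF sums_two_thirds] divide_right_mono) (use d in auto)
  then show "ternary d \<le> 1" using sums_unique[OF sums_two_thirds] by simp
qed

lemma ternary_shift: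
  assumes "\<And>m. d m \<in> {0, 1}"
  shows "3 * ternary d = 2 * of_int (d 0) + ternary (\<lambda>m. d (Suc m))"
proof -
  have s: "summable (\<lambda>m. 2 * of_int (d (Suc m)) / 3 ^ Suc m :: real)"
    by (rule summable_ternary) (rule assms)
  have "ternary d = 2 * of_int (d 0) / 3 ^ Suc 0 + (\<Sum>m. 2 * of_int (d (Suc m)) / 3 ^ Suc (Suc m))"
    unfolding ternary_def using suminf_split_head[OF summable_ternary[of d, OF assms]] by simp
  also have "(\<Sum>m. 2 * of_int (d (Suc m)) / 3 ^ Suc (Suc m)) = (\<Sum>m. (1 / 3) * (2 * of_int (d (Suc m)) / 3 ^ Suc m :: real))"
    by (intro suminf_cong) simp
  also have "\<dots> = (1 / 3) * ternary (\<lambda>m. d (Suc m))"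
    unfolding ternary_def by (rule suminf_mult[OF s])
  finally show ?thesis by simp
qed

text \<open>Multiplication by 3 shifts the digits and splits off \<open>2 * d 0\<close>. Further
  multiplication by \<open>3 ^ m\<close> keeps this an even integer, which the period 2 of
  \<open>bump_cos\<close> ignores.\<close>

lemma bump_cos_ternary:
  assumes "\<And>m. d m \<in> {0, 1}"
  shows "bump_cos (3 ^ m * ternary d) = of_int (d m)"
  using assms
proof (induction m arbitrary: d)
  case 0
  have "3 * ternary d = 2 * of_int (d 0) + ternary (\<lambda>m. d (Suc m))"
    by (rule ternary_shift) (rule 0)
  moreover have "0 \<le> ternary (\<lambda>m. d (Suc m))" "ternary (\<lambda>m. d (Suc m)) \<le> 1"
    by (rule ternary_bounds, rule 0)+
  ultimately show ?case
    using 0[of 0] by (auto intro!: bump_cos_eq_0 bump_cos_eq_1)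
next
  case (Suc m)
  have "3 ^ Suc m * ternary d = 3 ^ m * (3 * ternary d)" by simp
  also have "\<dots> = 3 ^ m * (2 * of_int (d 0) + ternary (\<lambda>m. d (Suc m)))"
    by (simp only: ternary_shift[of d, OF Suc.prems])
  also have "\<dots> = 2 * of_int (3 ^ m * d 0) + 3 ^ m * ternary (\<lambda>m. d (Suc m))"
    by (simp add: algebra_simps)
  finally have "bump_cos (3 ^ Suc m * ternary d) = bump_cos (3 ^ m * ternary (\<lambda>m. d (Suc m)))"
    by (simp only: bump_cos_periodic)
  also have "\<dots> = of_int (d (Suc m))" by (rule Suc.IH) (rule Suc.prems)
  finally show ?case .
qed

definition bin_digit :: "real \<Rightarrow> nat \<Rightarrow> int" where
  "bin_digit u k = \<lfloor>2 ^ Suc k * u\<rfloor> mod 2"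

lemma bin_digit_01: "bin_digit u k \<in> {0, 1}"
  by (auto simp: bin_digit_def)

text \<open>The \<open>n\<close>-th partial sum truncates \<open>u\<close> after \<open>n\<close>
  binary digits; the bounds on \<open>u\<close> make the integer part 0.\<close>

lemma bin_digit_sums:
  assumes "0 \<le> u" "u < 1"
  shows "(\<lambda>k. of_int (bin_digit u k) / 2 ^ Suc k) sums u"
proof -
  have part: "(\<Sum>k<n. of_int (bin_digit u k) / 2 ^ Suc k) = real_of_int \<lfloor>2 ^ n * u\<rfloor> / 2 ^ n" for n
  proof (induction n)
    case 0
    then show ?case using assms by (simp add: floor_eq_iff)
  next
    case (Suc n)
    have "\<lfloor>2 ^ Suc n * u / real_of_int 2\<rfloor> = \<lfloor>2 ^ Suc n * u\<rfloor> div 2"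
      by (rule floor_divide_real_eq_div) simp
    then have "\<lfloor>2 ^ n * u\<rfloor> = \<lfloor>2 ^ Suc n * u\<rfloor> div 2" by simp
    then have "\<lfloor>2 ^ Suc n * u\<rfloor> = 2 * \<lfloor>2 ^ n * u\<rfloor> + bin_digit u n"
      unfolding bin_digit_def by simp
    then have "real_of_int \<lfloor>2 ^ Suc n * u\<rfloor> = 2 * of_int \<lfloor>2 ^ n * u\<rfloor> + of_int (bin_digit u n)"
      by (simp only: of_int_add of_int_mult of_int_numeral)
    then show ?case
      unfolding sum.lessThan_Suc Suc by (simp add: field_simps)
  qed
  have "(\<lambda>n. real_of_int \<lfloor>2 ^ n * u\<rfloor> / 2 ^ n) \<longlonglongrightarrow> u"
  proof (rule LIM_zero_cancel)
    show "(\<lambda>n. real_of_int \<lfloor>2 ^ n * u\<rfloor> / 2 ^ n - u) \<longlonglongrightarrow> 0"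
    proof (rule Lim_null_comparison)
      have "norm (real_of_int \<lfloor>2 ^ n * u\<rfloor> / 2 ^ n - u) \<le> (1 / 2) ^ n" for n
      proof -
        have "real_of_int \<lfloor>2 ^ n * u\<rfloor> / 2 ^ n - u = (of_int \<lfloor>2 ^ n * u\<rfloor> - 2 ^ n * u) / 2 ^ n"
          by (simp add: field_simps)
        moreover have "\<bar>of_int \<lfloor>2 ^ n * u\<rfloor> - 2 ^ n * u\<bar> \<le> 1" by linarith
        ultimately show ?thesis by (simp add: power_one_over abs_divide divide_right_mono)
      qed
      then show "\<forall>\<^sub>F n in sequentially. norm (real_of_int \<lfloor>2 ^ n * u\<rfloor> / 2 ^ n - u) \<le> (1 / 2) ^ n" by simp
      show "(\<lambda>n. (1 / 2 :: real) ^ n) \<longlonglongrightarrow> 0" by (rule LIMSEQ_power_zero) simp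
    qed
  qed
  then show ?thesis unfolding sums_def part .
qed

text \<open>Schoenberg's space-filling curve: the ternary digits of the parameter list the binary digits of all
  coordinates of the point.\<close>

lemma space_filling_curve:
  fixes K :: "'a::euclidean_space set"
  assumes "bounded K"
  shows "\<exists>(c :: real \<Rightarrow> 'a) (s :: 'a \<Rightarrow> real). continuous_on UNIV c \<and> s \<in> borel_measurable borel \<and>
    (\<forall>x. 0 \<le> s x \<and> s x \<le> 1) \<and> (\<forall>x\<in>K. c (s x) = x)"
proof -
  obtain B where B: "\<forall>x\<in>K. norm x \<le> B" using assms unfolding bounded_iff ..
  \<comment> \<open>One more than a bound for the norms puts the rescaled coordinates
    \<open>u x b\<close> strictly below 1, as the binary expansion requires.\<close>
  define a where "a = \<bar>B\<bar> + 1"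
  have a: "a > 0" by (simp add: a_def)
  define N where "N = DIM('a)"
  have N: "N > 0" by (simp add: N_def)
  obtain e :: "'a \<Rightarrow> nat" where e: "bij_betw e Basis {0..<N}"
    unfolding N_def using ex_bij_betw_finite_nat[of "Basis :: 'a set"] by auto
  define e' where "e' = inv_into (Basis :: 'a set) e"
  have ee: "e b < N" "e' (e b) = b" if "b \<in> Basis" for b
    using e that by (auto simp: e'_def bij_betw_def)
  define u where "u x b = (x \<bullet> b + a) / (2 * a)" for x b :: 'a
  \<comment> \<open>Interleaving: position \<open>k * N + e b\<close> holds the \<open>k\<close>-th
    binary digit of the coordinate \<open>b\<close>.\<close>
  define D where "D x m = bin_digit (u x (e' (m mod N))) (m div N)" for x m
  define s where "s x = ternary (D x)" for x
  define w where "w t b = (\<Sum>k. bump_cos (3 ^ (k * N + e b) * t) / 2 ^ Suc k)" for t and b :: 'a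
  define c where "c t = (\<Sum>b\<in>Basis. (2 * a * w t b - a) *\<^sub>R b)" for t :: real
  have half: "summable (\<lambda>k. 1 / 2 ^ Suc k :: real)"
    using power_half_series[THEN sums_summable] by (simp add: power_one_over)
  have "continuous_on UNIV (\<lambda>t. w t b)" for b
  proof -
    have "uniform_limit UNIV (\<lambda>n t. \<Sum>k<n. bump_cos (3 ^ (k * N + e b) * t) / 2 ^ Suc k)
        (\<lambda>t. \<Sum>k. bump_cos (3 ^ (k * N + e b) * t) / 2 ^ Suc k) sequentially"
      by (rule Weierstrass_m_test[OF _ half]) (simp add: bump_cos_bounds abs_of_nonneg divide_right_mono)
    then have "continuous_on UNIV (\<lambda>t. \<Sum>k. bump_cos (3 ^ (k * N + e b) * t) / 2 ^ Suc k)"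
      by (rule uniform_limit_theorem[rotated]) (auto intro!: always_eventually continuous_intros)
    then show ?thesis by (simp add: w_def)
  qed
  then have c: "continuous_on UNIV c"
    unfolding c_def by (intro continuous_intros)
  have D01: "D x m \<in> {0, 1}" for x m unfolding D_def by (rule bin_digit_01)
  have s01: "0 \<le> s x" "s x \<le> 1" for x
    unfolding s_def by (rule ternary_bounds, rule D01)+
  have "(\<lambda>x. real_of_int (D x m)) \<in> borel_measurable borel" for m
    unfolding D_def bin_digit_def u_def by measurable
  then have s: "s \<in> borel_measurable borel"
    unfolding s_def ternary_def by (intro borel_measurable_suminf borel_measurable_divide borel_measurable_times) auto
  have "c (s x) = x" if x: "x \<in> K" for x
  proof (rule euclidean_eqI)
    fix b :: 'a assume b: "b \<in> Basis"
    have "\<bar>x \<bullet> b\<bar> \<le> norm x" using b by (rule Basis_le_norm)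
    also have "norm x \<le> B" using B x by auto
    finally have "\<bar>x \<bullet> b\<bar> < a" by (simp add: a_def)
    then have u: "0 \<le> u x b" "u x b < 1" by (auto simp: u_def field_simps abs_less_iff)
    have "w (s x) b = (\<Sum>k. of_int (bin_digit (u x b) k) / 2 ^ Suc k)"
      unfolding w_def
    proof (rule suminf_cong)
      fix k
      have "bump_cos (3 ^ (k * N + e b) * s x) = of_int (D x (k * N + e b))"
        unfolding s_def by (rule bump_cos_ternary) (rule D01)
      also have "D x (k * N + e b) = bin_digit (u x b) k"
        using ee[OF b] N by (simp add: D_def)
      finally show "bump_cos (3 ^ (k * N + e b) * s x) / 2 ^ Suc k = of_int (bin_digit (u x b) k) / 2 ^ Suc k"
        by simp
    qed
    also have "\<dots> = u x b" using sums_unique[OF bin_digit_sums[OF u]] by simp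
    finally have "2 * a * w (s x) b - a = x \<bullet> b" using a by (simp add: u_def)
    then show "c (s x) \<bullet> b = x \<bullet> b"
      using b by (simp add: c_def inner_sum_left inner_Basis if_distrib cong: if_cong)
  qed
  then show ?thesis using c s s01 by (intro exI[of _ c] exI[of _ s]) simp
qed

text \<open>The pushforwards along the section \<open>s\<close> live on [0, 1], hence are tight and
  have a weakly convergent subsequence; its limit is pushed back along the curve \<open>c\<close>.
  Measurability of \<open>s\<close> suffices, since \<open>f \<circ> c\<close> is continuous and
  \<open>c (s x) = x\<close> on \<open>K\<close>.\<close>

lemma compact_probabilities_convergent_subsequence:
  fixes K :: "'a::euclidean_space set" and \<rho> :: "nat \<Rightarrow> 'a measure"
  assumes K: "compact K"
    and sets: "\<And>n. sets (\<rho> n) = sets borel"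
    and one: "\<And>n. emeasure (\<rho> n) K = 1" and null: "\<And>n. emeasure (\<rho> n) (- K) = 0"
  shows "\<exists>r \<mu>. strict_mono (r :: nat \<Rightarrow> nat) \<and> sets \<mu> = sets borel \<and> emeasure \<mu> K = 1 \<and> emeasure \<mu> (- K) = 0 \<and>
    (\<forall>f :: 'a \<Rightarrow> real. continuous_on UNIV f \<longrightarrow> bounded (range f) \<longrightarrow>
      (\<lambda>n. LINT x|\<rho> (r n). f x) \<longlonglongrightarrow> (LINT x|\<mu>. f x))"
proof -
  obtain c :: "real \<Rightarrow> 'a" and s where c: "continuous_on UNIV c" and s: "s \<in> borel_measurable borel"
    and s01: "\<And>x. 0 \<le> s x" "\<And>x. s x \<le> 1" and cs: "\<And>x. x \<in> K \<Longrightarrow> c (s x) = x"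
    using space_filling_curve[OF compact_imp_bounded[OF K]] by auto
  have cm [measurable]: "c \<in> borel_measurable borel" using c by (rule borel_measurable_continuous_onI)
  note [measurable_cong] = sets
  note s [measurable]
  have Kb [measurable]: "K \<in> sets borel" using K by (simp add: compact_imp_closed borel_closed)
  have sp: "space (\<rho> n) = UNIV" for n using sets_eq_imp_space_eq[OF sets] by simp
  have tot: "emeasure (\<rho> n) UNIV = 1" for n
  proof -
    have "emeasure (\<rho> n) (K \<union> - K) = emeasure (\<rho> n) K + emeasure (\<rho> n) (- K)"
      by (rule plus_emeasure[symmetric]) (auto simp: sets)
    then show ?thesis using one null by simp
  qed
  have prob: "prob_space (\<rho> n)" for n by (rule prob_spaceI) (simp add: sp tot)
  have AEK: "AE x in \<rho> n. x \<in> K" for n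
    by (rule AE_I[where N="- K"]) (auto simp: sp sets null)
  define \<nu> where "\<nu> n = distr (\<rho> n) borel s" for n
  have rd: "real_distribution (\<nu> n)" for n
    unfolding \<nu>_def real_distribution_def real_distribution_axioms_def
    by (auto intro!: prob_space.prob_space_distr prob)
  have tight: "tight \<nu>"
    unfolding tight_def
  proof (intro conjI allI impI rd)
    fix \<epsilon> :: real assume "\<epsilon> > 0"
    \<comment> \<open>The interval in \<open>tight\<close> is open on the left; starting at -1 keeps
      the value 0 inside.\<close>
    have "measure (\<nu> n) {-1<..1} = 1" for n
    proof -
      have "- 1 < s x" for x using s01(1)[of x] by linarith
      then have "s -` {-1<..1} = UNIV" using s01 by auto
      then have "emeasure (\<nu> n) {-1<..1} = 1"
        unfolding \<nu>_def by (subst emeasure_distr) (auto simp: sp tot)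
      then show ?thesis by (simp add: measure_def)
    qed
    then show "\<exists>a b. a < b \<and> (\<forall>n. 1 - \<epsilon> < measure (\<nu> n) {a<..b})"
      using \<open>\<epsilon> > 0\<close> by (intro exI[of _ "-1"] exI[of _ 1]) auto
  qed
  have "\<exists>r M. strict_mono (r :: nat \<Rightarrow> nat) \<and> real_distribution M \<and> weak_conv_m (\<nu> \<circ> id \<circ> r) M"
    by (rule tight_imp_convergent_subsubsequence[OF tight strict_mono_id])
  then obtain r M where r: "strict_mono (r :: nat \<Rightarrow> nat)" and M: "real_distribution M"
    and wc: "weak_conv_m (\<lambda>n. \<nu> (r n)) M"
    by (auto simp: comp_def)
  interpret M: real_distribution M by (rule M)
  define \<mu> where "\<mu> = distr M borel c"
  have \<mu>sets: "sets \<mu> = sets borel" by (simp add: \<mu>_def)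
  interpret \<mu>: prob_space \<mu> unfolding \<mu>_def by (rule M.prob_space_distr) simp
  have conv: "(\<lambda>n. LINT x|\<rho> (r n). f x) \<longlonglongrightarrow> (LINT x|\<mu>. f x)"
    if f: "continuous_on UNIV f" and bd: "bounded (range f)" for f :: "'a \<Rightarrow> real"
  proof -
    have fm [measurable]: "f \<in> borel_measurable borel" using f by (rule borel_measurable_continuous_onI)
    obtain B where B: "\<forall>y\<in>range f. norm y \<le> B" using bd unfolding bounded_iff ..
    have "(\<lambda>n. LINT t|\<nu> (r n). f (c t)) \<longlonglongrightarrow> (LINT t|M. f (c t))"
    proof (rule weak_conv_imp_integral_bdd_continuous_conv[OF _ M wc])
      show "real_distribution (\<nu> (r n))" for n by (rule rd)
      show "isCont (\<lambda>t. f (c t)) t" for t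
        using continuous_on_compose2[OF f c] by (simp add: continuous_on_eq_continuous_at)
      show "norm (f (c t)) \<le> B" for t using B by auto
    qed
    moreover have "(LINT t|\<nu> n. f (c t)) = (LINT x|\<rho> n. f x)" for n
    proof -
      have "(LINT t|\<nu> n. f (c t)) = (LINT x|\<rho> n. f (c (s x)))"
        unfolding \<nu>_def by (rule integral_distr) auto
      also have "\<dots> = (LINT x|\<rho> n. f x)"
        by (rule integral_cong_AE) (use AEK[of n] cs in \<open>auto elim!: eventually_mono\<close>)
      finally show ?thesis .
    qed
    moreover have "(LINT x|\<mu>. f x) = (LINT t|M. f (c t))"
      unfolding \<mu>_def by (rule integral_distr) auto
    ultimately show ?thesis by simp
  qed
  have K0: "K \<noteq> {}" using one[of 0] by auto
  have "AE x in \<mu>. x \<in> K"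
  proof -
    \<comment> \<open>A bounded continuous function that vanishes exactly on \<open>K\<close>, so
      that weak convergence transports the support to the limit.\<close>
    define f where "f x = min 1 (infdist x K)" for x
    have f0: "f x \<ge> 0" "f x \<le> 1" for x by (auto simp: f_def infdist_nonneg)
    have fc: "continuous_on UNIV f" unfolding f_def by (intro continuous_intros)
    have fm [measurable]: "f \<in> borel_measurable borel" using fc by (rule borel_measurable_continuous_onI)
    have fb: "bounded (range f)" unfolding bounded_iff using f0 by (intro exI[of _ 1]) auto
    have "(LINT x|\<rho> n. f x) = 0" for n
    proof -
      have "(LINT x|\<rho> n. f x) = (LINT x|\<rho> n. 0)"
      proof (rule integral_cong_AE)
        show "AE x in \<rho> n. f x = 0" using AEK[of n] by eventually_elim (simp add: f_def)
      qed measurable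
      then show ?thesis by simp
    qed
    then have "(LINT x|\<mu>. f x) = 0"
      using conv[OF fc fb] by (simp add: LIMSEQ_const_iff)
    moreover have "f \<in> borel_measurable \<mu>"
      using fm unfolding measurable_cong_sets[OF \<mu>sets refl] .
    then have "integrable \<mu> f"
      by (intro \<mu>.integrable_const_bound[where B=1] AE_I2) (use f0 in auto)
    ultimately have "AE x in \<mu>. f x = 0"
      using integral_nonneg_eq_0_iff_AE[of \<mu> f] f0 by auto
    then show ?thesis
    proof eventually_elim
      case (elim x)
      then have "infdist x K = 0" by (auto simp: f_def min_def split: if_splits)
      then show ?case using in_closed_iff_infdist_zero[of K x] K K0 by (simp add: compact_imp_closed)
    qed
  qed
  then have "emeasure \<mu> (- K) = 0"
    using \<mu>sets sets_eq_imp_space_eq[OF \<mu>sets] by (subst (asm) AE_iff_measurable[where N="- K"]) auto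
  moreover have "emeasure \<mu> K = 1"
    using \<open>AE x in \<mu>. x \<in> K\<close> \<mu>sets by (simp add: \<mu>.emeasure_eq_1_AE)
  ultimately show ?thesis using r \<mu>sets conv by blast
qed

section \<open>Completeness of the space of square-integrable functions\<close>

lemma tendsto_0_ennrealI:
  fixes X :: "'b \<Rightarrow> ennreal"
  assumes "\<And>e. e > 0 \<Longrightarrow> \<forall>\<^sub>F n in F. X n \<le> ennreal e"
  shows "(X \<longlongrightarrow> 0) F"
proof (rule order_tendstoI)
  fix a :: ennreal assume "0 < a"
  then obtain y where y: "0 < y" "y < a" using dense by auto
  then obtain e where e: "y = ennreal e" "0 \<le> e" by (cases y) auto
  then have "e > 0" using y by auto
  from assms[OF this] show "\<forall>\<^sub>F n in F. X n < a"
    by eventually_elim (use y e in auto)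
qed simp

lemma tendsto_0_ennrealD:
  fixes X :: "'b \<Rightarrow> ennreal"
  assumes "(X \<longlongrightarrow> 0) F" "e > 0"
  shows "\<forall>\<^sub>F n in F. X n \<le> ennreal e"
  using order_tendstoD(2)[OF assms(1), of "ennreal e"] assms(2) by (auto elim: eventually_mono)

lemma Fatou_bound:
  fixes u :: "nat \<Rightarrow> 'a \<Rightarrow> real"
  assumes [measurable]: "\<And>k. u k \<in> borel_measurable M"
    and lim: "AE x in M. (\<lambda>k. u k x) \<longlonglongrightarrow> v x"
    and le: "\<forall>\<^sub>F k in sequentially. (\<integral>\<^sup>+x. ennreal (u k x) \<partial>M) \<le> B"
  shows "(\<integral>\<^sup>+x. ennreal (v x) \<partial>M) \<le> B"
proof -
  have "(\<integral>\<^sup>+x. ennreal (v x) \<partial>M) = (\<integral>\<^sup>+x. liminf (\<lambda>k. ennreal (u k x)) \<partial>M)"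
  proof (rule nn_integral_cong_AE)
    show "AE x in M. ennreal (v x) = liminf (\<lambda>k. ennreal (u k x))"
      using lim
    proof eventually_elim
      case (elim x)
      then have "(\<lambda>k. ennreal (u k x)) \<longlonglongrightarrow> ennreal (v x)" by (rule tendsto_ennrealI)
      then show ?case by (intro lim_imp_Liminf[symmetric]) auto
    qed
  qed
  also have "\<dots> \<le> liminf (\<lambda>k. \<integral>\<^sup>+x. ennreal (u k x) \<partial>M)"
    by (rule nn_integral_liminf) measurable
  also have "\<dots> \<le> limsup (\<lambda>k. \<integral>\<^sup>+x. ennreal (u k x) \<partial>M)"
    by (intro Liminf_le_Limsup) auto
  also have "\<dots> \<le> B" by (rule Limsup_bounded) (rule le)
  finally show ?thesis .
qed

text \<open>A factor 2 replaces Minkowski's inequality: square integrals can be added without taking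
  roots, and the estimates built on it ask only for finiteness, convergence to 0 or some
  constant.\<close>

lemma norm_add_squared_le:
  fixes a b :: "'a::real_normed_vector"
  shows "(norm (a + b))\<^sup>2 \<le> 2 * (norm a)\<^sup>2 + 2 * (norm b)\<^sup>2"
proof -
  have "(norm (a + b))\<^sup>2 \<le> (norm a + norm b)\<^sup>2"
    by (intro power_mono norm_triangle_ineq) simp
  also have "\<dots> \<le> 2 * (norm a)\<^sup>2 + 2 * (norm b)\<^sup>2"
    using zero_le_power2[of "norm a - norm b"] by (simp add: power2_eq_square algebra_simps)
  finally show ?thesis .
qed

lemma nn_integral_add_squared_le:
  fixes F G :: "'a \<Rightarrow> 'b::{second_countable_topology, real_normed_vector}"
  assumes [measurable]: "F \<in> borel_measurable M" "G \<in> borel_measurable M"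
  shows "(\<integral>\<^sup>+x. ennreal ((norm (F x + G x))\<^sup>2) \<partial>M)
    \<le> 2 * (\<integral>\<^sup>+x. ennreal ((norm (F x))\<^sup>2) \<partial>M) + 2 * (\<integral>\<^sup>+x. ennreal ((norm (G x))\<^sup>2) \<partial>M)"
proof -
  have "(\<integral>\<^sup>+x. ennreal ((norm (F x + G x))\<^sup>2) \<partial>M)
      \<le> (\<integral>\<^sup>+x. 2 * ennreal ((norm (F x))\<^sup>2) + 2 * ennreal ((norm (G x))\<^sup>2) \<partial>M)"
  proof (rule nn_integral_mono)
    fix x
    have "2 * ennreal ((norm (F x))\<^sup>2) + 2 * ennreal ((norm (G x))\<^sup>2)
        = ennreal (2 * (norm (F x))\<^sup>2 + 2 * (norm (G x))\<^sup>2)"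
      by (simp add: ennreal_mult)
    then show "ennreal ((norm (F x + G x))\<^sup>2) \<le> 2 * ennreal ((norm (F x))\<^sup>2) + 2 * ennreal ((norm (G x))\<^sup>2)"
      by (simp only: ennreal_leI[OF norm_add_squared_le])
  qed
  also have "\<dots> = 2 * (\<integral>\<^sup>+x. ennreal ((norm (F x))\<^sup>2) \<partial>M) + 2 * (\<integral>\<^sup>+x. ennreal ((norm (G x))\<^sup>2) \<partial>M)"
    by (simp add: nn_integral_add nn_integral_cmult)
  finally show ?thesis .
qed

lemma abs_add_powr_le:
  fixes a b p :: real
  assumes "p \<ge> 0"
  shows "\<bar>a + b\<bar> powr p \<le> 2 powr p * (\<bar>a\<bar> powr p + \<bar>b\<bar> powr p)"
proof -
  have "\<bar>a + b\<bar> powr p \<le> (2 * max \<bar>a\<bar> \<bar>b\<bar>) powr p"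
    by (rule powr_mono2) (use assms in auto)
  also have "\<dots> = 2 powr p * (max \<bar>a\<bar> \<bar>b\<bar>) powr p"
    by (rule powr_mult)
  also have "\<dots> \<le> 2 powr p * (\<bar>a\<bar> powr p + \<bar>b\<bar> powr p)"
    by (intro mult_left_mono) (auto simp: max_def)
  finally show ?thesis .
qed

lemma nn_integral_add_powr_le:
  fixes F G :: "'a \<Rightarrow> real"
  assumes [measurable]: "F \<in> borel_measurable M" "G \<in> borel_measurable M" and p: "p \<ge> 0"
  shows "(\<integral>\<^sup>+x. ennreal (\<bar>F x + G x\<bar> powr p) \<partial>M)
    \<le> ennreal (2 powr p) * ((\<integral>\<^sup>+x. ennreal (\<bar>F x\<bar> powr p) \<partial>M) + (\<integral>\<^sup>+x. ennreal (\<bar>G x\<bar> powr p) \<partial>M))"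
proof -
  have "(\<integral>\<^sup>+x. ennreal (\<bar>F x + G x\<bar> powr p) \<partial>M)
      \<le> (\<integral>\<^sup>+x. ennreal (2 powr p) * (ennreal (\<bar>F x\<bar> powr p) + ennreal (\<bar>G x\<bar> powr p)) \<partial>M)"
  proof (rule nn_integral_mono)
    fix x
    have "ennreal (2 powr p) * (ennreal (\<bar>F x\<bar> powr p) + ennreal (\<bar>G x\<bar> powr p))
        = ennreal (2 powr p * (\<bar>F x\<bar> powr p + \<bar>G x\<bar> powr p))"
      by (simp add: ennreal_mult)
    then show "ennreal (\<bar>F x + G x\<bar> powr p) \<le> ennreal (2 powr p) * (ennreal (\<bar>F x\<bar> powr p) + ennreal (\<bar>G x\<bar> powr p))"
      by (simp only: ennreal_leI[OF abs_add_powr_le[OF p]])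
  qed
  also have "\<dots> = ennreal (2 powr p) * ((\<integral>\<^sup>+x. ennreal (\<bar>F x\<bar> powr p) \<partial>M) + (\<integral>\<^sup>+x. ennreal (\<bar>G x\<bar> powr p) \<partial>M))"
    by (simp add: nn_integral_add nn_integral_cmult)
  finally show ?thesis .
qed

text \<open>Riesz-Fischer for functions rather than classes. The subsequence converging almost
  everywhere is part of the claim because the gradient bound and the density of the functional are
  later passed to the limit along it.\<close>

lemma L2_complete:
  fixes F :: "nat \<Rightarrow> 'a \<Rightarrow> 'b::{second_countable_topology, banach}"
  assumes [measurable]: "\<And>n. F n \<in> borel_measurable M"
    and Cauchy: "\<And>e. e > 0 \<Longrightarrow> \<exists>N. \<forall>m\<ge>N. \<forall>n\<ge>N. (\<integral>\<^sup>+x. ennreal ((norm (F m x - F n x))\<^sup>2) \<partial>M) \<le> ennreal e"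
  shows "\<exists>G s. G \<in> borel_measurable M \<and> strict_mono (s :: nat \<Rightarrow> nat) \<and>
    (AE x in M. (\<lambda>k. F (s k) x) \<longlonglongrightarrow> G x) \<and>
    (\<lambda>n. \<integral>\<^sup>+x. ennreal ((norm (F n x - G x))\<^sup>2) \<partial>M) \<longlonglongrightarrow> 0"
proof -
  have "\<forall>k. \<exists>N. \<forall>m\<ge>N. \<forall>n\<ge>N. (\<integral>\<^sup>+x. ennreal ((norm (F m x - F n x))\<^sup>2) \<partial>M) \<le> ennreal ((1 / 8) ^ k)"
    by (intro allI Cauchy) simp
  from choice[OF this] obtain N where
    "\<forall>k. \<forall>m\<ge>N k. \<forall>n\<ge>N k. (\<integral>\<^sup>+x. ennreal ((norm (F m x - F n x))\<^sup>2) \<partial>M) \<le> ennreal ((1 / 8) ^ k)" ..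
  then have N: "(\<integral>\<^sup>+x. ennreal ((norm (F m x - F n x))\<^sup>2) \<partial>M) \<le> ennreal ((1 / 8) ^ k)"
    if "m \<ge> N k" "n \<ge> N k" for k m n using that by simp
  \<comment> \<open>The sum dominates \<open>N k\<close>, and the added \<open>k\<close> makes
    \<open>s\<close> strictly increasing.\<close>
  define s where "s k = (\<Sum>i\<le>k. N i) + k" for k
  have sN: "s k \<ge> N k" for k
    using member_le_sum[of k "{..k}" N] by (simp add: s_def)
  have smono: "strict_mono s" unfolding strict_mono_Suc_iff by (simp add: s_def)
  define \<Delta> where "\<Delta> k x = norm (F (s (Suc k)) x - F (s k) x)" for k x
  have [measurable]: "\<Delta> k \<in> borel_measurable M" for k unfolding \<Delta>_def by measurable
  have \<Delta>int: "(\<integral>\<^sup>+x. ennreal ((\<Delta> k x)\<^sup>2) \<partial>M) \<le> ennreal ((1 / 8) ^ k)" for k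
    unfolding \<Delta>_def
    by (rule N[OF order_trans[OF sN] sN]) (use smono in \<open>simp add: strict_mono_less_eq\<close>)
  \<comment> \<open>Weights 4^k against squared distances 8^-k leave the summable 2^-k. So the
    weighted sum of squares is finite almost everywhere, and there the increments are at most a
    constant times 2^-k.\<close>
  have "(\<integral>\<^sup>+x. (\<Sum>k. ennreal (4 ^ k) * ennreal ((\<Delta> k x)\<^sup>2)) \<partial>M)
      = (\<Sum>k. ennreal (4 ^ k) * (\<integral>\<^sup>+x. ennreal ((\<Delta> k x)\<^sup>2) \<partial>M))"
    by (subst nn_integral_suminf) (auto simp: nn_integral_cmult)
  also have "\<dots> \<le> (\<Sum>k. ennreal ((1 / 2) ^ k))"
  proof (intro suminf_le summableI)
    fix k
    have "ennreal (4 ^ k) * (\<integral>\<^sup>+x. ennreal ((\<Delta> k x)\<^sup>2) \<partial>M) \<le> ennreal (4 ^ k) * ennreal ((1 / 8) ^ k)"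
      by (intro mult_left_mono \<Delta>int) simp
    also have "\<dots> = ennreal ((1 / 2) ^ k)"
      by (subst ennreal_mult[symmetric]) (simp_all add: power_mult_distrib[symmetric])
    finally show "ennreal (4 ^ k) * (\<integral>\<^sup>+x. ennreal ((\<Delta> k x)\<^sup>2) \<partial>M) \<le> ennreal ((1 / 2) ^ k)" .
  qed
  also have "\<dots> < \<top>"
    by (subst suminf_ennreal2) (auto simp: summable_geometric)
  finally have "(\<integral>\<^sup>+x. (\<Sum>k. ennreal (4 ^ k) * ennreal ((\<Delta> k x)\<^sup>2)) \<partial>M) \<noteq> \<infinity>" by auto
  then have "AE x in M. (\<Sum>k. ennreal (4 ^ k) * ennreal ((\<Delta> k x)\<^sup>2)) \<noteq> \<infinity>"
    by (intro nn_integral_PInf_AE) auto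
  then have conv: "AE x in M. convergent (\<lambda>k. F (s k) x)"
  proof eventually_elim
    case (elim x)
    then obtain c where c: "(\<Sum>k. ennreal (4 ^ k) * ennreal ((\<Delta> k x)\<^sup>2)) = ennreal c" "c \<ge> 0"
      by (cases "\<Sum>k. ennreal (4 ^ k) * ennreal ((\<Delta> k x)\<^sup>2)") auto
    have "\<Delta> k x \<le> sqrt c * (1 / 2) ^ k" for k
    proof -
      have "ennreal (4 ^ k) * ennreal ((\<Delta> k x)\<^sup>2) \<le> (\<Sum>k. ennreal (4 ^ k) * ennreal ((\<Delta> k x)\<^sup>2))"
        using sum_le_suminf[of "\<lambda>k. ennreal (4 ^ k) * ennreal ((\<Delta> k x)\<^sup>2)" "{k}"] by simp
      then have "4 ^ k * (\<Delta> k x)\<^sup>2 \<le> c"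
        unfolding c(1) using c(2) by (simp add: ennreal_mult[symmetric])
      then have "sqrt (4 ^ k * (\<Delta> k x)\<^sup>2) \<le> sqrt c" by simp
      moreover have "sqrt (4 ^ k * (\<Delta> k x)\<^sup>2) = 2 ^ k * \<Delta> k x"
      proof -
        have "(4::real) ^ k = (2 ^ k)\<^sup>2" 
          using power_mult[of "2 :: real" k 2] power_mult[of "2 :: real" 2 k] by (simp add: mult.commute)
        then show ?thesis by (simp add: real_sqrt_mult \<Delta>_def)
      qed
      ultimately have "\<Delta> k x * 2 ^ k \<le> sqrt c" by (simp add: mult.commute)
      then show ?thesis by (simp add: power_one_over pos_le_divide_eq)
    qed
    then have \<Delta>le: "norm (F (s (Suc k)) x - F (s k) x) \<le> sqrt c * (1 / 2) ^ k" for k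
      by (simp add: \<Delta>_def)
    have "summable (\<lambda>k. sqrt c * (1 / 2) ^ k)"
      by (intro summable_mult summable_geometric) simp
    then have "summable (\<lambda>k. F (s (Suc k)) x - F (s k) x)"
      by (rule summable_comparison_test'[where N=0]) (rule \<Delta>le)
    then have "convergent (\<lambda>n. F (s 0) x + (\<Sum>k<n. F (s (Suc k)) x - F (s k) x))"
      by (intro convergent_add convergent_const) (simp add: summable_iff_convergent)
    moreover have "F (s 0) x + (\<Sum>k<n. F (s (Suc k)) x - F (s k) x) = F (s n) x" for n
      using sum_lessThan_telescope[of "\<lambda>k. F (s k) x" n] by simp
    ultimately show ?case by simp
  qed
  define G where "G x = lim (\<lambda>k. F (s k) x)" for x
  have G [measurable]: "G \<in> borel_measurable M" unfolding G_def by measurable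
  have lim: "AE x in M. (\<lambda>k. F (s k) x) \<longlonglongrightarrow> G x"
    using conv by eventually_elim (simp add: G_def convergent_LIMSEQ_iff)
  have "(\<lambda>n. \<integral>\<^sup>+x. ennreal ((norm (F n x - G x))\<^sup>2) \<partial>M) \<longlonglongrightarrow> 0"
  proof (rule tendsto_0_ennrealI)
    fix e :: real assume "e > 0"
    then obtain K where K: "\<And>m n. m \<ge> K \<Longrightarrow> n \<ge> K \<Longrightarrow> (\<integral>\<^sup>+x. ennreal ((norm (F m x - F n x))\<^sup>2) \<partial>M) \<le> ennreal e"
      using Cauchy by blast
    have "(\<integral>\<^sup>+x. ennreal ((norm (F n x - G x))\<^sup>2) \<partial>M) \<le> ennreal e" if n: "n \<ge> K" for n
    proof (rule Fatou_bound[where u="\<lambda>k x. (norm (F n x - F (s k) x))\<^sup>2"])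
      show "AE x in M. (\<lambda>k. (norm (F n x - F (s k) x))\<^sup>2) \<longlonglongrightarrow> (norm (F n x - G x))\<^sup>2"
        using lim by eventually_elim (intro tendsto_intros)
      show "\<forall>\<^sub>F k in sequentially. (\<integral>\<^sup>+x. ennreal ((norm (F n x - F (s k) x))\<^sup>2) \<partial>M) \<le> ennreal e"
        using eventually_ge_at_top[of K]
      proof eventually_elim
        case (elim k)
        then have "s k \<ge> K" using seq_suble[OF smono, of k] by simp
        with n show ?case by (rule K)
      qed
    qed measurable
    then show "\<forall>\<^sub>F n in sequentially. (\<integral>\<^sup>+x. ennreal ((norm (F n x - G x))\<^sup>2) \<partial>M) \<le> ennreal e"
      by (auto simp: eventually_sequentially)
  qed
  then show ?thesis using G smono lim by blast
qed

section \<open>The Dirichlet space\<close>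

text \<open>This and the next quantity take values in [0, \<infinity>] and carry no root: they make
  sense before integrability is known and obey crude triangle inequalities.\<close>

definition L2sq :: "('a::euclidean_space \<Rightarrow> 'b::real_normed_vector) \<Rightarrow> ennreal" where
  "L2sq F = (\<integral>\<^sup>+x. ennreal ((norm (F x))\<^sup>2) \<partial>lborel)"

definition Lsobolev :: "('a::euclidean_space \<Rightarrow> real) \<Rightarrow> ennreal" where
  "Lsobolev u = (\<integral>\<^sup>+x. ennreal (\<bar>u x\<bar> powr sobolev_exponent TYPE('a)) \<partial>lborel)"

text \<open>One limit \<open>G\<close> of the gradients of an approximating sequence is named, so
  that the Cauchy condition of \<open>D12\<close> turns into convergence to
  \<open>G\<close>.\<close>

definition D12_gradient :: "('a::euclidean_space \<Rightarrow> real) \<Rightarrow> ('a \<Rightarrow> 'a) \<Rightarrow> bool" where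
  "D12_gradient u G \<longleftrightarrow> u \<in> borel_measurable borel \<and> G \<in> borel_measurable borel \<and>
    (\<exists>f. (\<forall>n. f n \<in> Cc_infinity) \<and>
      (\<lambda>n. L2sq (\<lambda>x. grad (f n) x - G x)) \<longlonglongrightarrow> 0 \<and> (\<lambda>n. Lsobolev (\<lambda>x. f n x - u x)) \<longlonglongrightarrow> 0)"

lemma sobolev_exponent_gt_1: "DIM('a::euclidean_space) \<ge> 3 \<Longrightarrow> sobolev_exponent TYPE('a) > 1"
  by (simp add: sobolev_exponent_def field_simps)

lemma L2sq_add_le:
  fixes F G :: "'a::euclidean_space \<Rightarrow> 'b::{second_countable_topology, real_normed_vector}"
  assumes "F \<in> borel_measurable borel" "G \<in> borel_measurable borel"
  shows "L2sq (\<lambda>x. F x + G x) \<le> 2 * L2sq F + 2 * L2sq G"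
  unfolding L2sq_def by (rule nn_integral_add_squared_le) (use assms in auto)

lemma L2sq_minus_commute: "L2sq (\<lambda>x. F x - G x) = L2sq (\<lambda>x. G x - F x)"
  by (simp add: L2sq_def norm_minus_commute)

lemma L2sq_triangle:
  fixes F G H :: "'a::euclidean_space \<Rightarrow> 'b::{second_countable_topology, real_normed_vector}"
  assumes "F \<in> borel_measurable borel" "G \<in> borel_measurable borel" "H \<in> borel_measurable borel"
  shows "L2sq (\<lambda>x. F x - H x) \<le> 2 * L2sq (\<lambda>x. F x - G x) + 2 * L2sq (\<lambda>x. G x - H x)"
  using L2sq_add_le[of "\<lambda>x. F x - G x" "\<lambda>x. G x - H x"] assms by simp

lemma L2sq_scaleR:
  fixes F :: "'a::euclidean_space \<Rightarrow> 'b::{second_countable_topology, real_normed_vector}"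
  assumes [measurable]: "F \<in> borel_measurable borel"
  shows "L2sq (\<lambda>x. a *\<^sub>R F x) = ennreal (a\<^sup>2) * L2sq F"
  unfolding L2sq_def by (simp add: power_mult_distrib ennreal_mult nn_integral_cmult)

lemma Lsobolev_add_le:
  assumes "u \<in> borel_measurable borel" "v \<in> borel_measurable borel" "DIM('a::euclidean_space) \<ge> 3"
  shows "Lsobolev (\<lambda>x::'a. u x + v x)
    \<le> ennreal (2 powr sobolev_exponent TYPE('a)) * (Lsobolev u + Lsobolev v)"
  unfolding Lsobolev_def
  by (rule nn_integral_add_powr_le) (use assms sobolev_exponent_gt_1[where 'a='a] in auto)

lemma Lsobolev_minus_commute: "Lsobolev (\<lambda>x. u x - v x) = Lsobolev (\<lambda>x. v x - u x)"
  by (simp add: Lsobolev_def abs_minus_commute)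

lemma Lsobolev_mult:
  assumes [measurable]: "u \<in> borel_measurable borel"
  shows "Lsobolev (\<lambda>x::'a::euclidean_space. a * u x) = ennreal (\<bar>a\<bar> powr sobolev_exponent TYPE('a)) * Lsobolev u"
  unfolding Lsobolev_def by (simp add: abs_mult powr_mult ennreal_mult nn_integral_cmult)

lemma tendsto_0_ennreal_bound:
  fixes X Y Z :: "'b \<Rightarrow> ennreal"
  assumes X: "(X \<longlongrightarrow> 0) F" and Y: "(Y \<longlongrightarrow> 0) F"
    and le: "\<And>n. Z n \<le> ennreal A * X n + ennreal B * Y n"
  shows "(Z \<longlongrightarrow> 0) F"
proof (rule tendsto_0_ennrealI)
  fix e :: real assume e: "e > 0"
  define d where "d = e / (2 * (\<bar>A\<bar> + \<bar>B\<bar> + 1))"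
  have d: "d > 0" using e by (simp add: d_def)
  have "\<bar>A\<bar> * d + \<bar>B\<bar> * d \<le> e"
  proof -
    have "(\<bar>A\<bar> + \<bar>B\<bar>) * d \<le> (2 * (\<bar>A\<bar> + \<bar>B\<bar> + 1)) * d" using d by (intro mult_right_mono) auto
    also have "\<dots> = e" by (simp add: d_def)
    finally show ?thesis by (simp add: algebra_simps)
  qed
  from tendsto_0_ennrealD[OF X d] tendsto_0_ennrealD[OF Y d]
  show "\<forall>\<^sub>F n in F. Z n \<le> ennreal e"
  proof eventually_elim
    case (elim n)
    have "Z n \<le> ennreal A * X n + ennreal B * Y n" by (rule le)
    also have "\<dots> \<le> ennreal \<bar>A\<bar> * ennreal d + ennreal \<bar>B\<bar> * ennreal d"
      by (intro add_mono mult_mono elim ennreal_leI) auto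
    also have "\<dots> = ennreal (\<bar>A\<bar> * d + \<bar>B\<bar> * d)"
      using d by (simp add: ennreal_mult)
    also have "\<dots> \<le> ennreal e" by (rule ennreal_leI) fact
    finally show ?case .
  qed
qed

lemma two_mult_ennreal_add: "0 \<le> a \<Longrightarrow> 0 \<le> b \<Longrightarrow> 2 * ennreal a + 2 * ennreal b = ennreal (2 * a + 2 * b)"
  by (simp add: ennreal_mult)

text \<open>Compact support provides the integrability without which the Bochner integral in
  \<open>dirichlet_norm\<close> would default to 0.\<close>

lemma dirichlet_norm_L2sq:
  assumes h: "h \<in> Cc_infinity"
  shows "L2sq (grad h) = ennreal ((dirichlet_norm h)\<^sup>2)"
proof -
  obtain R where R: "R > 0" "\<And>x. norm x \<ge> R \<Longrightarrow> h x = 0" "\<And>x. norm x \<ge> R \<Longrightarrow> grad h x = 0"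
    using Cc_infinity_support[OF h] by auto
  have "continuous_on UNIV (\<lambda>x. (norm (grad h x))\<^sup>2)"
    by (intro continuous_intros Cc_infinity_continuous_grad h)
  then have "integrable lborel (\<lambda>x. (norm (grad h x))\<^sup>2)"
    by (rule integrable_compact_support[where R=R]) (use R in auto)
  then show ?thesis
    unfolding L2sq_def dirichlet_norm_def by (subst nn_integral_eq_integral) auto
qed

lemma D12_imp_D12_gradient:
  fixes u :: "'a::euclidean_space \<Rightarrow> real"
  assumes u: "u \<in> D12"
  shows "\<exists>G. D12_gradient u G"
proof -
  from u obtain f where um: "u \<in> borel_measurable borel" and f: "\<And>n. f n \<in> Cc_infinity"
    and Cau: "\<And>e. e > 0 \<Longrightarrow> \<exists>M. \<forall>m\<ge>M. \<forall>n\<ge>M. dirichlet_norm (\<lambda>x. f m x - f n x) < e"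
    and lim: "(\<lambda>n. Lsobolev (\<lambda>x. f n x - u x)) \<longlonglongrightarrow> 0"
    unfolding D12_def Lsobolev_def by auto
  have "\<exists>(G :: 'a \<Rightarrow> 'a) s. G \<in> borel_measurable lborel \<and> strict_mono (s :: nat \<Rightarrow> nat) \<and>
    (AE x in lborel. (\<lambda>k. grad (f (s k)) x) \<longlonglongrightarrow> G x) \<and>
    (\<lambda>n. \<integral>\<^sup>+x. ennreal ((norm (grad (f n) x - G x))\<^sup>2) \<partial>lborel) \<longlonglongrightarrow> 0"
  proof (rule L2_complete)
    show "grad (f n) \<in> borel_measurable lborel" for n
      using Cc_infinity_grad_borel_measurable[OF f] by simp
    fix e :: real assume "e > 0"
    then obtain M where M: "\<And>m n. m \<ge> M \<Longrightarrow> n \<ge> M \<Longrightarrow> dirichlet_norm (\<lambda>x. f m x - f n x) < sqrt e"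
      using Cau[of "sqrt e"] by auto
    have "(\<integral>\<^sup>+x. ennreal ((norm (grad (f m) x - grad (f n) x))\<^sup>2) \<partial>lborel) \<le> ennreal e" if "m \<ge> M" "n \<ge> M" for m n
    proof -
      have "grad (\<lambda>x. f m x - f n x) = (\<lambda>x. grad (f m) x - grad (f n) x)"
        by (rule ext) (rule grad_diff[OF f f])
      then have "(\<integral>\<^sup>+x. ennreal ((norm (grad (f m) x - grad (f n) x))\<^sup>2) \<partial>lborel)
          = ennreal ((dirichlet_norm (\<lambda>x. f m x - f n x))\<^sup>2)"
        using dirichlet_norm_L2sq[OF Cc_infinity_diff[OF f f, of m n]] by (simp add: L2sq_def)
      also have "\<dots> \<le> ennreal ((sqrt e)\<^sup>2)"
        by (intro ennreal_leI power_mono less_imp_le[OF M[OF that]]) (simp add: dirichlet_norm_def)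
      finally show ?thesis using \<open>e > 0\<close> by simp
    qed
    then show "\<exists>N. \<forall>m\<ge>N. \<forall>n\<ge>N. (\<integral>\<^sup>+x. ennreal ((norm (grad (f m) x - grad (f n) x))\<^sup>2) \<partial>lborel) \<le> ennreal e"
      by auto
  qed
  then obtain G :: "'a \<Rightarrow> 'a" where "G \<in> borel_measurable borel" "(\<lambda>n. L2sq (\<lambda>x. grad (f n) x - G x)) \<longlonglongrightarrow> 0"
    unfolding L2sq_def by auto
  then have "D12_gradient u G" unfolding D12_gradient_def using um f lim by blast
  then show ?thesis by (intro exI[of _ G])
qed

lemma D12_gradient_imp_D12:
  assumes u: "D12_gradient u G"
  shows "u \<in> D12"
proof -
  obtain f where m [measurable]: "u \<in> borel_measurable borel" "G \<in> borel_measurable borel"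
    and f: "\<And>n. f n \<in> Cc_infinity"
    and G: "(\<lambda>n. L2sq (\<lambda>x. grad (f n) x - G x)) \<longlonglongrightarrow> 0"
    and lim: "(\<lambda>n. Lsobolev (\<lambda>x. f n x - u x)) \<longlonglongrightarrow> 0"
    using u unfolding D12_gradient_def by auto
  have "\<exists>M. \<forall>m\<ge>M. \<forall>n\<ge>M. dirichlet_norm (\<lambda>x. f m x - f n x) < e" if e: "e > 0" for e
  proof -
    \<comment> \<open>Two triangle terms \<open>2 * (e\<^sup>2 / 8)\<close> add up to half of
      \<open>e\<^sup>2\<close>, which leaves the strict inequality.\<close>
    have "e\<^sup>2 / 8 > 0" using e by simp
    then have "\<forall>\<^sub>F n in sequentially. L2sq (\<lambda>x. grad (f n) x - G x) \<le> ennreal (e\<^sup>2 / 8)"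
      by (rule tendsto_0_ennrealD[OF G])
    then obtain M where M: "\<And>n. n \<ge> M \<Longrightarrow> L2sq (\<lambda>x. grad (f n) x - G x) \<le> ennreal (e\<^sup>2 / 8)"
      unfolding eventually_sequentially by auto
    have "dirichlet_norm (\<lambda>x. f m x - f n x) < e" if mn: "m \<ge> M" "n \<ge> M" for m n
    proof -
      have gr: "grad (\<lambda>x. f m x - f n x) = (\<lambda>x. grad (f m) x - grad (f n) x)"
        by (rule ext) (rule grad_diff[OF f f])
      have "ennreal ((dirichlet_norm (\<lambda>x. f m x - f n x))\<^sup>2) = L2sq (\<lambda>x. grad (f m) x - grad (f n) x)"
        using dirichlet_norm_L2sq[OF Cc_infinity_diff[OF f f, of m n]] by (simp add: gr)
      also have "\<dots> \<le> 2 * L2sq (\<lambda>x. grad (f m) x - G x) + 2 * L2sq (\<lambda>x. G x - grad (f n) x)"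
        by (intro L2sq_triangle Cc_infinity_grad_borel_measurable f m)
      also have "\<dots> \<le> 2 * ennreal (e\<^sup>2 / 8) + 2 * ennreal (e\<^sup>2 / 8)"
        unfolding L2sq_minus_commute[of G] by (intro add_mono mult_left_mono M mn) auto
      also have "\<dots> = ennreal (2 * (e\<^sup>2 / 8) + 2 * (e\<^sup>2 / 8))"
        by (rule two_mult_ennreal_add) auto
      finally have "(dirichlet_norm (\<lambda>x. f m x - f n x))\<^sup>2 \<le> e\<^sup>2 / 2"
        by (subst (asm) ennreal_le_iff) auto
      also have "\<dots> < e\<^sup>2" using e by simp
      finally show ?thesis by (rule power_less_imp_less_base) (use e in simp)
    qed
    then show ?thesis by blast
  qed
  then show ?thesis
    unfolding D12_def using f lim m by (auto simp: Lsobolev_def)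
qed

lemma D12_gradient_linear_combination:
  fixes u v :: "'a::euclidean_space \<Rightarrow> real"
  assumes u: "D12_gradient u G" and v: "D12_gradient v H" and N: "DIM('a) \<ge> 3"
  shows "D12_gradient (\<lambda>x. a * u x + b * v x) (\<lambda>x. a *\<^sub>R G x + b *\<^sub>R H x)"
proof -
  obtain f where um [measurable]: "u \<in> borel_measurable borel" "G \<in> borel_measurable borel"
    and f: "\<And>n. f n \<in> Cc_infinity"
    and fG: "(\<lambda>n. L2sq (\<lambda>x. grad (f n) x - G x)) \<longlonglongrightarrow> 0"
    and fu: "(\<lambda>n. Lsobolev (\<lambda>x. f n x - u x)) \<longlonglongrightarrow> 0"
    using u unfolding D12_gradient_def by auto
  obtain g where vm [measurable]: "v \<in> borel_measurable borel" "H \<in> borel_measurable borel"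
    and g: "\<And>n. g n \<in> Cc_infinity"
    and gH: "(\<lambda>n. L2sq (\<lambda>x. grad (g n) x - H x)) \<longlonglongrightarrow> 0"
    and gv: "(\<lambda>n. Lsobolev (\<lambda>x. g n x - v x)) \<longlonglongrightarrow> 0"
    using v unfolding D12_gradient_def by auto
  note [measurable] = Cc_infinity_borel_measurable[OF f] Cc_infinity_grad_borel_measurable[OF f]
    Cc_infinity_borel_measurable[OF g] Cc_infinity_grad_borel_measurable[OF g]
  define h where "h n x = a * f n x + b * g n x" for n x
  have h: "h n \<in> Cc_infinity" for n
    unfolding h_def[abs_def] by (rule Cc_infinity_linear_combination[OF f g])
  have gradh: "grad (h n) x = a *\<^sub>R grad (f n) x + b *\<^sub>R grad (g n) x" for n x
    unfolding h_def[abs_def]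
    by (rule grad_linear_combination) (auto intro: Cc_infinity_differentiable f g)
  have "(\<lambda>n. L2sq (\<lambda>x. grad (h n) x - (a *\<^sub>R G x + b *\<^sub>R H x))) \<longlonglongrightarrow> 0"
  proof (rule tendsto_0_ennreal_bound[OF fG gH])
    fix n
    have "L2sq (\<lambda>x. grad (h n) x - (a *\<^sub>R G x + b *\<^sub>R H x))
        = L2sq (\<lambda>x. a *\<^sub>R (grad (f n) x - G x) + b *\<^sub>R (grad (g n) x - H x))"
      by (simp add: gradh algebra_simps)
    also have "\<dots> \<le> 2 * L2sq (\<lambda>x. a *\<^sub>R (grad (f n) x - G x)) + 2 * L2sq (\<lambda>x. b *\<^sub>R (grad (g n) x - H x))"
      by (rule L2sq_add_le) measurable
    also have "\<dots> = ennreal (2 * a\<^sup>2) * L2sq (\<lambda>x. grad (f n) x - G x) + ennreal (2 * b\<^sup>2) * L2sq (\<lambda>x. grad (g n) x - H x)"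
      by (simp add: L2sq_scaleR ennreal_mult mult.assoc)
    finally show "L2sq (\<lambda>x. grad (h n) x - (a *\<^sub>R G x + b *\<^sub>R H x)) \<le> \<dots>" .
  qed
  moreover have "(\<lambda>n. Lsobolev (\<lambda>x. h n x - (a * u x + b * v x))) \<longlonglongrightarrow> 0"
  proof (rule tendsto_0_ennreal_bound[OF fu gv])
    fix n
    let ?p = "sobolev_exponent TYPE('a)"
    have "Lsobolev (\<lambda>x. h n x - (a * u x + b * v x)) = Lsobolev (\<lambda>x. a * (f n x - u x) + b * (g n x - v x))"
      by (simp add: h_def algebra_simps)
    also have "\<dots> \<le> ennreal (2 powr ?p) * (Lsobolev (\<lambda>x. a * (f n x - u x)) + Lsobolev (\<lambda>x. b * (g n x - v x)))"
      by (intro Lsobolev_add_le N) measurable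
    also have "\<dots> = ennreal (2 powr ?p * \<bar>a\<bar> powr ?p) * Lsobolev (\<lambda>x. f n x - u x)
        + ennreal (2 powr ?p * \<bar>b\<bar> powr ?p) * Lsobolev (\<lambda>x. g n x - v x)"
      by (simp add: Lsobolev_mult ennreal_mult distrib_left mult.assoc)
    finally show "Lsobolev (\<lambda>x. h n x - (a * u x + b * v x)) \<le> \<dots>" .
  qed
  ultimately show ?thesis unfolding D12_gradient_def using h by (auto intro!: exI[of _ h])
qed

lemma D12_gradient_diff:
  fixes u v :: "'a::euclidean_space \<Rightarrow> real"
  assumes "D12_gradient u G" "D12_gradient v H" "DIM('a) \<ge> 3"
  shows "D12_gradient (\<lambda>x. u x - v x) (\<lambda>x. G x - H x)"
  using D12_gradient_linear_combination[OF assms, of 1 "-1"] by simp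

lemma D12_gradient_zero: "D12_gradient (\<lambda>x. 0) (\<lambda>x. 0)"
  unfolding D12_gradient_def
proof (intro conjI exI[of _ "\<lambda>n x. 0"])
  have "grad (\<lambda>x. 0) = (\<lambda>x::'a. 0)"
    using grad_linear_combination[of "\<lambda>x. 0" _ "\<lambda>x. 0" 0 0] by auto
  then show "(\<lambda>n. L2sq (\<lambda>x. grad (\<lambda>x. 0) x - (0::'a))) \<longlonglongrightarrow> 0" by (simp add: L2sq_def)
qed (auto simp: Cc_infinity_zero Lsobolev_def)

lemma D12_gradient_finite:
  assumes "D12_gradient u G"
  shows "L2sq G < \<top>"
proof -
  obtain f where m [measurable]: "u \<in> borel_measurable borel" "G \<in> borel_measurable borel"
    and f: "\<And>n. f n \<in> Cc_infinity"
    and lim: "(\<lambda>n. L2sq (\<lambda>x. grad (f n) x - G x)) \<longlonglongrightarrow> 0"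
    using assms unfolding D12_gradient_def by auto
  obtain n where "L2sq (\<lambda>x. grad (f n) x - G x) \<le> ennreal 1"
    using tendsto_0_ennrealD[OF lim, of 1] unfolding eventually_sequentially by auto
  then have n: "L2sq (\<lambda>x. G x - grad (f n) x) < \<top>"
    unfolding L2sq_minus_commute[of G] by (rule le_less_trans) simp
  have "L2sq (\<lambda>x. (G x - grad (f n) x) + grad (f n) x) \<le> 2 * L2sq (\<lambda>x. G x - grad (f n) x) + 2 * L2sq (grad (f n))"
    by (intro L2sq_add_le borel_measurable_diff Cc_infinity_grad_borel_measurable f m)
  also have "\<dots> < \<top>" using n by (simp add: dirichlet_norm_L2sq[OF f] ennreal_mult_less_top)
  finally show ?thesis by simp
qed

text \<open>The inequality for test functions survives the limit with worse constants: the factor 2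
  at \<open>d\<close> and the factor \<open>2 powr p\<close> are the price of the two crude triangle
  inequalities. An error e is carried along and sent to 0 at the end.\<close>

lemma D12_Sobolev_inequality:
  fixes u :: "'a::euclidean_space \<Rightarrow> real"
  assumes u: "D12_gradient u G" and N: "DIM('a) \<ge> 3" and d: "L2sq G \<le> ennreal d" "d \<ge> 0"
  shows "Lsobolev u \<le> ennreal (2 powr sobolev_exponent TYPE('a) *
    ((2 * (real DIM('a) - 1) / (real DIM('a) - 2))\<^sup>2 * (2 * d)) powr (real DIM('a) / (real DIM('a) - 2)))"
proof -
  define p where "p = sobolev_exponent TYPE('a)"
  define c where "c = (2 * (real DIM('a) - 1) / (real DIM('a) - 2))\<^sup>2"
  define k where "k = real DIM('a) / (real DIM('a) - 2)"
  have k: "k > 0" and c: "c \<ge> 0" using N by (auto simp: k_def c_def)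
  obtain f where m [measurable]: "u \<in> borel_measurable borel" "G \<in> borel_measurable borel"
    and f: "\<And>n. f n \<in> Cc_infinity"
    and G: "(\<lambda>n. L2sq (\<lambda>x. grad (f n) x - G x)) \<longlonglongrightarrow> 0"
    and lim: "(\<lambda>n. Lsobolev (\<lambda>x. f n x - u x)) \<longlonglongrightarrow> 0"
    using u unfolding D12_gradient_def by auto
  have le: "Lsobolev u \<le> ennreal (2 powr p * (e + (c * (2 * e + 2 * d)) powr k))" if e: "e > 0" for e
  proof -
    have "\<forall>\<^sub>F n in sequentially. L2sq (\<lambda>x. grad (f n) x - G x) \<le> ennreal e \<and> Lsobolev (\<lambda>x. f n x - u x) \<le> ennreal e"
      using tendsto_0_ennrealD[OF G e] tendsto_0_ennrealD[OF lim e] by (rule eventually_conj)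
    then obtain n where n: "L2sq (\<lambda>x. grad (f n) x - G x) \<le> ennreal e" "Lsobolev (\<lambda>x. f n x - u x) \<le> ennreal e"
      unfolding eventually_sequentially by blast
    have "L2sq (\<lambda>x. (grad (f n) x - G x) + G x) \<le> 2 * L2sq (\<lambda>x. grad (f n) x - G x) + 2 * L2sq G"
      by (intro L2sq_add_le borel_measurable_diff Cc_infinity_grad_borel_measurable f m)
    also have "\<dots> \<le> 2 * ennreal e + 2 * ennreal d"
      by (intro add_mono mult_left_mono n d) auto
    also have "\<dots> = ennreal (2 * e + 2 * d)" using e d by (simp add: ennreal_mult)
    finally have gf: "L2sq (grad (f n)) \<le> ennreal (2 * e + 2 * d)" by simp
    have "Lsobolev (f n) \<le> ennreal_powr (ennreal c * L2sq (grad (f n))) k"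
      unfolding Lsobolev_def L2sq_def c_def k_def by (rule Sobolev_inequality_Cc_infinity[OF f N])
    also have "\<dots> \<le> ennreal_powr (ennreal c * ennreal (2 * e + 2 * d)) k"
      using k by (intro ennreal_powr_mono mult_left_mono gf) auto
    also have "\<dots> = ennreal ((c * (2 * e + 2 * d)) powr k)"
      using k c e d by (simp add: ennreal_powr_ennreal ennreal_mult[symmetric] del: ennreal_plus)
    finally have fn: "Lsobolev (f n) \<le> ennreal ((c * (2 * e + 2 * d)) powr k)" .
    have "Lsobolev (\<lambda>x. (u x - f n x) + f n x) \<le> ennreal (2 powr p) * (Lsobolev (\<lambda>x. u x - f n x) + Lsobolev (f n))"
      unfolding p_def by (intro Lsobolev_add_le borel_measurable_diff Cc_infinity_borel_measurable f m N)
    also have "\<dots> \<le> ennreal (2 powr p) * (ennreal e + ennreal ((c * (2 * e + 2 * d)) powr k))"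
      unfolding Lsobolev_minus_commute[of u] by (intro mult_left_mono add_mono n fn) auto
    also have "\<dots> = ennreal (2 powr p * (e + (c * (2 * e + 2 * d)) powr k))"
      using e by (simp add: ennreal_mult)
    finally show ?thesis by simp
  qed
  have "(\<lambda>n. ennreal (2 powr p * (inverse (real (Suc n)) + (c * (2 * inverse (real (Suc n)) + 2 * d)) powr k)))
      \<longlonglongrightarrow> ennreal (2 powr p * (0 + (c * (2 * 0 + 2 * d)) powr k))"
  proof (intro tendsto_ennrealI tendsto_mult tendsto_add tendsto_const LIMSEQ_inverse_real_of_nat)
    have "(\<lambda>n. c * (2 * inverse (real (Suc n)) + 2 * d)) \<longlonglongrightarrow> c * (2 * 0 + 2 * d)"
      by (intro tendsto_mult tendsto_add tendsto_const LIMSEQ_inverse_real_of_nat)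
    then show "(\<lambda>n. (c * (2 * inverse (real (Suc n)) + 2 * d)) powr k) \<longlonglongrightarrow> (c * (2 * 0 + 2 * d)) powr k"
      by (rule tendsto_powr'[OF _ tendsto_const]) (use k c d in \<open>auto simp del: of_nat_Suc\<close>)
  qed
  then have "Lsobolev u \<le> ennreal (2 powr p * (0 + (c * (2 * 0 + 2 * d)) powr k))"
    by (rule LIMSEQ_le_const) (use le in \<open>auto simp del: of_nat_Suc\<close>)
  then show ?thesis by (simp add: p_def c_def k_def)
qed

text \<open>Diagonal argument: \<open>f n\<close> is a test function within 1 / (n + 1) of the
  \<open>n\<close>-th pair in both quantities.\<close>

lemma D12_gradient_closed:
  fixes u :: "'a::euclidean_space \<Rightarrow> real"
  assumes un: "\<And>n. D12_gradient (u' n) (G' n)" and N: "DIM('a) \<ge> 3"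
    and m [measurable]: "u \<in> borel_measurable borel" "G \<in> borel_measurable borel"
    and G: "(\<lambda>n. L2sq (\<lambda>x. G' n x - G x)) \<longlonglongrightarrow> 0"
    and u: "(\<lambda>n. Lsobolev (\<lambda>x. u' n x - u x)) \<longlonglongrightarrow> 0"
  shows "D12_gradient u G"
proof -
  have m' [measurable]: "u' n \<in> borel_measurable borel" "G' n \<in> borel_measurable borel" for n
    using un[of n] by (auto simp: D12_gradient_def)
  define e where "e n = inverse (real (Suc n))" for n
  have e: "e n > 0" for n by (simp add: e_def)
  have e0: "(\<lambda>n. ennreal (e n)) \<longlonglongrightarrow> 0"
    using tendsto_ennrealI[OF LIMSEQ_inverse_real_of_nat] by (simp add: e_def)
  have "\<exists>f. f \<in> Cc_infinity \<and> L2sq (\<lambda>x. grad f x - G' n x) \<le> ennreal (e n) \<and> Lsobolev (\<lambda>x. f x - u' n x) \<le> ennreal (e n)" for n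
  proof -
    obtain f where f: "\<And>k. f k \<in> Cc_infinity"
      and fG: "(\<lambda>k. L2sq (\<lambda>x. grad (f k) x - G' n x)) \<longlonglongrightarrow> 0"
      and fu: "(\<lambda>k. Lsobolev (\<lambda>x. f k x - u' n x)) \<longlonglongrightarrow> 0"
      using un[of n] unfolding D12_gradient_def by auto
    have "\<forall>\<^sub>F k in sequentially. L2sq (\<lambda>x. grad (f k) x - G' n x) \<le> ennreal (e n) \<and> Lsobolev (\<lambda>x. f k x - u' n x) \<le> ennreal (e n)"
      using tendsto_0_ennrealD[OF fG e[of n]] tendsto_0_ennrealD[OF fu e[of n]] by (rule eventually_conj)
    then obtain k where "L2sq (\<lambda>x. grad (f k) x - G' n x) \<le> ennreal (e n)" "Lsobolev (\<lambda>x. f k x - u' n x) \<le> ennreal (e n)"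
      unfolding eventually_sequentially by blast
    then show ?thesis using f by blast
  qed
  then have "\<forall>n. \<exists>f. f \<in> Cc_infinity \<and> L2sq (\<lambda>x. grad f x - G' n x) \<le> ennreal (e n) \<and> Lsobolev (\<lambda>x. f x - u' n x) \<le> ennreal (e n)"
    by blast
  from choice[OF this] obtain f where
    "\<forall>n. f n \<in> Cc_infinity \<and> L2sq (\<lambda>x. grad (f n) x - G' n x) \<le> ennreal (e n) \<and> Lsobolev (\<lambda>x. f n x - u' n x) \<le> ennreal (e n)" ..
  then have f: "\<And>n. f n \<in> Cc_infinity" and fG: "\<And>n. L2sq (\<lambda>x. grad (f n) x - G' n x) \<le> ennreal (e n)"
    and fu: "\<And>n. Lsobolev (\<lambda>x. f n x - u' n x) \<le> ennreal (e n)" by auto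
  note [measurable] = Cc_infinity_borel_measurable[OF f] Cc_infinity_grad_borel_measurable[OF f]
  have "(\<lambda>n. L2sq (\<lambda>x. grad (f n) x - G x)) \<longlonglongrightarrow> 0"
  proof (rule tendsto_0_ennreal_bound[OF e0 G])
    fix n
    have "L2sq (\<lambda>x. grad (f n) x - G x) \<le> 2 * L2sq (\<lambda>x. grad (f n) x - G' n x) + 2 * L2sq (\<lambda>x. G' n x - G x)"
      by (rule L2sq_triangle) measurable
    also have "\<dots> \<le> ennreal 2 * ennreal (e n) + ennreal 2 * L2sq (\<lambda>x. G' n x - G x)"
      by (simp add: mult_left_mono fG)
    finally show "L2sq (\<lambda>x. grad (f n) x - G x) \<le> \<dots>" .
  qed
  moreover have "(\<lambda>n. Lsobolev (\<lambda>x. f n x - u x)) \<longlonglongrightarrow> 0"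
  proof (rule tendsto_0_ennreal_bound[OF e0 u])
    fix n
    let ?c = "2 powr sobolev_exponent TYPE('a)"
    have "Lsobolev (\<lambda>x. (f n x - u' n x) + (u' n x - u x)) \<le> ennreal ?c * (Lsobolev (\<lambda>x. f n x - u' n x) + Lsobolev (\<lambda>x. u' n x - u x))"
      by (intro Lsobolev_add_le N) measurable
    also have "\<dots> \<le> ennreal ?c * ennreal (e n) + ennreal ?c * Lsobolev (\<lambda>x. u' n x - u x)"
      unfolding distrib_left by (intro add_mono mult_left_mono fu) auto
    finally show "Lsobolev (\<lambda>x. f n x - u x) \<le> ennreal ?c * ennreal (e n) + ennreal ?c * Lsobolev (\<lambda>x. u' n x - u x)"
      by simp
  qed
  ultimately show ?thesis unfolding D12_gradient_def using f m by blast
qed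

section \<open>Local convergence in L^1 and integration by parts\<close>

lemma nn_integral_indicator_le:
  fixes F :: "'a::euclidean_space \<Rightarrow> 'b::{second_countable_topology, real_normed_vector}"
  assumes [measurable]: "S \<in> sets borel" "F \<in> borel_measurable borel" and q: "q \<ge> 1" and \<eta>: "\<eta> > 0"
  shows "(\<integral>\<^sup>+x. indicator S x * ennreal (norm (F x)) \<partial>lborel)
    \<le> ennreal \<eta> * emeasure lborel S + ennreal (\<eta> powr (1 - q)) * (\<integral>\<^sup>+x. ennreal (norm (F x) powr q) \<partial>lborel)"
proof -
  \<comment> \<open>A value up to \<eta> is covered by the first summand; a larger \<open>s\<close>
    equals \<open>s powr (1 - q) * s powr q\<close>, where \<open>1 - q \<le> 0\<close> allows the
    first base to be lowered to \<eta>. This controls local L^1 norms for q = 2 and for the Sobolev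
    exponent alike.\<close>
  have s: "s \<le> \<eta> + \<eta> powr (1 - q) * s powr q" if "s \<ge> 0" for s
  proof (cases "s \<le> \<eta>")
    case False
    have "s = s powr (1 - q) * s powr q" using False \<eta> by (simp add: powr_add[symmetric])
    also have "\<dots> \<le> \<eta> powr (1 - q) * s powr q"
      using False \<eta> q by (intro mult_right_mono powr_mono2') auto
    finally show ?thesis using \<eta> by simp
  qed (use that in \<open>auto intro: add_increasing2\<close>)
  have "(\<integral>\<^sup>+x. indicator S x * ennreal (norm (F x)) \<partial>lborel)
      \<le> (\<integral>\<^sup>+x. ennreal \<eta> * indicator S x + ennreal (\<eta> powr (1 - q)) * ennreal (norm (F x) powr q) \<partial>lborel)"
  proof (rule nn_integral_mono)
    fix x
    have "ennreal (norm (F x)) \<le> ennreal (\<eta> + \<eta> powr (1 - q) * norm (F x) powr q)"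
      by (intro ennreal_leI s) simp
    also have "\<dots> = ennreal \<eta> + ennreal (\<eta> powr (1 - q)) * ennreal (norm (F x) powr q)"
      using \<eta> by (simp add: ennreal_mult)
    finally show "indicator S x * ennreal (norm (F x))
        \<le> ennreal \<eta> * indicator S x + ennreal (\<eta> powr (1 - q)) * ennreal (norm (F x) powr q)"
      by (simp add: indicator_def)
  qed
  also have "\<dots> = ennreal \<eta> * emeasure lborel S + ennreal (\<eta> powr (1 - q)) * (\<integral>\<^sup>+x. ennreal (norm (F x) powr q) \<partial>lborel)"
    by (simp add: nn_integral_add nn_integral_cmult nn_integral_cmult_indicator)
  finally show ?thesis .
qed

lemma nn_integral_indicator_tendsto_0:
  fixes F :: "nat \<Rightarrow> 'a::euclidean_space \<Rightarrow> 'b::{second_countable_topology, real_normed_vector}"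
  assumes S: "S \<in> sets borel" "emeasure lborel S < \<top>" and F: "\<And>n. F n \<in> borel_measurable borel" and q: "q \<ge> 1"
    and lim: "(\<lambda>n. \<integral>\<^sup>+x. ennreal (norm (F n x) powr q) \<partial>lborel) \<longlonglongrightarrow> 0"
  shows "(\<lambda>n. \<integral>\<^sup>+x. indicator S x * ennreal (norm (F n x)) \<partial>lborel) \<longlonglongrightarrow> 0"
proof (rule tendsto_0_ennrealI)
  fix e :: real assume e: "e > 0"
  obtain m where m: "emeasure lborel S = ennreal m" "m \<ge> 0"
    using S(2) by (cases "emeasure lborel S") auto
  \<comment> \<open>Adding 1 avoids division by a null volume; \<eta> makes the volume term at most
    e / 2, and \<delta> then does the same for the other term.\<close>
  define m' where "m' = m + 1"
  have m': "m' > 0" "m \<le> m'" using m by (auto simp: m'_def)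
  define \<eta> where "\<eta> = e / (2 * m')"
  define \<delta> where "\<delta> = e / 2 / \<eta> powr (1 - q)"
  have \<eta>: "\<eta> > 0" using e m' by (simp add: \<eta>_def)
  have \<delta>: "\<delta> > 0" "\<eta> powr (1 - q) * \<delta> = e / 2" using e \<eta> by (auto simp: \<delta>_def)
  have \<eta>m: "\<eta> * m \<le> e / 2"
  proof -
    have "\<eta> * m \<le> \<eta> * m'" using \<eta> m' by simp
    also have "\<dots> = e / 2" using m' by (simp add: \<eta>_def)
    finally show ?thesis .
  qed
  from tendsto_0_ennrealD[OF lim \<delta>(1)]
  show "\<forall>\<^sub>F n in sequentially. (\<integral>\<^sup>+x. indicator S x * ennreal (norm (F n x)) \<partial>lborel) \<le> ennreal e"
  proof eventually_elim
    case (elim n)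
    have "(\<integral>\<^sup>+x. indicator S x * ennreal (norm (F n x)) \<partial>lborel)
        \<le> ennreal \<eta> * emeasure lborel S + ennreal (\<eta> powr (1 - q)) * (\<integral>\<^sup>+x. ennreal (norm (F n x) powr q) \<partial>lborel)"
      by (rule nn_integral_indicator_le[OF S(1) F q \<eta>])
    also have "\<dots> \<le> ennreal \<eta> * ennreal m + ennreal (\<eta> powr (1 - q)) * ennreal \<delta>"
      unfolding m(1) by (intro add_left_mono mult_left_mono elim) simp
    also have "\<dots> = ennreal (\<eta> * m + e / 2)"
      using \<eta> m \<delta> e by (simp add: ennreal_mult[symmetric])
    also have "\<dots> \<le> ennreal e" by (rule ennreal_leI) (use \<eta>m in simp)
    finally show ?case .
  qed
qed

lemma nn_integral_norm_tendsto_0: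
  fixes F :: "nat \<Rightarrow> 'a::euclidean_space \<Rightarrow> 'b::{second_countable_topology, real_normed_vector}"
    and H :: "nat \<Rightarrow> 'a \<Rightarrow> 'c::real_normed_vector"
  assumes lim: "(\<lambda>n. \<integral>\<^sup>+x. indicator S x * ennreal (norm (F n x)) \<partial>lborel) \<longlonglongrightarrow> 0"
    and [measurable]: "S \<in> sets borel" "\<And>n. F n \<in> borel_measurable borel" and C: "C \<ge> 0"
    and le: "\<And>n x. norm (H n x) \<le> C * indicator S x * norm (F n x)"
  shows "(\<lambda>n. \<integral>\<^sup>+x. ennreal (norm (H n x)) \<partial>lborel) \<longlonglongrightarrow> 0"
proof (rule tendsto_0_ennreal_bound[OF lim tendsto_const, where A=C and B=0])
  fix n
  have "(\<integral>\<^sup>+x. ennreal (norm (H n x)) \<partial>lborel) \<le> (\<integral>\<^sup>+x. ennreal C * (indicator S x * ennreal (norm (F n x))) \<partial>lborel)"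
  proof (rule nn_integral_mono)
    fix x
    have "ennreal C * (indicator S x * ennreal (norm (F n x))) = ennreal (C * indicator S x * norm (F n x))"
      using C by (simp add: indicator_def ennreal_mult)
    then show "ennreal (norm (H n x)) \<le> ennreal C * (indicator S x * ennreal (norm (F n x)))"
      by (simp only: ennreal_leI[OF le])
  qed
  also have "\<dots> = ennreal C * (\<integral>\<^sup>+x. indicator S x * ennreal (norm (F n x)) \<partial>lborel)"
    by (rule nn_integral_cmult) measurable
  finally show "(\<integral>\<^sup>+x. ennreal (norm (H n x)) \<partial>lborel)
      \<le> ennreal C * (\<integral>\<^sup>+x. indicator S x * ennreal (norm (F n x)) \<partial>lborel) + ennreal 0 * 0"
    by simp
qed

lemma L2sq_powr: "L2sq F = (\<integral>\<^sup>+x. ennreal (norm (F x) powr 2) \<partial>lborel)"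
  by (simp add: L2sq_def powr_numeral)

lemma Lsobolev_norm:
  "Lsobolev (u :: 'a::euclidean_space \<Rightarrow> real) = (\<integral>\<^sup>+x. ennreal (norm (u x) powr sobolev_exponent TYPE('a)) \<partial>lborel)"
  by (simp add: Lsobolev_def)

text \<open>Integration by parts holds for the approximating \<open>f n\<close>. On a ball carrying
  the support of \<psi>, convergence in the Sobolev and the square integral implies convergence in
  L^1, so both sides pass to the limit. Continuity of \<open>u\<close> gives its local
  integrability.\<close>

lemma D12_gradient_has_weak_gradient:
  fixes u :: "'a::euclidean_space \<Rightarrow> real"
  assumes D: "D12_gradient u G" and u: "continuous_on UNIV u" and N: "DIM('a) \<ge> 3"
  shows "has_weak_gradient u G"
proof -
  obtain f where m [measurable]: "u \<in> borel_measurable borel" "G \<in> borel_measurable borel"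
    and f: "\<And>n. f n \<in> Cc_infinity"
    and fG: "(\<lambda>n. L2sq (\<lambda>x. grad (f n) x - G x)) \<longlonglongrightarrow> 0"
    and fu: "(\<lambda>n. Lsobolev (\<lambda>x. f n x - u x)) \<longlonglongrightarrow> 0"
    using D unfolding D12_gradient_def by auto
  note fm [measurable] = Cc_infinity_borel_measurable[OF f] Cc_infinity_grad_borel_measurable[OF f]
  have li_u: "locally_integrable u"
    unfolding locally_integrable_def set_integrable_def
    by (intro allI impI borel_integrable_compact continuous_on_subset[OF u]) auto
  have li_G: "locally_integrable G"
    unfolding locally_integrable_def set_integrable_def
  proof (intro allI impI integrableI_bounded)
    fix K :: "'a set" assume K: "compact K"
    then have Kb [measurable]: "K \<in> sets borel" by (simp add: borel_compact)
    show "(\<lambda>x. indicat_real K x *\<^sub>R G x) \<in> borel_measurable lborel" by measurable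
    have "(\<integral>\<^sup>+x. ennreal (norm (indicat_real K x *\<^sub>R G x)) \<partial>lborel) = (\<integral>\<^sup>+x. indicator K x * ennreal (norm (G x)) \<partial>lborel)"
      by (intro nn_integral_cong) (simp add: indicator_def)
    also have "\<dots> \<le> ennreal 1 * emeasure lborel K + ennreal (1 powr (1 - 2)) * (\<integral>\<^sup>+x. ennreal (norm (G x) powr 2) \<partial>lborel)"
      by (rule nn_integral_indicator_le) auto
    also have "\<dots> < \<top>"
      using D12_gradient_finite[OF D] emeasure_bounded_finite[OF compact_imp_bounded[OF K]] by (simp add: L2sq_powr)
    finally show "(\<integral>\<^sup>+x. ennreal (norm (indicat_real K x *\<^sub>R G x)) \<partial>lborel) < \<infinity>" by simp
  qed
  have "(LINT x|lborel. u x *\<^sub>R grad \<psi> x) = - (LINT x|lborel. \<psi> x *\<^sub>R G x)" if \<psi>: "\<psi> \<in> Cc_infinity" for \<psi>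
  proof -
    obtain R where R: "R > 0" "\<And>x. norm x \<ge> R \<Longrightarrow> \<psi> x = 0" "\<And>x. norm x \<ge> R \<Longrightarrow> grad \<psi> x = 0"
      using Cc_infinity_support[OF \<psi>] by auto
    obtain B where B: "B \<ge> 0" "\<And>x. norm (grad \<psi> x) \<le> B"
      using Cc_infinity_grad_bounded[OF \<psi>] by auto
    have "compact (\<psi> ` cball 0 R)"
      by (intro compact_continuous_image continuous_on_subset[OF Cc_infinity_continuous[OF \<psi>]]) auto
    then have "bounded (\<psi> ` cball 0 R)" by (rule compact_imp_bounded)
    then obtain B' where B': "\<forall>y\<in>\<psi> ` cball 0 R. norm y \<le> B'" unfolding bounded_iff ..
    note \<psi>m [measurable] = Cc_infinity_borel_measurable[OF \<psi>] Cc_infinity_grad_borel_measurable[OF \<psi>]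
    have [measurable]: "cball (0::'a) R \<in> sets borel" by (simp add: borel_closed)
    have fin: "emeasure lborel (cball (0::'a) R) < \<top>"
      using emeasure_bounded_finite[OF bounded_cball] by simp
    have "(\<lambda>n. \<integral>\<^sup>+x. indicator (cball 0 R) x * ennreal (norm (f n x - u x)) \<partial>lborel) \<longlonglongrightarrow> 0"
      by (rule nn_integral_indicator_tendsto_0[OF _ fin, where q="sobolev_exponent TYPE('a)"])
         (use fu sobolev_exponent_gt_1[OF N] in \<open>auto simp: Lsobolev_norm\<close>)
    then have l1: "(\<lambda>n. \<integral>\<^sup>+x. ennreal (norm (f n x *\<^sub>R grad \<psi> x - u x *\<^sub>R grad \<psi> x)) \<partial>lborel) \<longlonglongrightarrow> 0"
    proof (rule nn_integral_norm_tendsto_0)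
      fix n x
      have "norm (f n x *\<^sub>R grad \<psi> x - u x *\<^sub>R grad \<psi> x) = norm (grad \<psi> x) * norm (f n x - u x)"
        by (simp add: scaleR_diff_left[symmetric])
      also have "\<dots> \<le> B * indicator (cball 0 R) x * norm (f n x - u x)"
        using R(3)[of x] B by (intro mult_right_mono) (auto simp: indicator_def)
      finally show "norm (f n x *\<^sub>R grad \<psi> x - u x *\<^sub>R grad \<psi> x) \<le> B * indicator (cball 0 R) x * norm (f n x - u x)" .
    qed (use fm m B in \<open>auto intro!: borel_measurable_diff\<close>)
    have "(\<lambda>n. \<integral>\<^sup>+x. indicator (cball 0 R) x * ennreal (norm (grad (f n) x - G x)) \<partial>lborel) \<longlonglongrightarrow> 0"
      by (rule nn_integral_indicator_tendsto_0[OF _ fin, where q=2]) (use fG in \<open>auto simp: L2sq_powr\<close>)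
    then have l2: "(\<lambda>n. \<integral>\<^sup>+x. ennreal (norm (\<psi> x *\<^sub>R grad (f n) x - \<psi> x *\<^sub>R G x)) \<partial>lborel) \<longlonglongrightarrow> 0"
    proof (rule nn_integral_norm_tendsto_0)
      fix n x
      have "\<bar>\<psi> x\<bar> \<le> \<bar>B'\<bar> * indicator (cball 0 R) x"
      proof (cases "norm x \<le> R")
        case True
        then show ?thesis using B' by force
      qed (use R(2)[of x] in simp)
      then have "\<bar>\<psi> x\<bar> * norm (grad (f n) x - G x) \<le> \<bar>B'\<bar> * indicator (cball 0 R) x * norm (grad (f n) x - G x)"
        by (rule mult_right_mono) simp
      then show "norm (\<psi> x *\<^sub>R grad (f n) x - \<psi> x *\<^sub>R G x) \<le> \<bar>B'\<bar> * indicator (cball 0 R) x * norm (grad (f n) x - G x)"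
        by (simp add: scaleR_diff_right[symmetric])
    qed (use fm m in \<open>auto intro!: borel_measurable_diff\<close>)
    have int: "integrable lborel (\<lambda>x. v x *\<^sub>R grad \<psi> x)" if "continuous_on UNIV v" for v
      by (rule integrable_compact_support[where R=R])
         (use R that in \<open>auto intro!: continuous_intros Cc_infinity_continuous_grad \<psi>\<close>)
    have int': "integrable lborel (\<lambda>x. \<psi> x *\<^sub>R grad (f n) x)" for n
      by (rule integrable_compact_support[where R=R])
         (use R in \<open>auto intro!: continuous_intros Cc_infinity_continuous Cc_infinity_continuous_grad \<psi> f\<close>)
    have L1: "(\<lambda>n. LINT x|lborel. f n x *\<^sub>R grad \<psi> x) \<longlonglongrightarrow> (LINT x|lborel. u x *\<^sub>R grad \<psi> x)"
      by (rule tendsto_L1_int[OF _ _ l1]) (intro int u Cc_infinity_continuous f)+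
    have L2: "(\<lambda>n. LINT x|lborel. \<psi> x *\<^sub>R grad (f n) x) \<longlonglongrightarrow> (LINT x|lborel. \<psi> x *\<^sub>R G x)"
      by (rule tendsto_L1_int[OF _ _ l2]) (intro int' integrable_test_function_mult li_G \<psi>)+
    have "(LINT x|lborel. f n x *\<^sub>R grad \<psi> x) = - (LINT x|lborel. \<psi> x *\<^sub>R grad (f n) x)" for n
      by (rule integral_by_parts_Cc_infinity[OF f \<psi>])
    then have "(\<lambda>n. LINT x|lborel. f n x *\<^sub>R grad \<psi> x) \<longlonglongrightarrow> - (LINT x|lborel. \<psi> x *\<^sub>R G x)"
      using tendsto_minus[OF L2] by simp
    with L1 show ?thesis by (rule LIMSEQ_unique)
  qed
  then show ?thesis unfolding has_weak_gradient_def using li_u li_G by blast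
qed

lemma nn_integral_lborel_translation:
  fixes F :: "'a::euclidean_space \<Rightarrow> ennreal"
  assumes [measurable]: "F \<in> borel_measurable borel"
  shows "(\<integral>\<^sup>+x. F (x + c) \<partial>lborel) = (\<integral>\<^sup>+x. F x \<partial>lborel)"
proof -
  have "(\<integral>\<^sup>+x. F x \<partial>lborel) = (\<integral>\<^sup>+x. F x \<partial>distr lborel borel ((+) c))"
    by (simp only: lborel_distr_plus)
  also have "\<dots> = (\<integral>\<^sup>+x. F (c + x) \<partial>lborel)" by (rule nn_integral_distr) auto
  finally show ?thesis by (simp add: add.commute)
qed

text \<open>Within distance |u x| / (2 L) of \<open>x\<close> the function loses at most half of its
  value, so the ball of that radius contributes a definite amount to the Sobolev integral.\<close>

lemma Lipschitz_sup_bound: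
  fixes u :: "'a::euclidean_space \<Rightarrow> real"
  assumes L: "L > 0" "\<And>x y. \<bar>u x - u y\<bar> \<le> L * norm (x - y)" and m: "u \<in> borel_measurable borel"
    and A: "Lsobolev u \<le> ennreal A" "A \<ge> 0" and N: "DIM('a) \<ge> 3"
  shows "(\<bar>u x\<bar> / 2) powr sobolev_exponent TYPE('a) * (unit_ball_vol (real DIM('a)) * (\<bar>u x\<bar> / (2 * L)) ^ DIM('a)) \<le> A"
proof -
  let ?p = "sobolev_exponent TYPE('a)"
  note [measurable] = m
  define r where "r = \<bar>u x\<bar> / (2 * L)"
  have r: "r \<ge> 0" using L by (simp add: r_def)
  have "ennreal ((\<bar>u x\<bar> / 2) powr ?p * (unit_ball_vol (real DIM('a)) * r ^ DIM('a)))
      = ennreal ((\<bar>u x\<bar> / 2) powr ?p) * emeasure lborel (ball x r)"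
    using r by (simp add: emeasure_ball ennreal_mult)
  also have "\<dots> = (\<integral>\<^sup>+y. ennreal ((\<bar>u x\<bar> / 2) powr ?p) * indicator (ball x r) y \<partial>lborel)"
    by (simp add: nn_integral_cmult_indicator)
  also have "\<dots> \<le> Lsobolev u"
    unfolding Lsobolev_def
  proof (rule nn_integral_mono)
    fix y
    show "ennreal ((\<bar>u x\<bar> / 2) powr ?p) * indicator (ball x r) y \<le> ennreal (\<bar>u y\<bar> powr ?p)"
    proof (cases "y \<in> ball x r")
      case True
      then have "L * norm (x - y) \<le> L * r" using L by (intro mult_left_mono) (auto simp: dist_norm)
      then have "\<bar>u x - u y\<bar> \<le> \<bar>u x\<bar> / 2" using L(2)[of x y] L(1) by (simp add: r_def)
      then have "\<bar>u x\<bar> / 2 \<le> \<bar>u y\<bar>" by linarith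
      then have "(\<bar>u x\<bar> / 2) powr ?p \<le> \<bar>u y\<bar> powr ?p"
        using sobolev_exponent_gt_1[OF N] by (intro powr_mono2) auto
      then show ?thesis using True by (simp add: ennreal_leI)
    qed simp
  qed
  also note A(1)
  finally show ?thesis using A(2) by (simp add: r_def)
qed

lemma D12_Lipschitz_sup_bound:
  assumes N: "DIM('a::euclidean_space) \<ge> 3"
  shows "\<exists>C>0. \<forall>(u :: 'a \<Rightarrow> real) G d x. D12_gradient u G \<longrightarrow> (\<forall>x y. \<bar>u x - u y\<bar> \<le> 2 * norm (x - y)) \<longrightarrow>
    d \<ge> 0 \<longrightarrow> L2sq G \<le> ennreal d \<longrightarrow> \<bar>u x\<bar> ^ DIM('a) \<le> C * d"
proof -
  define p where "p = sobolev_exponent TYPE('a)"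
  define n where "n = real DIM('a)"
  define c where "c = (2 * (n - 1) / (n - 2))\<^sup>2 * 2"
  define k where "k = n / (n - 2)"
  define w where "w = unit_ball_vol n"
  have n: "n \<ge> 3" using N by (simp add: n_def)
  have k: "k > 0" and c: "c > 0" and w: "w > 0" using n by (auto simp: k_def c_def w_def)
  \<comment> \<open>This identity makes the final bound linear in \<open>d\<close>: the left side
    becomes \<open>s ^ DIM('a)\<close> to the power \<open>k\<close>, the right a multiple of
    \<open>d powr k\<close>, and the \<open>k\<close>-th root is taken.\<close>
  have pnk: "p + n = n * k"
  proof -
    have "n - 2 > 0" using n by simp
    then have "p + n = (2 * n + n * (n - 2)) / (n - 2)"
      by (simp add: p_def sobolev_exponent_def n_def[symmetric] add_divide_distrib)
    also have "\<dots> = n * k" by (simp add: k_def algebra_simps)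
    finally show ?thesis .
  qed
  \<comment> \<open>\<open>Q\<close> gathers all constants, among them the unit ball volume
    \<open>w\<close> and 4 = 2 * 2 from the radius for Lipschitz constant 2.\<close>
  define Q where "Q = 2 powr p * 2 powr p * 4 ^ DIM('a) / w * c powr k"
  have Q: "Q > 0" using w c by (simp add: Q_def)
  have "\<bar>u x\<bar> ^ DIM('a) \<le> Q powr (1 / k) * d"
    if u: "D12_gradient u G" and L: "\<forall>x y. \<bar>u x - u y\<bar> \<le> 2 * norm (x - y)" and d: "d \<ge> 0" "L2sq G \<le> ennreal d"
    for u :: "'a \<Rightarrow> real" and G d x
  proof (cases "u x = 0")
    case True
    then show ?thesis using N d by (simp add: power_0_left)
  next
    case False
    define s where "s = \<bar>u x\<bar>"
    have s: "s > 0" using False by (simp add: s_def)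
    have um: "u \<in> borel_measurable borel" using u by (simp add: D12_gradient_def)
    have "Lsobolev u \<le> ennreal (2 powr p * (c * d) powr k)"
      using D12_Sobolev_inequality[OF u N d(2,1)] by (simp add: p_def c_def k_def n_def mult.assoc)
    then have "(s / 2) powr p * (w * (s / (2 * 2)) ^ DIM('a)) \<le> 2 powr p * (c * d) powr k"
      unfolding s_def p_def w_def n_def
      by (intro Lipschitz_sup_bound um N) (use L in auto)
    then have le: "s powr p * s ^ DIM('a) * (w / (2 powr p * 4 ^ DIM('a))) \<le> 2 powr p * (c powr k * d powr k)"
      using s c d by (simp add: powr_divide power_divide powr_mult mult_ac)
    have "(s ^ DIM('a)) powr k = s powr p * s ^ DIM('a)"
    proof -
      have "(s ^ DIM('a)) powr k = s powr (n * k)"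
        using s by (simp add: powr_realpow[symmetric] powr_powr n_def)
      also have "\<dots> = s powr p * s powr n" by (simp only: pnk[symmetric] powr_add)
      also have "s powr n = s ^ DIM('a)" using s by (simp add: n_def powr_realpow)
      finally show ?thesis .
    qed
    then have "(s ^ DIM('a)) powr k \<le> Q * d powr k"
      using le w by (simp add: Q_def field_simps)
    then have "((s ^ DIM('a)) powr k) powr (1 / k) \<le> (Q * d powr k) powr (1 / k)"
      using k by (intro powr_mono2) auto
    then have "s ^ DIM('a) \<le> Q powr (1 / k) * d"
      using k s d Q by (simp add: powr_powr powr_mult)
    then show ?thesis by (simp add: s_def)
  qed
  then show ?thesis using Q by (intro exI[of _ "Q powr (1 / k)"]) auto
qed

section \<open>Bounded gradients and Lipschitz functions\<close>

text \<open>The increment is an integral of the gradient over a segment. A single segment might lie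
  in the null set where \<open>G\<close> is not bounded by 1, so increments are integrated over
  \<open>B\<close>: by Tonelli and translation invariance each \<open>t\<close> sees a translate of
  \<open>B\<close>, on which |grad f| \<le> 1 + |grad f - G| almost everywhere.\<close>

lemma ball_difference_estimate:
  fixes f :: "'a::euclidean_space \<Rightarrow> real"
  assumes f: "f \<in> Cc_infinity" and G [measurable]: "G \<in> borel_measurable borel"
    and G1: "AE x in lborel. norm (G x) \<le> 1"
    and B [measurable]: "B \<in> sets borel" and K [measurable]: "K \<in> sets borel"
    and BK: "\<And>y t. y \<in> B \<Longrightarrow> 0 \<le> t \<Longrightarrow> t \<le> 1 \<Longrightarrow> y + t *\<^sub>R h \<in> K"
  shows "(\<integral>\<^sup>+y. indicator B y * ennreal \<bar>f (y + h) - f y\<bar> \<partial>lborel)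
    \<le> ennreal (norm h) * (emeasure lborel B + (\<integral>\<^sup>+z. indicator K z * ennreal (norm (grad f z - G z)) \<partial>lborel))"
proof -
  note [measurable] = Cc_infinity_borel_measurable[OF f] Cc_infinity_grad_borel_measurable[OF f]
  define X where "X = (\<integral>\<^sup>+z. indicator K z * ennreal (norm (grad f z - G z)) \<partial>lborel)"
  define \<Phi> where "\<Phi> y t = ennreal (indicator {0..1} t *\<^sub>R (norm (grad f (y + t *\<^sub>R h)) * norm h))" for y and t :: real
  have p: "ennreal \<bar>f (y + h) - f y\<bar> \<le> (\<integral>\<^sup>+t. \<Phi> y t \<partial>lborel)" for y
  proof -
    have "ennreal \<bar>f (y + 1 *\<^sub>R h) - f (y + 0 *\<^sub>R h)\<bar> \<le> (\<integral>\<^sup>+t. \<Phi> y t \<partial>lborel)"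
      unfolding \<Phi>_def
    proof (rule FTC_nn_integral_bound[where d="\<lambda>t. grad f (y + t *\<^sub>R h) \<bullet> h"])
      show "((\<lambda>t. f (y + t *\<^sub>R h)) has_vector_derivative grad f (y + t *\<^sub>R h) \<bullet> h) (at t)" for t
        by (rule has_real_derivative_iff_has_vector_derivative[THEN iffD1, OF has_real_derivative_along_line[OF f]])
      have "continuous_on UNIV (\<lambda>t. grad f (y + t *\<^sub>R h))"
        by (rule continuous_on_compose2[OF Cc_infinity_continuous_grad[OF f]]) (auto intro!: continuous_intros)
      then show "continuous_on UNIV (\<lambda>t. norm (grad f (y + t *\<^sub>R h)) * norm h)"
        by (intro continuous_intros)
      show "\<bar>grad f (y + t *\<^sub>R h) \<bullet> h\<bar> \<le> norm (grad f (y + t *\<^sub>R h)) * norm h" for t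
        by (rule Cauchy_Schwarz_ineq2)
    qed simp
    then show ?thesis by simp
  qed
  have \<Phi>m: "(\<lambda>t. \<Phi> y t) \<in> borel_measurable lborel" for y unfolding \<Phi>_def by measurable
  have B\<Phi>m: "case_prod (\<lambda>t y. indicator B y * \<Phi> y t) \<in> borel_measurable (lborel \<Otimes>\<^sub>M lborel)"
    unfolding \<Phi>_def by measurable
  have "(\<integral>\<^sup>+y. indicator B y * ennreal \<bar>f (y + h) - f y\<bar> \<partial>lborel)
      \<le> (\<integral>\<^sup>+y. (\<integral>\<^sup>+t. indicator B y * \<Phi> y t \<partial>lborel) \<partial>lborel)"
    by (intro nn_integral_mono, subst nn_integral_cmult[OF \<Phi>m]) (intro mult_left_mono p zero_le)
  also have "\<dots> = (\<integral>\<^sup>+t. (\<integral>\<^sup>+y. indicator B y * \<Phi> y t \<partial>lborel) \<partial>lborel)"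
    by (rule lborel_pair.Fubini'[OF B\<Phi>m])
  also have "\<dots> \<le> (\<integral>\<^sup>+t. (ennreal (norm h) * (emeasure lborel B + X)) * indicator {0..1::real} t \<partial>lborel)"
  proof (rule nn_integral_mono)
    fix t :: real
    show "(\<integral>\<^sup>+y. indicator B y * \<Phi> y t \<partial>lborel) \<le> (ennreal (norm h) * (emeasure lborel B + X)) * indicator {0..1} t"
    proof (cases "t \<in> {0..1}")
      case True
      define F where "F z = indicator B (z - t *\<^sub>R h) * ennreal (norm (grad f z))" for z
      have Fm [measurable]: "F \<in> borel_measurable borel" unfolding F_def by measurable
      have "(\<integral>\<^sup>+y. indicator B y * \<Phi> y t \<partial>lborel) = (\<integral>\<^sup>+y. ennreal (norm h) * F (y + t *\<^sub>R h) \<partial>lborel)"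
        using True by (intro nn_integral_cong) (simp add: \<Phi>_def F_def ennreal_mult mult_ac)
      also have "\<dots> = ennreal (norm h) * (\<integral>\<^sup>+y. F (y + t *\<^sub>R h) \<partial>lborel)"
        by (rule nn_integral_cmult) measurable
      also have "(\<integral>\<^sup>+y. F (y + t *\<^sub>R h) \<partial>lborel) = (\<integral>\<^sup>+z. F z \<partial>lborel)"
        by (rule nn_integral_lborel_translation) measurable
      also have "\<dots> \<le> (\<integral>\<^sup>+z. indicator B (z + - (t *\<^sub>R h)) + indicator K z * ennreal (norm (grad f z - G z)) \<partial>lborel)"
      proof (rule nn_integral_mono_AE)
        show "AE z in lborel. F z \<le> indicator B (z + - (t *\<^sub>R h)) + indicator K z * ennreal (norm (grad f z - G z))"
          using G1
        proof eventually_elim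
          case (elim z)
          show ?case
          proof (cases "z - t *\<^sub>R h \<in> B")
            case zB: True
            then have zK: "z \<in> K" using BK[of "z - t *\<^sub>R h" t] True by simp
            have "norm (grad f z) \<le> norm (G z) + norm (grad f z - G z)" by (rule norm_triangle_sub)
            also have "\<dots> \<le> 1 + norm (grad f z - G z)" using elim by simp
            finally have "ennreal (norm (grad f z)) \<le> ennreal (1 + norm (grad f z - G z))" by (rule ennreal_leI)
            then show ?thesis using zB zK by (simp add: F_def)
          qed (simp add: F_def)
        qed
      qed
      also have "\<dots> = (\<integral>\<^sup>+z. indicator B (z + - (t *\<^sub>R h)) \<partial>lborel) + X"
        unfolding X_def by (rule nn_integral_add) measurable
      also have "(\<integral>\<^sup>+z. indicator B (z + - (t *\<^sub>R h)) \<partial>lborel) = (\<integral>\<^sup>+z. indicator B z \<partial>(lborel :: 'a measure))"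
        by (rule nn_integral_lborel_translation) measurable
      also have "\<dots> = emeasure lborel B" by simp
      finally show ?thesis using True by (simp add: mult_left_mono)
    qed (simp add: \<Phi>_def)
  qed
  also have "\<dots> = ennreal (norm h) * (emeasure lborel B + X)"
    by (subst nn_integral_cmult_indicator) auto
  finally show ?thesis by (simp add: X_def)
qed

text \<open>Averaging over a small ball: the averages of the increments of the approximating functions are controlled
  by local averages of their gradients, which converge to those of \<open>G\<close>.\<close>

lemma D12_gradient_Lipschitz:
  fixes u :: "'a::euclidean_space \<Rightarrow> real"
  assumes D: "D12_gradient u G" and u: "continuous_on UNIV u" and N: "DIM('a) \<ge> 3"
    and G1: "AE x in lborel. norm (G x) \<le> 1"
  shows "\<bar>u x - u y\<bar> \<le> norm (x - y)"
proof (rule ccontr)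
  assume "\<not> \<bar>u x - u y\<bar> \<le> norm (x - y)"
  define h where "h = y - x"
  have "norm h < \<bar>u (x + h) - u x\<bar>"
    using \<open>\<not> \<bar>u x - u y\<bar> \<le> norm (x - y)\<close> by (simp add: h_def norm_minus_commute abs_minus_commute)
  \<comment> \<open>A level strictly in between: by continuity the increment stays above
    \<open>c\<close> on a whole ball, which can be compared with averages.\<close>
  then obtain c where c: "norm h < c" "c < \<bar>u (x + h) - u x\<bar>" using dense by blast
  have "continuous_on UNIV (\<lambda>z. \<bar>u (z + h) - u z\<bar>)"
    by (intro continuous_intros continuous_on_compose2[OF u]) auto
  then have "open {z. c < \<bar>u (z + h) - u z\<bar>}"
    by (rule open_Collect_less[OF continuous_on_const])
  then obtain r where r: "r > 0" "\<And>z. z \<in> ball x r \<Longrightarrow> c < \<bar>u (z + h) - u z\<bar>"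
    using c(2) unfolding open_contains_ball by blast
  define B where "B = ball x r"
  define K where "K = cball (0::'a) (norm x + r + norm h)"
  have Bm [measurable]: "B \<in> sets borel" and Km [measurable]: "K \<in> sets borel"
    by (auto simp: B_def K_def borel_closed)
  have BK: "z + t *\<^sub>R h \<in> K" if "z \<in> B" "0 \<le> t" "t \<le> 1" for z t
  proof -
    have "norm (z + t *\<^sub>R h) \<le> norm z + t * norm h"
      using norm_triangle_ineq[of z "t *\<^sub>R h"] that by simp
    also have "t * norm h \<le> 1 * norm h" using that by (intro mult_right_mono) auto
    also have "norm z \<le> norm x + r"
      using that(1) norm_triangle_sub[of z x] by (simp add: B_def dist_norm norm_minus_commute)
    finally show ?thesis by (simp add: K_def)
  qed
  have Kfin: "emeasure lborel K < \<top>"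
    using emeasure_bounded_finite[OF bounded_cball[of "0::'a"]] by (simp add: K_def)
  define v where "v = unit_ball_vol (real DIM('a)) * r ^ DIM('a)"
  have v: "emeasure lborel B = ennreal v" "v > 0"
    using r by (auto simp: B_def v_def emeasure_ball)
  obtain f where m [measurable]: "u \<in> borel_measurable borel" "G \<in> borel_measurable borel"
    and f: "\<And>n. f n \<in> Cc_infinity"
    and fG: "(\<lambda>n. L2sq (\<lambda>x. grad (f n) x - G x)) \<longlonglongrightarrow> 0"
    and fu: "(\<lambda>n. Lsobolev (\<lambda>x. f n x - u x)) \<longlonglongrightarrow> 0"
    using D unfolding D12_gradient_def by auto
  note fm [measurable] = Cc_infinity_borel_measurable[OF f] Cc_infinity_grad_borel_measurable[OF f]
  define X where "X n = (\<integral>\<^sup>+z. indicator K z * ennreal (norm (grad (f n) z - G z)) \<partial>lborel)" for n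
  define Y where "Y n = (\<integral>\<^sup>+z. indicator K z * ennreal (norm (f n z - u z)) \<partial>lborel)" for n
  have X: "X \<longlonglongrightarrow> 0" unfolding X_def[abs_def]
    by (rule nn_integral_indicator_tendsto_0[OF Km Kfin, where q=2]) (use fG in \<open>auto simp: L2sq_powr\<close>)
  have Y: "Y \<longlonglongrightarrow> 0" unfolding Y_def[abs_def]
    by (rule nn_integral_indicator_tendsto_0[OF Km Kfin, where q="sobolev_exponent TYPE('a)"])
       (use fu sobolev_exponent_gt_1[OF N] in \<open>auto simp: Lsobolev_norm\<close>)
  define I where "I = (\<integral>\<^sup>+z. indicator B z * ennreal \<bar>u (z + h) - u z\<bar> \<partial>lborel)"
  \<comment> \<open>Replacing \<open>u\<close> by \<open>f n\<close> at the two ends of the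
    increment costs \<open>Y n\<close> each; the increment of \<open>f n\<close> itself is governed
    by \<open>ball_difference_estimate\<close>.\<close>
  have I_le: "I \<le> (Y n + Y n) + ennreal (norm h) * (ennreal v + X n)" for n
  proof -
    have Y1: "(\<integral>\<^sup>+z. indicator B z * ennreal (norm (f n (z + s *\<^sub>R h) - u (z + s *\<^sub>R h))) \<partial>lborel) \<le> Y n"
      if s: "s \<in> {0, 1}" for s
    proof -
      have "(\<integral>\<^sup>+z. indicator B z * ennreal (norm (f n (z + s *\<^sub>R h) - u (z + s *\<^sub>R h))) \<partial>lborel)
          \<le> (\<integral>\<^sup>+z. indicator K (z + s *\<^sub>R h) * ennreal (norm (f n (z + s *\<^sub>R h) - u (z + s *\<^sub>R h))) \<partial>lborel)"
      proof (intro nn_integral_mono mult_right_mono zero_le)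
        fix z
        have "z + s *\<^sub>R h \<in> K" if "z \<in> B" using BK[OF that, of s] s by auto
        then show "(indicator B z :: ennreal) \<le> indicator K (z + s *\<^sub>R h)" by (auto simp: indicator_def)
      qed
      also have "\<dots> = Y n"
        unfolding Y_def by (rule nn_integral_lborel_translation) measurable
      finally show ?thesis .
    qed
    have "I \<le> (\<integral>\<^sup>+z. (indicator B z * ennreal (norm (f n (z + 1 *\<^sub>R h) - u (z + 1 *\<^sub>R h)))
        + indicator B z * ennreal (norm (f n (z + 0 *\<^sub>R h) - u (z + 0 *\<^sub>R h))))
        + indicator B z * ennreal \<bar>f n (z + h) - f n z\<bar> \<partial>lborel)"
      unfolding I_def
    proof (rule nn_integral_mono)
      fix z
      have "ennreal \<bar>u (z + h) - u z\<bar> \<le> ennreal ((\<bar>f n (z + h) - u (z + h)\<bar> + \<bar>f n z - u z\<bar>) + \<bar>f n (z + h) - f n z\<bar>)"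
        by (rule ennreal_leI) linarith
      also have "\<dots> = (ennreal \<bar>f n (z + h) - u (z + h)\<bar> + ennreal \<bar>f n z - u z\<bar>) + ennreal \<bar>f n (z + h) - f n z\<bar>"
        by simp
      finally show "indicator B z * ennreal \<bar>u (z + h) - u z\<bar>
          \<le> (indicator B z * ennreal (norm (f n (z + 1 *\<^sub>R h) - u (z + 1 *\<^sub>R h)))
        + indicator B z * ennreal (norm (f n (z + 0 *\<^sub>R h) - u (z + 0 *\<^sub>R h))))
        + indicator B z * ennreal \<bar>f n (z + h) - f n z\<bar>"
        by (simp add: indicator_def)
    qed
    also have "\<dots> = (\<integral>\<^sup>+z. indicator B z * ennreal (norm (f n (z + 1 *\<^sub>R h) - u (z + 1 *\<^sub>R h)))
          + indicator B z * ennreal (norm (f n (z + 0 *\<^sub>R h) - u (z + 0 *\<^sub>R h))) \<partial>lborel)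
        + (\<integral>\<^sup>+z. indicator B z * ennreal \<bar>f n (z + h) - f n z\<bar> \<partial>lborel)"
      by (rule nn_integral_add) measurable
    also have "(\<integral>\<^sup>+z. indicator B z * ennreal (norm (f n (z + 1 *\<^sub>R h) - u (z + 1 *\<^sub>R h)))
          + indicator B z * ennreal (norm (f n (z + 0 *\<^sub>R h) - u (z + 0 *\<^sub>R h))) \<partial>lborel)
        = (\<integral>\<^sup>+z. indicator B z * ennreal (norm (f n (z + 1 *\<^sub>R h) - u (z + 1 *\<^sub>R h))) \<partial>lborel) + (\<integral>\<^sup>+z. indicator B z * ennreal (norm (f n (z + 0 *\<^sub>R h) - u (z + 0 *\<^sub>R h))) \<partial>lborel)"
      by (rule nn_integral_add) measurable
    finally have I_sum: "I \<le> (\<integral>\<^sup>+z. indicator B z * ennreal (norm (f n (z + 1 *\<^sub>R h) - u (z + 1 *\<^sub>R h))) \<partial>lborel)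
        + (\<integral>\<^sup>+z. indicator B z * ennreal (norm (f n (z + 0 *\<^sub>R h) - u (z + 0 *\<^sub>R h))) \<partial>lborel)
        + (\<integral>\<^sup>+z. indicator B z * ennreal \<bar>f n (z + h) - f n z\<bar> \<partial>lborel)" .
    have I_diff: "(\<integral>\<^sup>+z. indicator B z * ennreal \<bar>f n (z + h) - f n z\<bar> \<partial>lborel) \<le> ennreal (norm h) * (ennreal v + X n)"
      unfolding v(1)[symmetric] X_def
      by (rule ball_difference_estimate[OF f m(2) G1 Bm Km BK])
    show ?thesis
      by (rule order_trans[OF I_sum add_mono[OF add_mono[OF Y1 Y1] I_diff]]) auto
  qed
  have "I \<le> ennreal (norm h * v)"
  proof (rule ennreal_le_epsilon)
    fix e :: real assume e: "e > 0"
    \<comment> \<open>The two copies of \<open>Y n\<close> and the term \<open>norm h * X n\<close>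
      contribute at most \<open>(2 + norm h) * d\<close>, which is to be \<open>e\<close>.\<close>
    define d where "d = e / (2 + norm h)"
    have "2 + norm h > 0" using norm_ge_zero[of h] by linarith
    then have d: "d > 0" "(2 + norm h) * d = e" using e by (auto simp: d_def)
    have "\<forall>\<^sub>F n in sequentially. X n \<le> ennreal d \<and> Y n \<le> ennreal d"
      using tendsto_0_ennrealD[OF X d(1)] tendsto_0_ennrealD[OF Y d(1)] by (rule eventually_conj)
    then obtain n where n: "X n \<le> ennreal d" "Y n \<le> ennreal d"
      unfolding eventually_sequentially by blast
    have "I \<le> (Y n + Y n) + ennreal (norm h) * (ennreal v + X n)" by (rule I_le)
    also have "\<dots> \<le> (ennreal d + ennreal d) + ennreal (norm h) * (ennreal v + ennreal d)"
      by (intro add_mono mult_left_mono n order_refl zero_le)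
    also have "\<dots> = ennreal (d + d + norm h * (v + d))"
      using d v by (simp add: ennreal_mult[symmetric] ennreal_plus[symmetric] del: ennreal_plus)
    also have "d + d + norm h * (v + d) = norm h * v + e"
      using d(2) by (simp add: algebra_simps)
    also have "ennreal (norm h * v + e) = ennreal (norm h * v) + ennreal e"
      using v e by simp
    finally show "I \<le> ennreal (norm h * v) + ennreal e" .
  qed
  \<comment> \<open>The ball has positive volume \<open>v\<close>, so this lower bound contradicts
    the upper one, as \<open>norm h < c\<close>.\<close>
  moreover have "ennreal (c * v) \<le> I"
  proof -
    have c0: "c > 0" using c(1) norm_ge_zero[of h] by linarith
    have "ennreal (c * v) = (\<integral>\<^sup>+z. ennreal c * indicator B z \<partial>lborel)"
      using c0 v by (simp add: nn_integral_cmult_indicator ennreal_mult)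
    also have "\<dots> \<le> I"
      unfolding I_def
      by (intro nn_integral_mono) (use r(2) in \<open>auto simp: indicator_def B_def intro!: ennreal_leI less_imp_le\<close>)
    finally show ?thesis .
  qed
  ultimately have "ennreal (c * v) \<le> ennreal (norm h * v)" by (rule order_trans[rotated])
  then have "c * v \<le> norm h * v" using v(2) by (subst (asm) ennreal_le_iff) auto
  then show False using c(1) v(2) by simp
qed

section \<open>The Born-Infeld energy\<close>

definition BI_density :: "'a::euclidean_space \<Rightarrow> real" where
  "BI_density v = 1 - sqrt (1 - (norm v)\<^sup>2)"

lemma measurable_BI_density [measurable]:
  "G \<in> borel_measurable M \<Longrightarrow> (\<lambda>x. BI_density (G x)) \<in> borel_measurable M"
  unfolding BI_density_def by measurable

lemma isCont_BI_density: "isCont BI_density v"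
  unfolding BI_density_def[abs_def] by (intro continuous_intros)

text \<open>With a = 1 - |v|^2 in [0, 1], the estimates express a \<le> sqrt a \<le> (1 + a) / 2.
  The lower bound of the density gives coercivity, the upper one integrability.\<close>

lemma BI_density_bounds:
  assumes "norm v \<le> 1"
  shows "(norm v)\<^sup>2 / 2 \<le> BI_density v" "BI_density v \<le> (norm v)\<^sup>2" "0 \<le> BI_density v"
proof -
  define a where "a = 1 - (norm v)\<^sup>2"
  have a: "0 \<le> a" "a \<le> 1" using assms by (auto simp: a_def abs_square_le_1)
  have "sqrt a \<le> (1 + a) / 2"
    using arith_geo_mean_sqrt[of a 1] a by simp
  then show 1: "(norm v)\<^sup>2 / 2 \<le> BI_density v" by (simp add: BI_density_def a_def field_simps)
  have "a \<le> sqrt a"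
    using a by (intro real_le_rsqrt) (simp add: power2_eq_square mult_left_le)
  then show "BI_density v \<le> (norm v)\<^sup>2" by (simp add: BI_density_def a_def)
  show "0 \<le> BI_density v" using 1 zero_le_power2[of "norm v"] by linarith
qed

text \<open>Uniform convexity: the density exceeds half the squared norm by a convex function.\<close>

lemma BI_density_midpoint:
  fixes v w :: "'a::euclidean_space"
  assumes "norm v \<le> 1" "norm w \<le> 1"
  shows "BI_density ((1 / 2) *\<^sub>R (v + w)) + (norm (v - w))\<^sup>2 / 8 \<le> (BI_density v + BI_density w) / 2"
proof -
  define a where "a = sqrt (1 - (norm v)\<^sup>2)"
  define b where "b = sqrt (1 - (norm w)\<^sup>2)"
  define d where "d = (norm (v - w))\<^sup>2"
  have a: "a \<ge> 0" "a\<^sup>2 = 1 - (norm v)\<^sup>2" using assms by (auto simp: a_def abs_square_le_1)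
  have b: "b \<ge> 0" "b\<^sup>2 = 1 - (norm w)\<^sup>2" using assms by (auto simp: b_def abs_square_le_1)
  have d0: "d \<ge> 0" by (simp add: d_def)
  have para: "(norm (v + w))\<^sup>2 + d = 2 * (norm v)\<^sup>2 + 2 * (norm w)\<^sup>2"
    by (simp add: d_def power2_norm_eq_inner inner_add_left inner_add_right inner_diff_left
        inner_diff_right inner_commute)
  have half: "(norm ((1 / 2) *\<^sub>R (v + w)))\<^sup>2 = (norm (v + w))\<^sup>2 / 4"
    by (simp add: power_divide del: scaleR_add_right)
  \<comment> \<open>Parallelogram law: the argument of the root at the midpoint is the mean of the
    two arguments plus d / 4.\<close>
  have m: "1 - (norm ((1 / 2) *\<^sub>R (v + w)))\<^sup>2 = (a\<^sup>2 + b\<^sup>2) / 2 + d / 4"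
    unfolding a(2) b(2) half using para by (simp add: field_simps)
  have "(a\<^sup>2 + b\<^sup>2) / 2 + d / 4 \<le> 1" unfolding m[symmetric] by simp
  moreover have "0 \<le> (a - b)\<^sup>2" by simp
  then have ab: "(a + b)\<^sup>2 \<le> 2 * (a\<^sup>2 + b\<^sup>2)" by (simp add: power2_eq_square algebra_simps)
  ultimately have ds: "d \<le> 4 - (a + b)\<^sup>2" by linarith
  define s where "s = a + b"
  have s: "0 \<le> s" using a b by (simp add: s_def)
  have s2: "s \<le> 2"
  proof (rule ccontr)
    assume "\<not> s \<le> 2"
    then have "2 * 2 < s * s" by (intro mult_strict_mono) auto
    then show False using ds d0 by (simp add: s_def power2_eq_square)
  qed
  have "d \<le> 4 * (2 - s)"
  proof -
    have "d \<le> (2 - s) * (2 + s)" using ds by (simp add: s_def power2_eq_square algebra_simps)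
    also have "\<dots> \<le> (2 - s) * 4" using s s2 by (intro mult_left_mono) auto
    finally show ?thesis by simp
  qed
  \<comment> \<open>Expanding the square, the wanted
    \<open>(s / 2 + d / 8)\<^sup>2 \<le> s\<^sup>2 / 4 + d / 4\<close> is \<open>d\<close> times
    this inequality.\<close>
  then have "s / 8 + d / 64 \<le> 1 / 4" using s s2 by simp
  then have "d * (s / 8 + d / 64) \<le> d * (1 / 4)" using d0 by (rule mult_left_mono)
  then have "(s / 2 + d / 8)\<^sup>2 \<le> s\<^sup>2 / 4 + d / 4"
    by (simp add: power2_eq_square algebra_simps)
  also have "\<dots> \<le> (a\<^sup>2 + b\<^sup>2) / 2 + d / 4" using ab by (simp add: s_def)
  finally have le: "s / 2 + d / 8 \<le> sqrt ((a\<^sup>2 + b\<^sup>2) / 2 + d / 4)" by (rule real_le_rsqrt)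
  define S where "S = sqrt ((a\<^sup>2 + b\<^sup>2) / 2 + d / 4)"
  have "BI_density ((1 / 2) *\<^sub>R (v + w)) = 1 - S" unfolding BI_density_def m S_def ..
  moreover have "BI_density v = 1 - a" "BI_density w = 1 - b" by (simp_all add: BI_density_def a_def b_def)
  moreover have "(a + b) / 2 + d / 8 \<le> S" using le by (simp only: s_def S_def)
  then have "1 - S + d / 8 \<le> ((1 - a) + (1 - b)) / 2" by (simp add: field_simps)
  ultimately show ?thesis by (simp only: d_def)
qed

section \<open>Admissible functions paired with a gradient\<close>

definition BI_pair :: "('a::euclidean_space \<Rightarrow> real) \<Rightarrow> ('a \<Rightarrow> 'a) \<Rightarrow> bool" where
  "BI_pair \<phi> G \<longleftrightarrow> D12_gradient \<phi> G \<and> (\<forall>x y. \<bar>\<phi> x - \<phi> y\<bar> \<le> norm (x - y)) \<and> (AE x in lborel. norm (G x) \<le> 1)"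

lemma continuous_on_of_Lipschitz:
  fixes \<phi> :: "'a::euclidean_space \<Rightarrow> real"
  assumes "\<And>x y. \<bar>\<phi> x - \<phi> y\<bar> \<le> norm (x - y)"
  shows "continuous_on UNIV \<phi>"
  by (rule lipschitz_on_continuous_on[of 1]) (auto intro!: lipschitz_onI simp: dist_norm assms)

lemma BI_pairD:
  assumes "BI_pair \<phi> G"
  shows "D12_gradient \<phi> G" "\<bar>\<phi> x - \<phi> y\<bar> \<le> norm (x - y)" "AE x in lborel. norm (G x) \<le> 1"
    "continuous_on UNIV \<phi>" "\<phi> \<in> borel_measurable borel" "G \<in> borel_measurable borel"
  using assms continuous_on_of_Lipschitz[of \<phi>] by (auto simp: BI_pair_def D12_gradient_def)

text \<open>The function is the pointwise limit of its cut-offs to growing balls. Needed for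
  \<open>weak_grad\<close>, of which only the defining property is known.\<close>

lemma locally_integrable_measurable:
  fixes g :: "'a::euclidean_space \<Rightarrow> 'b::{banach, second_countable_topology}"
  assumes g: "locally_integrable g"
  shows "g \<in> borel_measurable lborel"
proof (rule borel_measurable_LIMSEQ_metric)
  show "(\<lambda>x. indicat_real (cball 0 (real n)) x *\<^sub>R g x) \<in> borel_measurable lborel" for n
    using g unfolding locally_integrable_def set_integrable_def by (intro borel_measurable_integrable) simp
  fix x :: 'a
  obtain n :: nat where n: "norm x \<le> real n" using real_arch_simple by blast
  have "\<forall>\<^sub>F k in sequentially. indicat_real (cball 0 (real k)) x *\<^sub>R g x = g x"
    using eventually_ge_at_top[of n] by eventually_elim (use n in auto)
  then show "(\<lambda>k. indicat_real (cball 0 (real k)) x *\<^sub>R g x) \<longlonglongrightarrow> g x"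
    by (rule tendsto_eventually)
qed

lemma BI_pair_weak_grad:
  fixes \<phi> :: "'a::euclidean_space \<Rightarrow> real"
  assumes "BI_pair \<phi> G" "DIM('a) \<ge> 3"
  shows "AE x in lborel. weak_grad \<phi> x = G x" "weak_grad \<phi> \<in> borel_measurable lborel"
proof -
  have h: "has_weak_gradient \<phi> G"
    by (rule D12_gradient_has_weak_gradient[OF BI_pairD(1,4)[OF assms(1)] assms(2)])
  show "AE x in lborel. weak_grad \<phi> x = G x" by (rule weak_grad_eq[OF h])
  have "has_weak_gradient \<phi> (weak_grad \<phi>)"
    unfolding weak_grad_def by (rule someI[of "has_weak_gradient \<phi>", OF h])
  then show "weak_grad \<phi> \<in> borel_measurable lborel"
    by (intro locally_integrable_measurable) (simp add: has_weak_gradient_def)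
qed

text \<open>The arbitrary Lipschitz constant in \<open>BI_space\<close> enters as continuity; with
  it, the gradient bound yields the constant 1 by \<open>D12_gradient_Lipschitz\<close>. A common
  constant is what the sup bound rests on.\<close>

lemma BI_space_iff_BI_pair:
  fixes \<phi> :: "'a::euclidean_space \<Rightarrow> real"
  assumes N: "DIM('a) \<ge> 3"
  shows "\<phi> \<in> BI_space \<longleftrightarrow> (\<exists>G. BI_pair \<phi> G)"
proof
  assume \<phi>: "\<phi> \<in> BI_space"
  then obtain G where G: "D12_gradient \<phi> G" using D12_imp_D12_gradient[of \<phi>] by (auto simp: BI_space_def)
  obtain L where "L-lipschitz_on UNIV \<phi>" using \<phi> by (auto simp: BI_space_def)
  then have c: "continuous_on UNIV \<phi>" by (rule lipschitz_on_continuous_on)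
  have "AE x in lborel. weak_grad \<phi> x = G x"
    by (rule weak_grad_eq[OF D12_gradient_has_weak_gradient[OF G c N]])
  moreover have "AE x in lborel. norm (weak_grad \<phi> x) \<le> 1" using \<phi> by (auto simp: BI_space_def)
  ultimately have G1: "AE x in lborel. norm (G x) \<le> 1" by eventually_elim simp
  show "\<exists>G. BI_pair \<phi> G"
    unfolding BI_pair_def using G G1 D12_gradient_Lipschitz[OF G c N G1] by blast
next
  assume "\<exists>G. BI_pair \<phi> G"
  then obtain G where G: "BI_pair \<phi> G" by blast
  have "AE x in lborel. norm (weak_grad \<phi> x) \<le> 1"
    using BI_pair_weak_grad(1)[OF G N] BI_pairD(3)[OF G] by eventually_elim simp
  moreover have "1-lipschitz_on UNIV \<phi>"
    using BI_pairD(2)[OF G] by (auto intro!: lipschitz_onI simp: dist_norm)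
  ultimately show "\<phi> \<in> BI_space"
    unfolding BI_space_def using D12_gradient_imp_D12[OF BI_pairD(1)[OF G]] by blast
qed

lemma BI_pair_zero: "BI_pair (\<lambda>x. 0) (\<lambda>x. 0)"
  by (simp add: BI_pair_def D12_gradient_zero)

lemma BI_pair_midpoint:
  fixes \<phi> \<psi> :: "'a::euclidean_space \<Rightarrow> real"
  assumes G: "BI_pair \<phi> G" and H: "BI_pair \<psi> H" and N: "DIM('a) \<ge> 3"
  shows "BI_pair (\<lambda>x. (\<phi> x + \<psi> x) / 2) (\<lambda>x. (1 / 2) *\<^sub>R (G x + H x))"
  unfolding BI_pair_def
proof (intro conjI allI)
  show "D12_gradient (\<lambda>x. (\<phi> x + \<psi> x) / 2) (\<lambda>x. (1 / 2) *\<^sub>R (G x + H x))"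
    using D12_gradient_linear_combination[OF BI_pairD(1)[OF G] BI_pairD(1)[OF H] N, of "1 / 2" "1 / 2"]
    by (simp add: add_divide_distrib scaleR_add_right)
  fix x y
  have "\<bar>\<phi> x - \<phi> y\<bar> \<le> norm (x - y)" "\<bar>\<psi> x - \<psi> y\<bar> \<le> norm (x - y)"
    using BI_pairD(2)[OF G] BI_pairD(2)[OF H] by auto
  then show "\<bar>(\<phi> x + \<psi> x) / 2 - (\<phi> y + \<psi> y) / 2\<bar> \<le> norm (x - y)"
    by (simp add: abs_le_iff field_simps)
next
  show "AE x in lborel. norm ((1 / 2) *\<^sub>R (G x + H x)) \<le> 1"
    using BI_pairD(3)[OF G] BI_pairD(3)[OF H]
  proof eventually_elim
    case (elim x)
    then show ?case using norm_triangle_ineq[of "G x" "H x"] by simp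
  qed
qed

definition energy :: "('a::euclidean_space \<Rightarrow> 'a) \<Rightarrow> real" where
  "energy G = (LINT x|lborel. (norm (G x))\<^sup>2)"

lemma energy_nonneg: "energy G \<ge> 0"
  by (simp add: energy_def)

lemma D12_gradient_energy:
  assumes "D12_gradient u G"
  shows "integrable lborel (\<lambda>x. (norm (G x))\<^sup>2)" "L2sq G = ennreal (energy G)"
proof -
  have [measurable]: "G \<in> borel_measurable borel" using assms by (simp add: D12_gradient_def)
  show i: "integrable lborel (\<lambda>x. (norm (G x))\<^sup>2)"
    by (rule integrableI_bounded) (use D12_gradient_finite[OF assms] in \<open>auto simp: L2sq_def\<close>)
  show "L2sq G = ennreal (energy G)"
    unfolding L2sq_def energy_def by (rule nn_integral_eq_integral[OF i]) simp
qed

lemma BI_pair_density_integrable: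
  assumes G: "BI_pair \<phi> G"
  shows "integrable lborel (\<lambda>x. BI_density (G x))"
proof (rule Bochner_Integration.integrable_bound[OF D12_gradient_energy(1)[OF BI_pairD(1)[OF G]]])
  note [measurable] = BI_pairD(6)[OF G]
  show "(\<lambda>x. BI_density (G x)) \<in> borel_measurable lborel" by measurable
  show "AE x in lborel. norm (BI_density (G x)) \<le> norm ((norm (G x))\<^sup>2)"
    using BI_pairD(3)[OF G]
  proof eventually_elim
    case (elim x)
    then show ?case using BI_density_bounds(2,3)[of "G x"] by simp
  qed
qed

lemma BI_pair_density_ge:
  assumes G: "BI_pair \<phi> G"
  shows "energy G / 2 \<le> (LINT x|lborel. BI_density (G x))"
proof -
  have "(LINT x|lborel. (norm (G x))\<^sup>2 / 2) \<le> (LINT x|lborel. BI_density (G x))"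
  proof (rule integral_mono_AE)
    show "integrable lborel (\<lambda>x. (norm (G x))\<^sup>2 / 2)"
      using D12_gradient_energy(1)[OF BI_pairD(1)[OF G]] by simp
    show "AE x in lborel. (norm (G x))\<^sup>2 / 2 \<le> BI_density (G x)"
      using BI_pairD(3)[OF G] by eventually_elim (rule BI_density_bounds)
  qed (rule BI_pair_density_integrable[OF G])
  then show ?thesis by (simp add: energy_def)
qed

lemma BI_pair_sup_bound:
  assumes N: "DIM('a::euclidean_space) \<ge> 3"
  shows "\<exists>C>0. \<forall>(\<phi> :: 'a \<Rightarrow> real) G \<psi> H x. BI_pair \<phi> G \<longrightarrow> BI_pair \<psi> H \<longrightarrow>
    \<bar>\<phi> x - \<psi> x\<bar> ^ DIM('a) \<le> C * energy (\<lambda>x. G x - H x)"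
proof -
  obtain C where C: "C > 0" "\<And>(u :: 'a \<Rightarrow> real) G d x. D12_gradient u G \<Longrightarrow> (\<forall>x y. \<bar>u x - u y\<bar> \<le> 2 * norm (x - y)) \<Longrightarrow>
    d \<ge> 0 \<Longrightarrow> L2sq G \<le> ennreal d \<Longrightarrow> \<bar>u x\<bar> ^ DIM('a) \<le> C * d"
    using D12_Lipschitz_sup_bound[OF N] by blast
  have "\<bar>\<phi> x - \<psi> x\<bar> ^ DIM('a) \<le> C * energy (\<lambda>x. G x - H x)"
    if G: "BI_pair \<phi> G" and H: "BI_pair \<psi> H" for \<phi> \<psi> :: "'a \<Rightarrow> real" and G H x
  proof (rule C(2)[of "\<lambda>x. \<phi> x - \<psi> x" "\<lambda>x. G x - H x"])
    show D: "D12_gradient (\<lambda>x. \<phi> x - \<psi> x) (\<lambda>x. G x - H x)"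
      by (rule D12_gradient_diff[OF BI_pairD(1)[OF G] BI_pairD(1)[OF H] N])
    show "L2sq (\<lambda>x. G x - H x) \<le> ennreal (energy (\<lambda>x. G x - H x))"
      using D12_gradient_energy(2)[OF D] by simp
    show "\<forall>x y. \<bar>\<phi> x - \<psi> x - (\<phi> y - \<psi> y)\<bar> \<le> 2 * norm (x - y)"
    proof (intro allI)
      fix x y
      show "\<bar>\<phi> x - \<psi> x - (\<phi> y - \<psi> y)\<bar> \<le> 2 * norm (x - y)"
        using BI_pairD(2)[OF G, of x y] BI_pairD(2)[OF H, of x y] by linarith
    qed
  qed (rule energy_nonneg)
  then show ?thesis using C(1) by blast
qed

lemma BI_pair_bounded:
  fixes \<phi> :: "'a::euclidean_space \<Rightarrow> real"
  assumes N: "DIM('a) \<ge> 3" and G: "BI_pair \<phi> G"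
  shows "\<exists>B\<ge>0. \<forall>x. \<bar>\<phi> x\<bar> \<le> B"
proof -
  obtain C where C: "C > 0" "\<And>(\<phi> :: 'a \<Rightarrow> real) G \<psi> H x. BI_pair \<phi> G \<Longrightarrow> BI_pair \<psi> H \<Longrightarrow>
    \<bar>\<phi> x - \<psi> x\<bar> ^ DIM('a) \<le> C * energy (\<lambda>x. G x - H x)"
    using BI_pair_sup_bound[OF N] by blast
  \<comment> \<open>The energy bounds the N-th power of |\<phi> x|, which dominates |\<phi> x| only
    above 1; hence the maximum.\<close>
  define B where "B = max 1 (C * energy G)"
  have "\<bar>\<phi> x\<bar> \<le> B" for x
  proof (cases "\<bar>\<phi> x\<bar> \<le> 1")
    case False
    then have "\<bar>\<phi> x\<bar> ^ 1 \<le> \<bar>\<phi> x\<bar> ^ DIM('a)" using N by (intro power_increasing) auto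
    also have "\<dots> \<le> C * energy G" using C(2)[OF G BI_pair_zero, of x] by simp
    finally show ?thesis by (simp add: B_def)
  qed (simp add: B_def)
  then show ?thesis by (intro exI[of _ B]) (auto simp: B_def)
qed

lemma D12_Sobolev_small:
  assumes N: "DIM('a::euclidean_space) \<ge> 3" and e: "e > 0"
  shows "\<exists>\<delta>>0. \<forall>(u :: 'a \<Rightarrow> real) G. D12_gradient u G \<longrightarrow> L2sq G \<le> ennreal \<delta> \<longrightarrow> Lsobolev u \<le> ennreal e"
proof -
  define k where "k = real DIM('a) / (real DIM('a) - 2)"
  define c where "c = (2 * (real DIM('a) - 1) / (real DIM('a) - 2))\<^sup>2"
  define q where "q = 2 powr sobolev_exponent TYPE('a)"
  have k: "k > 0" and c: "c > 0" and q: "q > 0" using N by (auto simp: k_def c_def q_def)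
  \<comment> \<open>Solves \<open>q * (c * (2 * \<delta>)) powr k = e\<close>, with the bound of
    \<open>D12_Sobolev_inequality\<close> on the left, for \<delta>.\<close>
  define \<delta> where "\<delta> = (e / q) powr (1 / k) / (2 * c)"
  have \<delta>: "\<delta> > 0" using e c q by (simp add: \<delta>_def)
  have "q * (c * (2 * \<delta>)) powr k = e"
    using k c q e by (simp add: \<delta>_def powr_powr)
  then have "Lsobolev u \<le> ennreal e" if "D12_gradient u G" "L2sq G \<le> ennreal \<delta>" for u :: "'a \<Rightarrow> real" and G
    using D12_Sobolev_inequality[OF that(1) N that(2)] \<delta> by (simp add: k_def c_def q_def)
  then show ?thesis using \<delta> by blast
qed

section \<open>Minimization for a fixed probability measure\<close>

definition BI_energy :: "'a::euclidean_space measure \<Rightarrow> ('a \<Rightarrow> real) \<Rightarrow> ('a \<Rightarrow> 'a) \<Rightarrow> real" where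
  "BI_energy \<rho> \<phi> G = (LINT x|lborel. BI_density (G x)) - (LINT x|\<rho>. \<phi> x)"

locale borel_prob = prob_space \<rho> for \<rho> :: "'a::euclidean_space measure" +
  assumes sets_rho: "sets \<rho> = sets borel" and dim3: "DIM('a) \<ge> 3"
begin

lemma borel_measurable_rho: "f \<in> borel_measurable borel \<Longrightarrow> f \<in> borel_measurable \<rho>"
  unfolding measurable_cong_sets[OF sets_rho refl] .

lemma integrable_rho:
  assumes "BI_pair \<phi> G"
  shows "integrable \<rho> \<phi>"
proof -
  obtain B where "\<And>x. \<bar>\<phi> x\<bar> \<le> B" using BI_pair_bounded[OF dim3 assms] by blast
  then show ?thesis
    using borel_measurable_rho[OF BI_pairD(5)[OF assms]] by (intro integrable_const_bound[where B=B]) auto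
qed

text \<open>Uniform convexity of the density is integrated; the integral against \<rho> is linear
  and averages exactly.\<close>

lemma BI_energy_midpoint:
  assumes G: "BI_pair \<phi> G" and H: "BI_pair \<psi> H"
  shows "\<exists>\<xi> K. BI_pair \<xi> K \<and>
    BI_energy \<rho> \<xi> K + energy (\<lambda>x. G x - H x) / 8 \<le> (BI_energy \<rho> \<phi> G + BI_energy \<rho> \<psi> H) / 2"
proof -
  note M = BI_pair_midpoint[OF G H dim3]
  note iG = BI_pair_density_integrable[OF G] and iH = BI_pair_density_integrable[OF H]
    and iM = BI_pair_density_integrable[OF M]
  have iD: "integrable lborel (\<lambda>x. (norm (G x - H x))\<^sup>2)"
    by (rule D12_gradient_energy(1)[OF D12_gradient_diff[OF BI_pairD(1)[OF G] BI_pairD(1)[OF H] dim3]])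
  have "(LINT x|lborel. BI_density ((1 / 2) *\<^sub>R (G x + H x)) + (norm (G x - H x))\<^sup>2 / 8)
      \<le> (LINT x|lborel. (BI_density (G x) + BI_density (H x)) / 2)"
  proof (rule integral_mono_AE)
    show "AE x in lborel. BI_density ((1 / 2) *\<^sub>R (G x + H x)) + (norm (G x - H x))\<^sup>2 / 8
        \<le> (BI_density (G x) + BI_density (H x)) / 2"
      using BI_pairD(3)[OF G] BI_pairD(3)[OF H] by eventually_elim (rule BI_density_midpoint)
  qed (use iG iH iM iD in auto)
  then have "(LINT x|lborel. BI_density ((1 / 2) *\<^sub>R (G x + H x))) + energy (\<lambda>x. G x - H x) / 8
      \<le> ((LINT x|lborel. BI_density (G x)) + (LINT x|lborel. BI_density (H x))) / 2"
    using iG iH iM iD by (simp add: energy_def)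
  moreover have "(LINT x|\<rho>. (\<phi> x + \<psi> x) / 2) = ((LINT x|\<rho>. \<phi> x) + (LINT x|\<rho>. \<psi> x)) / 2"
    using integrable_rho[OF G] integrable_rho[OF H] by simp
  ultimately have "BI_energy \<rho> (\<lambda>x. (\<phi> x + \<psi> x) / 2) (\<lambda>x. (1 / 2) *\<^sub>R (G x + H x)) + energy (\<lambda>x. G x - H x) / 8
    \<le> (BI_energy \<rho> \<phi> G + BI_energy \<rho> \<psi> H) / 2"
    by (simp add: BI_energy_def field_simps)
  then show ?thesis using M by blast
qed

lemma BI_energy_bounded_below: "\<exists>m. \<forall>\<phi> G. BI_pair \<phi> G \<longrightarrow> m \<le> BI_energy \<rho> \<phi> G"
proof -
  obtain C where C: "C > 0" "\<And>(\<phi> :: 'a \<Rightarrow> real) G \<psi> H x. BI_pair \<phi> G \<Longrightarrow> BI_pair \<psi> H \<Longrightarrow>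
    \<bar>\<phi> x - \<psi> x\<bar> ^ DIM('a) \<le> C * energy (\<lambda>x. G x - H x)"
    using BI_pair_sup_bound[OF dim3] by blast
  \<comment> \<open>Above this threshold, t > 1 gives t^2 \<le> t^N \<le> C * energy, and t \<ge> 2
    * C turns this into t \<le> energy / 2, which the gradient part of the functional
    compensates.\<close>
  define s where "s = max 1 (2 * C)"
  have s: "s \<ge> 1" "s \<ge> 2 * C" by (auto simp: s_def)
  have "- s \<le> BI_energy \<rho> \<phi> G" if G: "BI_pair \<phi> G" for \<phi> G
  proof -
    have "\<phi> x \<le> energy G / 2 + s" for x
    proof (cases "\<bar>\<phi> x\<bar> \<le> s")
      case True
      then show ?thesis using energy_nonneg[of G] by simp
    next
      case False
      define t where "t = \<bar>\<phi> x\<bar>"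
      have t: "t > s" using False by (simp add: t_def)
      have "2 * C * t \<le> t * t" using t s by (intro mult_right_mono) auto
      also have "\<dots> = t ^ 2" by (simp add: power2_eq_square)
      also have "\<dots> \<le> t ^ DIM('a)" using t s dim3 by (intro power_increasing) auto
      also have "\<dots> \<le> C * energy G" using C(2)[OF G BI_pair_zero, of x] by (simp add: t_def)
      finally have "C * (2 * t) \<le> C * energy G" by simp
      then have "t \<le> energy G / 2" using C(1) by simp
      then show ?thesis using s by (simp add: t_def)
    qed
    then have "(LINT x|\<rho>. \<phi> x) \<le> energy G / 2 + s"
      by (intro integral_le_const integrable_rho[OF G]) auto
    then show ?thesis using BI_pair_density_ge[OF G] by (simp add: BI_energy_def)
  qed
  then show ?thesis by blast
qed

text \<open>The midpoint would lie below the common minimum by at least an eighth of the energy of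
  the difference, so this energy vanishes. The sup bound then forces equality at every point, as the
  definite description of the potential requires.\<close>

lemma BI_energy_minimizer_unique:
  assumes G: "BI_pair \<phi> G" and H: "BI_pair \<psi> H"
    and minG: "\<And>\<xi> K. BI_pair \<xi> K \<Longrightarrow> BI_energy \<rho> \<phi> G \<le> BI_energy \<rho> \<xi> K"
    and minH: "\<And>\<xi> K. BI_pair \<xi> K \<Longrightarrow> BI_energy \<rho> \<psi> H \<le> BI_energy \<rho> \<xi> K"
  shows "\<phi> = \<psi>"
proof
  fix x
  obtain C where C: "C > 0" "\<And>(\<phi> :: 'a \<Rightarrow> real) G \<psi> H x. BI_pair \<phi> G \<Longrightarrow> BI_pair \<psi> H \<Longrightarrow>
    \<bar>\<phi> x - \<psi> x\<bar> ^ DIM('a) \<le> C * energy (\<lambda>x. G x - H x)"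
    using BI_pair_sup_bound[OF dim3] by blast
  obtain \<xi> K where K: "BI_pair \<xi> K"
    "BI_energy \<rho> \<xi> K + energy (\<lambda>x. G x - H x) / 8 \<le> (BI_energy \<rho> \<phi> G + BI_energy \<rho> \<psi> H) / 2"
    using BI_energy_midpoint[OF G H] by blast
  have "energy (\<lambda>x. G x - H x) \<le> 0"
    using K(2) minG[OF K(1)] minG[OF H] minH[OF G] by argo
  then have "C * energy (\<lambda>x. G x - H x) \<le> 0" using C(1) by (simp add: mult_le_0_iff)
  then have "\<bar>\<phi> x - \<psi> x\<bar> ^ DIM('a) \<le> 0" using C(2)[OF G H, of x] by linarith
  then have "\<bar>\<phi> x - \<psi> x\<bar> ^ DIM('a) = 0" by (intro antisym) auto
  then show "\<phi> x = \<psi> x" by simp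
qed

lemma BI_energy_minimizer_exists:
  "\<exists>\<phi> G. BI_pair \<phi> G \<and> (\<forall>\<xi> K. BI_pair \<xi> K \<longrightarrow> BI_energy \<rho> \<phi> G \<le> BI_energy \<rho> \<xi> K)"
proof -
  define S where "S = {BI_energy \<rho> \<phi> G |\<phi> G. BI_pair \<phi> G}"
  define m where "m = Inf S"
  have S0: "S \<noteq> {}" unfolding S_def using BI_pair_zero by blast
  obtain m0 where m0: "\<And>\<phi> G. BI_pair \<phi> G \<Longrightarrow> m0 \<le> BI_energy \<rho> \<phi> G"
    using BI_energy_bounded_below by blast
  have bdd: "bdd_below S" unfolding S_def by (rule bdd_belowI[of _ m0]) (use m0 in blast)
  have m: "m \<le> BI_energy \<rho> \<phi> G" if "BI_pair \<phi> G" for \<phi> G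
    unfolding m_def by (rule cInf_lower[OF _ bdd]) (use that in \<open>auto simp: S_def\<close>)
  define e where "e n = inverse (real (Suc n))" for n
  have e: "e n > 0" for n by (simp add: e_def)
  have e0: "e \<longlonglongrightarrow> 0" unfolding e_def[abs_def] by (rule LIMSEQ_inverse_real_of_nat)
  have "\<exists>p. BI_pair (fst p) (snd p) \<and> BI_energy \<rho> (fst p) (snd p) < m + e n" for n
  proof -
    have "Inf S < m + e n" using e[of n] by (simp add: m_def)
    then obtain y where "y \<in> S" "y < m + e n" using cInf_lessD[OF S0] by blast
    then obtain \<phi> G where "BI_pair \<phi> G" "BI_energy \<rho> \<phi> G < m + e n" unfolding S_def by blast
    then show ?thesis by (intro exI[of _ "(\<phi>, G)"]) simp
  qed
  then have "\<forall>n. \<exists>p. BI_pair (fst p) (snd p) \<and> BI_energy \<rho> (fst p) (snd p) < m + e n" by blast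
  from choice[OF this] obtain P where
    P: "\<forall>n. BI_pair (fst (P n)) (snd (P n)) \<and> BI_energy \<rho> (fst (P n)) (snd (P n)) < m + e n" ..
  define \<phi>' where "\<phi>' n = fst (P n)" for n
  define G' where "G' n = snd (P n)" for n
  have GP: "BI_pair (\<phi>' n) (G' n)" and le: "BI_energy \<rho> (\<phi>' n) (G' n) < m + e n" for n
    using P by (auto simp: \<phi>'_def G'_def)
  note [measurable] = BI_pairD(5)[OF GP] BI_pairD(6)[OF GP]
  have DD: "D12_gradient (\<lambda>x. \<phi>' i x - \<phi>' j x) (\<lambda>x. G' i x - G' j x)" for i j
    by (rule D12_gradient_diff[OF BI_pairD(1)[OF GP] BI_pairD(1)[OF GP] dim3])
  \<comment> \<open>The functional is at least \<open>m\<close> at the midpoint, so an eighth of the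
    energy of the difference is at most \<open>(e i + e j) / 2\<close>.\<close>
  have en: "energy (\<lambda>x. G' i x - G' j x) \<le> 4 * (e i + e j)" for i j
  proof -
    obtain \<xi> K where K: "BI_pair \<xi> K" "BI_energy \<rho> \<xi> K + energy (\<lambda>x. G' i x - G' j x) / 8
        \<le> (BI_energy \<rho> (\<phi>' i) (G' i) + BI_energy \<rho> (\<phi>' j) (G' j)) / 2"
      using BI_energy_midpoint[OF GP GP, of i j] by blast
    show ?thesis using K(2) m[OF K(1)] le[of i] le[of j] by argo
  qed
  have Cauchy: "\<exists>M. \<forall>i\<ge>M. \<forall>j\<ge>M. energy (\<lambda>x. G' i x - G' j x) \<le> d" if d: "d > 0" for d
  proof -
    have "\<forall>\<^sub>F n in sequentially. e n < d / 8"
      using order_tendstoD(2)[OF e0, of "d / 8"] d by simp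
    then obtain M where M: "\<And>n. n \<ge> M \<Longrightarrow> e n < d / 8" unfolding eventually_sequentially by blast
    have "energy (\<lambda>x. G' i x - G' j x) \<le> d" if "i \<ge> M" "j \<ge> M" for i j
      using en[of i j] M[OF that(1)] M[OF that(2)] by argo
    then show ?thesis by blast
  qed
  have "\<exists>G s. G \<in> borel_measurable lborel \<and> strict_mono (s :: nat \<Rightarrow> nat) \<and>
    (AE x in lborel. (\<lambda>k. G' (s k) x) \<longlonglongrightarrow> G x) \<and>
    (\<lambda>n. \<integral>\<^sup>+x. ennreal ((norm (G' n x - G x))\<^sup>2) \<partial>lborel) \<longlonglongrightarrow> 0"
  proof (rule L2_complete)
    fix d :: real assume "d > 0"
    then obtain M where M: "\<And>i j. i \<ge> M \<Longrightarrow> j \<ge> M \<Longrightarrow> energy (\<lambda>x. G' i x - G' j x) \<le> d" using Cauchy by blast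
    have "(\<integral>\<^sup>+x. ennreal ((norm (G' i x - G' j x))\<^sup>2) \<partial>lborel) \<le> ennreal d" if "i \<ge> M" "j \<ge> M" for i j
      using D12_gradient_energy(2)[OF DD, of i j] M[OF that] by (simp add: L2sq_def ennreal_leI)
    then show "\<exists>N. \<forall>m\<ge>N. \<forall>n\<ge>N. (\<integral>\<^sup>+x. ennreal ((norm (G' m x - G' n x))\<^sup>2) \<partial>lborel) \<le> ennreal d" by blast
  qed measurable
  then obtain G s where G [measurable]: "G \<in> borel_measurable borel" and s: "strict_mono (s :: nat \<Rightarrow> nat)"
    and ae: "AE x in lborel. (\<lambda>k. G' (s k) x) \<longlonglongrightarrow> G x" and L2: "(\<lambda>n. L2sq (\<lambda>x. G' n x - G x)) \<longlonglongrightarrow> 0"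
    by (auto simp: L2sq_def)
  obtain C where C: "C > 0" "\<And>(\<phi> :: 'a \<Rightarrow> real) G \<psi> H x. BI_pair \<phi> G \<Longrightarrow> BI_pair \<psi> H \<Longrightarrow>
    \<bar>\<phi> x - \<psi> x\<bar> ^ DIM('a) \<le> C * energy (\<lambda>x. G x - H x)"
    using BI_pair_sup_bound[OF dim3] by blast
  have "uniformly_convergent_on UNIV \<phi>'"
  proof (rule Cauchy_uniformly_convergent, unfold uniformly_Cauchy_on_def, intro allI impI)
    fix d :: real assume d: "d > 0"
    \<comment> \<open>Chosen so that \<open>C * d'\<close> is the N-th power of d / 2.\<close>
    define d' where "d' = (d / 2) ^ DIM('a) / C"
    have "d' > 0" using d C by (simp add: d'_def)
    then obtain M where M: "\<And>i j. i \<ge> M \<Longrightarrow> j \<ge> M \<Longrightarrow> energy (\<lambda>x. G' i x - G' j x) \<le> d'" using Cauchy by blast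
    have "dist (\<phi>' i x) (\<phi>' j x) < d" if "i \<ge> M" "j \<ge> M" for i j x
    proof -
      have "\<bar>\<phi>' i x - \<phi>' j x\<bar> ^ DIM('a) \<le> C * energy (\<lambda>x. G' i x - G' j x)" by (rule C(2)[OF GP GP])
      also have "\<dots> \<le> C * d'" using C(1) by (intro mult_left_mono M that) auto
      also have "\<dots> = (d / 2) ^ DIM('a)" using C(1) by (simp add: d'_def)
      finally have "\<bar>\<phi>' i x - \<phi>' j x\<bar> \<le> d / 2"
        by (subst (asm) power_mono_iff) (use d in auto)
      then show ?thesis using d by (simp add: dist_real_def)
    qed
    then show "\<exists>M. \<forall>x\<in>UNIV. \<forall>m\<ge>M. \<forall>n\<ge>M. dist (\<phi>' m x) (\<phi>' n x) < d" by blast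
  qed
  then obtain \<phi> where unif: "uniform_limit UNIV \<phi>' \<phi> sequentially"
    unfolding uniformly_convergent_on_def by blast
  have lim: "(\<lambda>n. \<phi>' n x) \<longlonglongrightarrow> \<phi> x" for x
    using tendsto_uniform_limitI[OF unif] by simp
  have Lip: "\<bar>\<phi> x - \<phi> y\<bar> \<le> norm (x - y)" for x y
    by (rule LIMSEQ_le_const2[OF tendsto_rabs[OF tendsto_diff[OF lim lim]]]) (use BI_pairD(2)[OF GP] in auto)
  have \<phi>m [measurable]: "\<phi> \<in> borel_measurable borel"
    by (rule borel_measurable_continuous_onI[OF continuous_on_of_Lipschitz[OF Lip]])
  \<comment> \<open>The Sobolev inequality applies to differences of two members of the sequence;
    the limit, not yet known to lie in the Dirichlet space, is reached by Fatou in the second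
    index.\<close>
  have Ls: "(\<lambda>n. Lsobolev (\<lambda>x. \<phi>' n x - \<phi> x)) \<longlonglongrightarrow> 0"
  proof (rule tendsto_0_ennrealI)
    fix d :: real assume "d > 0"
    then obtain \<delta> where \<delta>: "\<delta> > 0" "\<And>(u :: 'a \<Rightarrow> real) G. D12_gradient u G \<Longrightarrow> L2sq G \<le> ennreal \<delta> \<Longrightarrow> Lsobolev u \<le> ennreal d"
      using D12_Sobolev_small[OF dim3] by blast
    obtain M where M: "\<And>i j. i \<ge> M \<Longrightarrow> j \<ge> M \<Longrightarrow> energy (\<lambda>x. G' i x - G' j x) \<le> \<delta>" using Cauchy[OF \<delta>(1)] by blast
    have "Lsobolev (\<lambda>x. \<phi>' n x - \<phi> x) \<le> ennreal d" if n: "n \<ge> M" for n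
      unfolding Lsobolev_def
    proof (rule Fatou_bound[where u="\<lambda>k x. \<bar>\<phi>' n x - \<phi>' k x\<bar> powr sobolev_exponent TYPE('a)"])
      show "AE x in lborel. (\<lambda>k. \<bar>\<phi>' n x - \<phi>' k x\<bar> powr sobolev_exponent TYPE('a))
          \<longlonglongrightarrow> \<bar>\<phi>' n x - \<phi> x\<bar> powr sobolev_exponent TYPE('a)"
        by (intro AE_I2 tendsto_powr' tendsto_rabs tendsto_diff tendsto_const lim)
           (use sobolev_exponent_gt_1[OF dim3] in auto)
      have "(\<integral>\<^sup>+x. ennreal (\<bar>\<phi>' n x - \<phi>' k x\<bar> powr sobolev_exponent TYPE('a)) \<partial>lborel) \<le> ennreal d" if k: "k \<ge> M" for k
        using \<delta>(2)[OF DD, of n k] M[OF n k] D12_gradient_energy(2)[OF DD, of n k]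
        by (simp add: Lsobolev_def ennreal_leI)
      then show "\<forall>\<^sub>F k in sequentially. (\<integral>\<^sup>+x. ennreal (\<bar>\<phi>' n x - \<phi>' k x\<bar> powr sobolev_exponent TYPE('a)) \<partial>lborel) \<le> ennreal d"
        unfolding eventually_sequentially by blast
    qed measurable
    then show "\<forall>\<^sub>F n in sequentially. Lsobolev (\<lambda>x. \<phi>' n x - \<phi> x) \<le> ennreal d"
      unfolding eventually_sequentially by blast
  qed
  have "D12_gradient \<phi> G"
    by (rule D12_gradient_closed[OF BI_pairD(1)[OF GP] dim3 \<phi>m G L2 Ls])
  moreover have "AE x in lborel. \<forall>k. norm (G' (s k) x) \<le> 1"
    unfolding AE_all_countable using BI_pairD(3)[OF GP] by blast
  then have "AE x in lborel. norm (G x) \<le> 1"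
    using ae
  proof eventually_elim
    case (elim x)
    show ?case by (rule LIMSEQ_le_const2[OF tendsto_norm[OF elim(2)]]) (use elim(1) in auto)
  qed
  ultimately have \<phi>G: "BI_pair \<phi> G" using Lip by (simp add: BI_pair_def)
  \<comment> \<open>Lower semicontinuity: uniform convergence handles the measure term, Fatou along
    the subsequence the density term. The slack \<open>d\<close> is removed at the end.\<close>
  have "BI_energy \<rho> \<phi> G \<le> m + d" if d: "d > 0" for d
  proof -
    have "\<forall>\<^sub>F n in sequentially. \<forall>x\<in>UNIV. dist (\<phi>' n x) (\<phi> x) < d / 2"
      by (rule uniform_limitD[OF unif]) (use d in simp)
    moreover have "\<forall>\<^sub>F n in sequentially. e n < d / 2"
      using order_tendstoD(2)[OF e0, of "d / 2"] d by simp
    ultimately have ev: "\<forall>\<^sub>F n in sequentially. (LINT x|lborel. BI_density (G' n x)) \<le> m + d + (LINT x|\<rho>. \<phi> x)"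
    proof eventually_elim
      case (elim n)
      have "(LINT x|\<rho>. \<phi>' n x) \<le> (LINT x|\<rho>. \<phi> x + d / 2)"
      proof (rule integral_mono)
        show "integrable \<rho> (\<lambda>x. \<phi> x + d / 2)" using integrable_rho[OF \<phi>G] by simp
        fix x
        have "dist (\<phi>' n x) (\<phi> x) < d / 2" using elim(1) by simp
        then show "\<phi>' n x \<le> \<phi> x + d / 2" unfolding dist_real_def by linarith
      qed (rule integrable_rho[OF GP])
      also have "\<dots> = (LINT x|\<rho>. \<phi> x) + d / 2" using integrable_rho[OF \<phi>G] by (simp add: prob_space)
      finally show ?case using le[of n] elim(2) by (simp add: BI_energy_def)
    qed
    define b where "b = m + d + (LINT x|\<rho>. \<phi> x)"
    have nn: "(\<integral>\<^sup>+x. ennreal (BI_density (H x)) \<partial>lborel) = ennreal (LINT x|lborel. BI_density (H x))"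
      if H: "BI_pair \<xi> H" for \<xi> H
    proof (rule nn_integral_eq_integral[OF BI_pair_density_integrable[OF H]])
      show "AE x in lborel. 0 \<le> BI_density (H x)"
        using BI_pairD(3)[OF H] by eventually_elim (rule BI_density_bounds)
    qed
    have "(\<integral>\<^sup>+x. ennreal (BI_density (G x)) \<partial>lborel) \<le> ennreal b"
    proof (rule Fatou_bound[where u="\<lambda>k x. BI_density (G' (s k) x)"])
      show "AE x in lborel. (\<lambda>k. BI_density (G' (s k) x)) \<longlonglongrightarrow> BI_density (G x)"
        using ae by eventually_elim (rule isCont_tendsto_compose[OF isCont_BI_density])
      have "\<forall>\<^sub>F k in sequentially. (LINT x|lborel. BI_density (G' (s k) x)) \<le> b"
        using filterlim_subseq[OF s] ev unfolding b_def by (rule eventually_compose_filterlim[rotated])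
      then show "\<forall>\<^sub>F k in sequentially. (\<integral>\<^sup>+x. ennreal (BI_density (G' (s k) x)) \<partial>lborel) \<le> ennreal b"
        by eventually_elim (simp add: nn[OF GP] ennreal_leI)
    qed measurable
    then have "ennreal (LINT x|lborel. BI_density (G x)) \<le> ennreal b" unfolding nn[OF \<phi>G] .
    \<comment> \<open>\<open>ennreal\<close> sends negative numbers to 0, so the sign of
      \<open>b\<close> is needed to return to real numbers.\<close>
    moreover have "0 \<le> b"
    proof -
      obtain n where "(LINT x|lborel. BI_density (G' n x)) \<le> b"
        using ev unfolding b_def eventually_sequentially by blast
      moreover have "0 \<le> energy (G' n) / 2" using energy_nonneg[of "G' n"] by simp
      ultimately show ?thesis using BI_pair_density_ge[OF GP, of n] by linarith
    qed
    ultimately have "(LINT x|lborel. BI_density (G x)) \<le> b" by simp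
    then show ?thesis by (simp add: BI_energy_def b_def)
  qed
  then have "BI_energy \<rho> \<phi> G \<le> m" by (rule field_le_epsilon)
  then show ?thesis using \<phi>G m by (meson order_trans)
qed

end

section \<open>Back to the functional, the potential and the energy\<close>

lemma boundary_prob_borel_prob:
  fixes \<Omega> :: "'a::euclidean_space set"
  assumes \<rho>: "\<rho> \<in> boundary_prob \<Omega>" and N: "DIM('a) \<ge> 3"
  shows "borel_prob \<rho>"
proof -
  have sets: "sets \<rho> = sets borel" and e: "emeasure \<rho> (- frontier \<Omega>) = 0" "emeasure \<rho> (frontier \<Omega>) = 1"
    using \<rho> by (auto simp: boundary_prob_def)
  have "frontier \<Omega> \<in> sets \<rho>" by (simp add: sets borel_closed)
  then have "emeasure \<rho> (frontier \<Omega> \<union> - frontier \<Omega>) = emeasure \<rho> (frontier \<Omega>) + emeasure \<rho> (- frontier \<Omega>)"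
    by (intro plus_emeasure[symmetric]) (auto simp: sets)
  then have "emeasure \<rho> (space \<rho>) = 1" using e sets_eq_imp_space_eq[OF sets] by simp
  then have "prob_space \<rho>" by (rule prob_spaceI)
  then show ?thesis using sets N by (simp add: borel_prob_def borel_prob_axioms_def)
qed

lemma boundary_prob_integral:
  fixes \<Omega> :: "'a::euclidean_space set"
  assumes \<rho>: "\<rho> \<in> boundary_prob \<Omega>" and \<phi>: "\<phi> \<in> borel_measurable borel"
  shows "(LINT x:frontier \<Omega>|\<rho>. \<phi> x) = (LINT x|\<rho>. \<phi> x)"
proof -
  have sets: "sets \<rho> = sets borel" and e: "emeasure \<rho> (- frontier \<Omega>) = 0"
    using \<rho> by (auto simp: boundary_prob_def)
  note [measurable_cong] = sets
  note [measurable] = \<phi>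
  have [measurable]: "frontier \<Omega> \<in> sets borel" by (simp add: borel_closed)
  have "AE x in \<rho>. x \<in> frontier \<Omega>"
    by (rule AE_I[where N="- frontier \<Omega>"]) (auto simp: sets e)
  then show ?thesis
    unfolding set_lebesgue_integral_def
    by (intro integral_cong_AE) (measurable, auto elim: eventually_mono)
qed

text \<open>The two integrands agree almost everywhere, and measurability of the chosen
  \<open>weak_grad\<close> permits the exchange. In particular the value does not depend on
  \<open>G\<close>.\<close>

lemma BI_functional_eq_BI_energy:
  fixes \<Omega> :: "'a::euclidean_space set"
  assumes \<rho>: "\<rho> \<in> boundary_prob \<Omega>" and G: "BI_pair \<phi> G" and N: "DIM('a) \<ge> 3"
  shows "BI_functional \<Omega> \<rho> \<phi> = BI_energy \<rho> \<phi> G"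
proof -
  note [measurable] = BI_pair_weak_grad(2)[OF G N] BI_pairD(6)[OF G]
  have "(LINT x|lborel. 1 - sqrt (1 - (norm (weak_grad \<phi> x))\<^sup>2)) = (LINT x|lborel. BI_density (G x))"
  proof (rule integral_cong_AE)
    show "AE x in lborel. 1 - sqrt (1 - (norm (weak_grad \<phi> x))\<^sup>2) = BI_density (G x)"
      using BI_pair_weak_grad(1)[OF G N] by eventually_elim (simp add: BI_density_def)
  qed measurable
  then show ?thesis
    by (simp add: BI_functional_def BI_energy_def boundary_prob_integral[OF \<rho> BI_pairD(5)[OF G]])
qed

text \<open>Existence and uniqueness of the minimizer turn the \<open>THE\<close> in
  \<open>potential\<close> into a usable minimality property.\<close>

lemma potential_minimizes:
  fixes \<Omega> :: "'a::euclidean_space set"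
  assumes \<rho>: "\<rho> \<in> boundary_prob \<Omega>" and N: "DIM('a) \<ge> 3"
  shows "potential \<Omega> \<rho> \<in> BI_space"
    "\<psi> \<in> BI_space \<Longrightarrow> BI_functional \<Omega> \<rho> (potential \<Omega> \<rho>) \<le> BI_functional \<Omega> \<rho> \<psi>"
proof -
  interpret borel_prob \<rho> by (rule boundary_prob_borel_prob[OF \<rho> N])
  note eq = BI_functional_eq_BI_energy[OF \<rho> _ N]
  have amin: "is_arg_min (BI_functional \<Omega> \<rho>) (\<lambda>\<phi>. \<phi> \<in> BI_space) \<phi> \<longleftrightarrow>
      \<phi> \<in> BI_space \<and> (\<forall>\<psi>\<in>BI_space. BI_functional \<Omega> \<rho> \<phi> \<le> BI_functional \<Omega> \<rho> \<psi>)" for \<phi>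
    by (auto simp: is_arg_min_def not_less)
  obtain \<phi> G where G: "BI_pair \<phi> G" and "\<forall>\<xi> K. BI_pair \<xi> K \<longrightarrow> BI_energy \<rho> \<phi> G \<le> BI_energy \<rho> \<xi> K"
    using BI_energy_minimizer_exists by (elim exE conjE)
  then have mn: "BI_energy \<rho> \<phi> G \<le> BI_energy \<rho> \<xi> K" if "BI_pair \<xi> K" for \<xi> K
    using that by simp
  have "\<exists>!\<phi>. is_arg_min (BI_functional \<Omega> \<rho>) (\<lambda>\<phi>. \<phi> \<in> BI_space) \<phi>"
    unfolding amin
  proof (rule ex1I[of _ \<phi>])
    have "BI_functional \<Omega> \<rho> \<phi> \<le> BI_functional \<Omega> \<rho> \<psi>" if \<psi>: "\<psi> \<in> BI_space" for \<psi>
    proof -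
      obtain H where H: "BI_pair \<psi> H" using \<psi> BI_space_iff_BI_pair[OF N, of \<psi>] by auto
      show ?thesis unfolding eq[OF G] eq[OF H] by (rule mn[OF H])
    qed
    then show "\<phi> \<in> BI_space \<and> (\<forall>\<psi>\<in>BI_space. BI_functional \<Omega> \<rho> \<phi> \<le> BI_functional \<Omega> \<rho> \<psi>)"
      using G BI_space_iff_BI_pair[OF N, of \<phi>] by auto
    fix \<psi> assume \<psi>: "\<psi> \<in> BI_space \<and> (\<forall>\<xi>\<in>BI_space. BI_functional \<Omega> \<rho> \<psi> \<le> BI_functional \<Omega> \<rho> \<xi>)"
    then obtain H where H: "BI_pair \<psi> H" using BI_space_iff_BI_pair[OF N, of \<psi>] by auto
    have "BI_energy \<rho> \<psi> H \<le> BI_energy \<rho> \<xi> K" if K: "BI_pair \<xi> K" for \<xi> K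
    proof -
      have "\<xi> \<in> BI_space" using K BI_space_iff_BI_pair[OF N, of \<xi>] by auto
      then have "BI_functional \<Omega> \<rho> \<psi> \<le> BI_functional \<Omega> \<rho> \<xi>" using \<psi> by simp
      then show ?thesis unfolding eq[OF K] eq[OF H] .
    qed
    then show "\<psi> = \<phi>" by (rule BI_energy_minimizer_unique[OF H G _ mn])
  qed
  from theI'[OF this] have "is_arg_min (BI_functional \<Omega> \<rho>) (\<lambda>\<phi>. \<phi> \<in> BI_space) (potential \<Omega> \<rho>)"
    by (simp add: potential_def)
  then show "potential \<Omega> \<rho> \<in> BI_space"
    "\<psi> \<in> BI_space \<Longrightarrow> BI_functional \<Omega> \<rho> (potential \<Omega> \<rho>) \<le> BI_functional \<Omega> \<rho> \<psi>"
    unfolding amin by auto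
qed

text \<open>By minimality of the potential. The bound serves to test one fixed function against a
  whole sequence of measures.\<close>

lemma electrostatic_energy_ge:
  fixes \<Omega> :: "'a::euclidean_space set"
  assumes "\<rho> \<in> boundary_prob \<Omega>" "DIM('a) \<ge> 3" "\<psi> \<in> BI_space"
  shows "- BI_functional \<Omega> \<rho> \<psi> \<le> electrostatic_energy \<Omega> \<rho>"
  using potential_minimizes(2)[OF assms] by (simp add: electrostatic_energy_def)

text \<open>Tested with the zero function. The infimum over real energies needs a lower bound to be
  meaningful.\<close>

lemma electrostatic_energy_nonneg:
  fixes \<Omega> :: "'a::euclidean_space set"
  assumes \<rho>: "\<rho> \<in> boundary_prob \<Omega>" and N: "DIM('a) \<ge> 3"
  shows "0 \<le> electrostatic_energy \<Omega> \<rho>"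
proof -
  have "(\<lambda>x::'a. 0) \<in> BI_space" using BI_pair_zero BI_space_iff_BI_pair[OF N] by blast
  from electrostatic_energy_ge[OF \<rho> N this]
  show ?thesis by (simp add: BI_functional_eq_BI_energy[OF \<rho> BI_pair_zero N] BI_energy_def BI_density_def)
qed

lemma equilibrium_measure_exists:
  fixes \<Omega> :: "'a::euclidean_space set"
  assumes N: "DIM('a) \<ge> 3" and \<Omega>: "\<Omega> \<noteq> {}" "bounded \<Omega>"
  shows "\<exists>\<rho>\<^sub>0\<in>boundary_prob \<Omega>.
    electrostatic_energy \<Omega> \<rho>\<^sub>0 = (INF \<rho>\<in>boundary_prob \<Omega>. electrostatic_energy \<Omega> \<rho>)"
proof -
  let ?E = "electrostatic_energy \<Omega>"
  define m where "m = (INF \<rho>\<in>boundary_prob \<Omega>. ?E \<rho>)"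
  have bdd: "bdd_below (?E ` boundary_prob \<Omega>)"
    by (rule bdd_belowI[of _ 0]) (use electrostatic_energy_nonneg[OF _ N] in auto)
  have K: "compact (frontier \<Omega>)" using \<Omega>(2) by (rule compact_frontier_bounded)
  \<comment> \<open>The frontier of a nonempty proper subset of a connected space is nonempty; the
    point mass found there makes the infimum range over a nonempty set.\<close>
  have "\<Omega> \<noteq> UNIV" using \<Omega>(2) not_bounded_UNIV by auto
  then obtain x where x: "x \<in> frontier \<Omega>" using \<Omega>(1) frontier_eq_empty[of \<Omega>] by blast
  have "return borel x \<in> boundary_prob \<Omega>"
    using x by (simp add: boundary_prob_def borel_closed borel_comp)
  then have ne: "?E ` boundary_prob \<Omega> \<noteq> {}" by blast
  define e where "e n = inverse (real (Suc n))" for n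
  have e: "e n > 0" for n by (simp add: e_def)
  have e0: "e \<longlonglongrightarrow> 0" unfolding e_def[abs_def] by (rule LIMSEQ_inverse_real_of_nat)
  have "\<exists>\<rho>. \<rho> \<in> boundary_prob \<Omega> \<and> ?E \<rho> < m + e n" for n
  proof -
    have "Inf (?E ` boundary_prob \<Omega>) < m + e n" using e[of n] by (simp add: m_def)
    then show ?thesis using cInf_lessD[OF ne] by blast
  qed
  then have "\<forall>n. \<exists>\<rho>. \<rho> \<in> boundary_prob \<Omega> \<and> ?E \<rho> < m + e n" by blast
  from choice[OF this] obtain \<rho> where "\<forall>n. \<rho> n \<in> boundary_prob \<Omega> \<and> ?E (\<rho> n) < m + e n" ..
  then have \<rho>: "\<rho> n \<in> boundary_prob \<Omega>" and \<rho>m: "?E (\<rho> n) < m + e n" for n by auto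
  have "sets (\<rho> n) = sets borel" "emeasure (\<rho> n) (frontier \<Omega>) = 1" "emeasure (\<rho> n) (- frontier \<Omega>) = 0" for n
    using \<rho>[of n] by (auto simp: boundary_prob_def)
  from compact_probabilities_convergent_subsequence[where \<rho>=\<rho>, OF K this] obtain r \<mu> where
    r: "strict_mono (r :: nat \<Rightarrow> nat)" and \<mu>s: "sets \<mu> = sets borel" "emeasure \<mu> (frontier \<Omega>) = 1" "emeasure \<mu> (- frontier \<Omega>) = 0"
    and conv: "\<forall>f :: 'a \<Rightarrow> real. continuous_on UNIV f \<longrightarrow> bounded (range f) \<longrightarrow>
      (\<lambda>n. LINT x|\<rho> (r n). f x) \<longlonglongrightarrow> (LINT x|\<mu>. f x)"
    by (elim exE conjE)
  have \<mu>: "\<mu> \<in> boundary_prob \<Omega>" using \<mu>s by (simp add: boundary_prob_def)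
  \<comment> \<open>From the supremum that represents the energy, one competitor is taken: the
    potential of the limit measure. It stays fixed while the measures converge, and at \<mu> it
    attains the energy.\<close>
  define \<phi> where "\<phi> = potential \<Omega> \<mu>"
  have \<phi>: "\<phi> \<in> BI_space" unfolding \<phi>_def by (rule potential_minimizes(1)[OF \<mu> N])
  then obtain G where G: "BI_pair \<phi> G" using BI_space_iff_BI_pair[OF N] by blast
  obtain B where B: "\<And>x. \<bar>\<phi> x\<bar> \<le> B" using BI_pair_bounded[OF N G] by blast
  have "bounded (range \<phi>)" unfolding bounded_iff by (intro exI[of _ B]) (use B in auto)
  then have "(\<lambda>n. LINT x|\<rho> (r n). \<phi> x) \<longlonglongrightarrow> (LINT x|\<mu>. \<phi> x)"
    using conv BI_pairD(4)[OF G] by simp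
  then have "(\<lambda>n. - BI_energy (\<rho> (r n)) \<phi> G) \<longlonglongrightarrow> - BI_energy \<mu> \<phi> G"
    unfolding BI_energy_def by (intro tendsto_intros)
  moreover have "(\<lambda>n. m + e (r n)) \<longlonglongrightarrow> m + 0"
    using LIMSEQ_subseq_LIMSEQ[OF e0 r] by (intro tendsto_intros) (simp add: comp_def)
  moreover have "- BI_energy (\<rho> (r n)) \<phi> G \<le> m + e (r n)" for n
    using electrostatic_energy_ge[OF \<rho> N \<phi>, of "r n"] \<rho>m[of "r n"]
    by (simp add: BI_functional_eq_BI_energy[OF \<rho> G N])
  ultimately have "- BI_energy \<mu> \<phi> G \<le> m + 0" by (intro LIMSEQ_le) auto
  then have "?E \<mu> \<le> m"
    by (simp add: electrostatic_energy_def \<phi>_def[symmetric] BI_functional_eq_BI_energy[OF \<mu> G N])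
  moreover have "m \<le> ?E \<mu>" unfolding m_def by (rule cINF_lower[OF bdd \<mu>])
  ultimately show ?thesis using \<mu> unfolding m_def by (intro bexI[of _ \<mu>]) auto
qed

theorem theorem4p1:
  fixes \<Omega> :: "(real ^ 'n) set"
  assumes "CARD('n) \<ge> 3"
    and "open \<Omega>" and "connected \<Omega>" and "\<Omega> \<noteq> {}" and "bounded \<Omega>"
  shows "\<exists>\<rho>\<^sub>0\<in>boundary_prob \<Omega>.
           electrostatic_energy \<Omega> \<rho>\<^sub>0 = (INF \<rho>\<in>boundary_prob \<Omega>. electrostatic_energy \<Omega> \<rho>)"
  using assms by (intro equilibrium_measure_exists) auto

end
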